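(* Let $\theta$ and $\phi$ be nonconstant inner functions. If $X$ is a densely defined linear transformation from $\mathcal{H}(\theta)$ to $\mathcal{H}(\phi)$ intertwining $u(S(\phi))$ and $u(S(\theta))$ for every $u\in H^\infty$, then $X$ is closable, and its closure is $\overline{X}=v(S(\phi))^{-1}u(S(\phi))P_{\mathcal{H}(\phi)}|\mathcal{H}(\theta)$ for some $u,v\in H^\infty$ with $\phi\mid u\theta$ and $v\wedge(\theta\vee\phi)\equiv1$.
   Context: $S$ is the unilateral shift on $H^2$; $\mathcal{H}(\theta)=H^2\ominus\theta H^2$, $S(\theta)^*=S^*|\mathcal{H}(\theta)$, and $u(S(\theta))=P_{\mathcal{H}(\theta)}u(S)|\mathcal{H}(\theta)$ where $u(S)$ is multiplication by $u$. A densely defined linear transformation $X$ with domain $\mathcal{D}(X)\subset\mathcal{H}_1$ intertwines $T_2\in\mathcal{B}(\mathcal{H}_2)$ and $T_1\in\mathcal{B}(\mathcal{H}_1)$ if $\mathcal{D}(X)$ is dense, invariant under $T_1$, and $T_2X=XT_1$ on $\mathcal{D}(X)$. For $f,g\in H^\infty$, $f\mid g$ means $g=fh$ with $h\in H^\infty$; $\wedge,\vee$ denote greatest common inner divisor and least common inner multiple; $\equiv$ means equality up to a unimodular constant. *)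

theory Defs
  imports "HOL-Complex_Analysis.Complex_Analysis"
begin

text \<open>Hardy spaces on the open unit disc \<open>\<bbbD> = ball 0 1\<close>.
  Elements of H^2 are holomorphic functions on the disc with square-summable
  Taylor coefficients; to have canonical representatives they are required to
  vanish outside the disc.  H^infinity functions are only considered on the disc.\<close>

definition h2_coeff :: "(complex \<Rightarrow> complex) \<Rightarrow> nat \<Rightarrow> complex" where
  "h2_coeff f n = (deriv ^^ n) f 0 / of_nat (fact n)"

definition H2 :: "(complex \<Rightarrow> complex) set" where
  "H2 = {f. f holomorphic_on ball 0 1 \<and> (\<forall>z. z \<notin> ball 0 1 \<longrightarrow> f z = 0)
            \<and> summable (\<lambda>n. (norm (h2_coeff f n))\<^sup>2)}"

definition h2_inner :: "(complex \<Rightarrow> complex) \<Rightarrow> (complex \<Rightarrow> complex) \<Rightarrow> complex" where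
  "h2_inner f g = (\<Sum>n. h2_coeff f n * cnj (h2_coeff g n))"

definition h2_norm :: "(complex \<Rightarrow> complex) \<Rightarrow> real" where
  "h2_norm f = sqrt (\<Sum>n. (norm (h2_coeff f n))\<^sup>2)"

definition Hinf :: "(complex \<Rightarrow> complex) set" where
  "Hinf = {u. u holomorphic_on ball 0 1 \<and> (\<exists>B. \<forall>z\<in>ball 0 1. norm (u z) \<le> B)}"

definition inner_fn :: "(complex \<Rightarrow> complex) \<Rightarrow> bool" where
  "inner_fn \<theta> \<longleftrightarrow> \<theta> \<in> Hinf \<and>
     (AE t in lborel. t \<in> {0..2*pi} \<longrightarrow>
        (\<exists>\<zeta>. ((\<lambda>r::real. \<theta> (of_real r * cis t)) \<longlongrightarrow> \<zeta>) (at_left 1) \<and> norm \<zeta> = 1))"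

definition nonconstant_on_disc :: "(complex \<Rightarrow> complex) \<Rightarrow> bool" where
  "nonconstant_on_disc f \<longleftrightarrow> \<not> (\<exists>c. \<forall>z\<in>ball 0 1. f z = c)"

definition hinf_dvd :: "(complex \<Rightarrow> complex) \<Rightarrow> (complex \<Rightarrow> complex) \<Rightarrow> bool" where
  "hinf_dvd f g \<longleftrightarrow> (\<exists>h\<in>Hinf. \<forall>z\<in>ball 0 1. g z = f z * h z)"

definition is_gcid :: "(complex \<Rightarrow> complex) \<Rightarrow> (complex \<Rightarrow> complex) \<Rightarrow> (complex \<Rightarrow> complex) \<Rightarrow> bool" where
  "is_gcid \<delta> f g \<longleftrightarrow> inner_fn \<delta> \<and> hinf_dvd \<delta> f \<and> hinf_dvd \<delta> g \<and>
     (\<forall>\<omega>. inner_fn \<omega> \<and> hinf_dvd \<omega> f \<and> hinf_dvd \<omega> g \<longrightarrow> hinf_dvd \<omega> \<delta>)"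

definition is_lcim :: "(complex \<Rightarrow> complex) \<Rightarrow> (complex \<Rightarrow> complex) \<Rightarrow> (complex \<Rightarrow> complex) \<Rightarrow> bool" where
  "is_lcim \<psi> f g \<longleftrightarrow> inner_fn \<psi> \<and> hinf_dvd f \<psi> \<and> hinf_dvd g \<psi> \<and>
     (\<forall>\<omega>. inner_fn \<omega> \<and> hinf_dvd f \<omega> \<and> hinf_dvd g \<omega> \<longrightarrow> hinf_dvd \<psi> \<omega>)"

definition model_space :: "(complex \<Rightarrow> complex) \<Rightarrow> (complex \<Rightarrow> complex) set" where
  "model_space \<theta> = {f \<in> H2. \<forall>g\<in>H2. h2_inner f (\<lambda>z. \<theta> z * g z) = 0}"

definition proj :: "(complex \<Rightarrow> complex) set \<Rightarrow> (complex \<Rightarrow> complex) \<Rightarrow> (complex \<Rightarrow> complex)" where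
  "proj K f = (THE p. p \<in> K \<and> (\<forall>k\<in>K. h2_inner (\<lambda>z. f z - p z) k = 0))"

text \<open>\<open>u(S(\<theta>)) = P_{\<H>(\<theta>)} u(S) |\<H>(\<theta>)\<close>.\<close>
definition compr :: "(complex \<Rightarrow> complex) \<Rightarrow> (complex \<Rightarrow> complex) \<Rightarrow> (complex \<Rightarrow> complex) \<Rightarrow> (complex \<Rightarrow> complex)" where
  "compr \<theta> u f = proj (model_space \<theta>) (\<lambda>z. u z * f z)"

definition dense_linear :: "(complex \<Rightarrow> complex) set \<Rightarrow> (complex \<Rightarrow> complex) set
     \<Rightarrow> (complex \<Rightarrow> complex) set \<Rightarrow> ((complex \<Rightarrow> complex) \<Rightarrow> (complex \<Rightarrow> complex)) \<Rightarrow> bool" where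
  "dense_linear H1 H2' D X \<longleftrightarrow>
     D \<subseteq> H1 \<and> (\<lambda>_. 0) \<in> D \<and> (\<forall>f\<in>D. \<forall>g\<in>D. (\<lambda>z. f z + g z) \<in> D) \<and> (\<forall>c. \<forall>f\<in>D. (\<lambda>z. c * f z) \<in> D) \<and>
     (\<forall>f\<in>H1. \<forall>e>0. \<exists>d\<in>D. h2_norm (\<lambda>z. f z - d z) < e) \<and>
     (\<forall>f\<in>D. X f \<in> H2') \<and>
     (\<forall>f\<in>D. \<forall>g\<in>D. X (\<lambda>z. f z + g z) = (\<lambda>z. X f z + X g z)) \<and> (\<forall>c. \<forall>f\<in>D. X (\<lambda>z. c * f z) = (\<lambda>z. c * X f z))"

definition intertwines :: "(complex \<Rightarrow> complex) set \<Rightarrow> ((complex \<Rightarrow> complex) \<Rightarrow> (complex \<Rightarrow> complex))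
     \<Rightarrow> ((complex \<Rightarrow> complex) \<Rightarrow> (complex \<Rightarrow> complex)) \<Rightarrow> ((complex \<Rightarrow> complex) \<Rightarrow> (complex \<Rightarrow> complex)) \<Rightarrow> bool" where
  "intertwines D X T2 T1 \<longleftrightarrow> (\<forall>f\<in>D. T1 f \<in> D) \<and> (\<forall>f\<in>D. T2 (X f) = X (T1 f))"

definition graph_of :: "(complex \<Rightarrow> complex) set \<Rightarrow> ((complex \<Rightarrow> complex) \<Rightarrow> (complex \<Rightarrow> complex))
     \<Rightarrow> ((complex \<Rightarrow> complex) \<times> (complex \<Rightarrow> complex)) set" where
  "graph_of D X = {(f, X f) | f. f \<in> D}"

definition graph_closure :: "((complex \<Rightarrow> complex) \<times> (complex \<Rightarrow> complex)) set
     \<Rightarrow> ((complex \<Rightarrow> complex) \<times> (complex \<Rightarrow> complex)) set" where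
  "graph_closure G = {(f, g). f \<in> H2 \<and> g \<in> H2 \<and>
     (\<exists>s. (\<forall>n. s n \<in> G) \<and> (\<lambda>n. h2_norm (\<lambda>z. fst (s n) z - f z)) \<longlonglongrightarrow> 0
                        \<and> (\<lambda>n. h2_norm (\<lambda>z. snd (s n) z - g z)) \<longlonglongrightarrow> 0)}"

definition closable :: "(complex \<Rightarrow> complex) set \<Rightarrow> ((complex \<Rightarrow> complex) \<Rightarrow> (complex \<Rightarrow> complex)) \<Rightarrow> bool" where
  "closable D X \<longleftrightarrow> (\<forall>f g1 g2. (f, g1) \<in> graph_closure (graph_of D X) \<and>
                                (f, g2) \<in> graph_closure (graph_of D X) \<longrightarrow> g1 = g2)"

end

theory Submission
  imports Defs
begin

text \<open>A module map between \<open>\<H>(\<theta>)\<close> and \<open>\<H>(\<phi>)\<close> lifts to a relation \<open>G \<subseteq> H\<^sup>2 \<times> H\<^sup>2\<close> that is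
  invariant under multiplication by bounded analytic functions and contains \<open>\<theta>H\<^sup>2 \<times> \<phi>H\<^sup>2\<close>.  For
  bounded pairs \<open>(f\<^sub>1, g\<^sub>1), (f\<^sub>2, g\<^sub>2)\<close> in \<open>G\<close>, both \<open>(f\<^sub>1f\<^sub>2, f\<^sub>2g\<^sub>1)\<close> and \<open>(f\<^sub>1f\<^sub>2, f\<^sub>1g\<^sub>2)\<close> belong to \<open>G\<close>, so
  the determinant \<open>f\<^sub>2g\<^sub>1 - f\<^sub>1g\<^sub>2\<close> is divisible by \<open>\<phi>\<close>.  This condition is closed and, the domain
  being dense, forces \<open>g \<in> \<phi>H\<^sup>2\<close> whenever \<open>(\<theta>h, g)\<close> is in the closure: the map is closable.
  Arbitrary pairs are approximated by bounded ones through multiplication by \<open>1 / (1 + \<epsilon>W)\<close>, where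
  \<open>Re W\<close> majorizes \<open>\<bar>f\<bar>\<^sup>2 + \<bar>g\<bar>\<^sup>2\<close>.  A Baire category argument in the closure of \<open>G\<close> yields a bounded
  pair \<open>(v, u)\<close> such that \<open>vH\<^sup>2 + \<psi>H\<^sup>2\<close> is dense, where \<open>\<psi> = \<theta> \<or> \<phi>\<close>; the determinant condition
  with this pair then describes the closure, because \<open>(vf, vg)\<close> and \<open>(\<psi>f, \<psi>g)\<close> both lie in it as soon as
  \<open>vg - uf \<in> \<phi>H\<^sup>2\<close>.  The least common multiple itself comes from Beurling's theorem applied to
  \<open>\<theta>H\<^sup>2 \<inter> \<phi>H\<^sup>2\<close>, together with Fatou's theorem on radial limits.\<close>

section \<open>Square-summable sequences as a Hilbert space\<close>

text \<open>Elements of the domain are merely square-summable, so two of them cannot be multiplied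
  inside H^2; arguments with products run on bounded pairs and are carried over by limits. Passing
  from the model spaces to H^2 turns the compressions into plain multiplications, at the price of a
  relation that is single-valued only modulo \<phi> H^2. One denominator has to be coprime to the
  least common multiple, whereas density of the domain only says that all first coordinates together
  have no common inner factor with it; genericity and completeness of the closed graph concentrate
  this joint property in a single pair. Inner functions are treated as isometric multipliers
  (\<open>isom_mult\<close>), a notion that passes to cofactors and that Beurling's theorem produces
  without boundary values. Radial limits matter only where \<open>inner_fn\<close> itself is met:
  bounded convergence derives isometry from it, and Fatou's theorem recovers it for the least common
  multiple.\<close>

lemma orthogonal_projection_exists:
  fixes K :: "'a::{real_inner,complete_space} set"
  assumes "closed K" "subspace K"
  obtains p where "p \<in> K" "\<And>k. k \<in> K \<Longrightarrow> inner (f - p) k = 0"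
proof -
  define d where "d = (INF k\<in>K. (norm (f - k))\<^sup>2)"
  have ne: "K \<noteq> {}" using assms(2) subspace_0 by blast
  have bdd: "bdd_below ((\<lambda>k. (norm (f - k))\<^sup>2) ` K)" by (rule bdd_belowI[of _ 0]) auto
  have d_le: "d \<le> (norm (f - k))\<^sup>2" if "k \<in> K" for k
    unfolding d_def using bdd that by (rule cINF_lower)
  have "\<exists>k\<in>K. (norm (f - k))\<^sup>2 < d + 1 / real (Suc n)" for n
  proof (rule ccontr)
    assume "\<not> ?thesis"
    then have "d + 1 / real (Suc n) \<le> d"
      unfolding d_def by (intro cINF_greatest ne) (auto simp: not_less)
    then show False by simp
  qed
  then obtain s where s: "\<And>n. s n \<in> K" "\<And>n. (norm (f - s n))\<^sup>2 < d + 1 / real (Suc n)" by metis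
  \<comment> \<open>Parallelogram law around \<open>f\<close>. The midpoint of two near-minimizers
    lies in \<open>K\<close>, so its squared distance is at least \<open>d\<close>, which forces the
    two points together.\<close>
  have par: "(norm (x - y))\<^sup>2 = 2 * (norm (f - x))\<^sup>2 + 2 * (norm (f - y))\<^sup>2 - 4 * (norm (f - (1/2) *\<^sub>R (x + y)))\<^sup>2"
    for x y by (simp add: power2_norm_eq_inner inner_simps inner_commute algebra_simps)
  have est: "(norm (s m - s n))\<^sup>2 \<le> 2 / real (Suc m) + 2 / real (Suc n)" for m n
  proof -
    have "(1/2) *\<^sub>R (s m + s n) \<in> K" using s assms(2) by (intro subspace_scale subspace_add)
    from d_le[OF this] show ?thesis using s(2)[of m] s(2)[of n] unfolding par[of "s m" "s n"] by simp
  qed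
  have "Cauchy s"
  proof (rule metric_CauchyI)
    fix e :: real assume e: "0 < e"
    obtain M where M: "4 / e\<^sup>2 < real M" using reals_Archimedean2 by blast
    show "\<exists>M. \<forall>m\<ge>M. \<forall>n\<ge>M. dist (s m) (s n) < e"
    proof (intro exI[of _ M] allI impI)
      fix m n assume mn: "M \<le> m" "M \<le> n"
      have "4 / e\<^sup>2 < real (Suc M)" using M by simp
      then have *: "4 / real (Suc M) < e\<^sup>2" using e by (simp add: field_simps)
      have "2 / real (Suc m) \<le> 2 / real (Suc M)" "2 / real (Suc n) \<le> 2 / real (Suc M)"
        using mn by (auto intro!: divide_left_mono)
      then have "(norm (s m - s n))\<^sup>2 < e\<^sup>2" using est[of m n] * by simp
      then show "dist (s m) (s n) < e" using e by (simp add: dist_norm power2_less_imp_less)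
    qed
  qed
  then obtain p where p: "s \<longlonglongrightarrow> p" using Cauchy_convergent convergent_def by blast
  have pK: "p \<in> K" using closed_sequentially[OF assms(1) _ p] s by blast
  have "(\<lambda>n. (norm (f - s n))\<^sup>2) \<longlonglongrightarrow> (norm (f - p))\<^sup>2" by (intro tendsto_intros p)
  moreover have "(\<lambda>n. d + 1 / real (Suc n)) \<longlonglongrightarrow> d + 0"
    by (intro tendsto_intros lim_inverse_n'[THEN LIMSEQ_Suc])
  ultimately have "(norm (f - p))\<^sup>2 \<le> d + 0"
    by (rule LIMSEQ_le) (use s(2) less_imp_le in blast)
  then have le: "(norm (f - p))\<^sup>2 \<le> d" by simp
  have "inner (f - p) k = 0" if k: "k \<in> K" for k
  proof (cases "k = 0")
    case False
    \<comment> \<open>This \<open>c\<close> minimizes the quadratic polynomial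
      \<open>(norm (f - (p + c *\<^sub>R k)))\<^sup>2\<close>; since \<open>p\<close> is already
      optimal, the gain must vanish.\<close>
    define c where "c = inner (f - p) k / inner k k"
    have pc: "p + c *\<^sub>R k \<in> K" using pK k assms(2) by (intro subspace_add subspace_scale)
    have kk: "inner k k \<noteq> 0" using False by simp
    have "(norm (f - (p + c *\<^sub>R k)))\<^sup>2 = (norm (f - p))\<^sup>2 - 2 * c * inner (f - p) k + c * c * inner k k"
      by (simp add: power2_norm_eq_inner inner_simps inner_commute algebra_simps)
    also have "c * c * inner k k = c * inner (f - p) k" using kk by (simp add: c_def)
    finally have "c * inner (f - p) k \<le> 0" using d_le[OF pc] le by simp
    then have "(inner (f - p) k)\<^sup>2 / inner k k \<le> 0" by (simp add: c_def power2_eq_square)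
    then have "(inner (f - p) k)\<^sup>2 \<le> 0" using kk inner_ge_zero[of k] by (simp add: divide_le_0_iff)
    then show ?thesis by simp
  qed simp
  then show ?thesis using that pK by blast
qed

lemma closed_subspace_eq_UNIV:
  fixes K :: "'a::{real_inner,complete_space} set"
  assumes "closed K" "subspace K" "\<And>b. (\<And>k. k \<in> K \<Longrightarrow> inner b k = 0) \<Longrightarrow> b = 0"
  shows "K = UNIV"
proof -
  have "f \<in> K" for f
  proof -
    obtain p where p: "p \<in> K" "\<And>k. k \<in> K \<Longrightarrow> inner (f - p) k = 0"
      using orthogonal_projection_exists[OF assms(1,2)] by blast
    have "f - p = 0" by (rule assms(3)) (rule p)
    then show "f \<in> K" using p by simp
  qed
  then show ?thesis by blast
qed

text \<open>\<open>H\<^sup>2\<close> is represented by Taylor coefficients and carries only the real inner product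
  \<open>Re \<langle>a, b\<rangle>\<close>: on subspaces closed under multiplication by \<open>\<i>\<close>, real and complex orthogonality coincide.\<close>

typedef h2 = "{a :: nat \<Rightarrow> complex. summable (\<lambda>n. (norm (a n))\<^sup>2)}"
  morphisms hcoeff h2_of
  by (rule exI[of _ "\<lambda>_. 0"]) simp

setup_lifting type_definition_h2

lemma summable_hcoeff: "summable (\<lambda>n. (norm (hcoeff a n))\<^sup>2)"
  using hcoeff[of a] by simp

text \<open>The parallelogram law bounds each term by twice the two given ones.\<close>

lemma summable_add_sq:
  fixes a b :: "nat \<Rightarrow> 'a::real_inner"
  assumes "summable (\<lambda>n. (norm (a n))\<^sup>2)" "summable (\<lambda>n. (norm (b n))\<^sup>2)"
  shows "summable (\<lambda>n. (norm (a n + b n))\<^sup>2)"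
proof (rule summable_comparison_test'[of "\<lambda>n. 2 * (norm (a n))\<^sup>2 + 2 * (norm (b n))\<^sup>2"])
  show "summable (\<lambda>n. 2 * (norm (a n))\<^sup>2 + 2 * (norm (b n))\<^sup>2)"
    using assms by (intro summable_add summable_mult)
  have "(norm (a n + b n))\<^sup>2 + (norm (a n - b n))\<^sup>2 = 2 * (norm (a n))\<^sup>2 + 2 * (norm (b n))\<^sup>2" for n
    by (simp add: power2_norm_eq_inner inner_simps inner_commute)
  moreover have "0 \<le> (norm (a n - b n))\<^sup>2" for n by simp
  ultimately have "(norm (a n + b n))\<^sup>2 \<le> 2 * (norm (a n))\<^sup>2 + 2 * (norm (b n))\<^sup>2" for n
    by (metis le_add_same_cancel1)
  then show "norm ((norm (a n + b n))\<^sup>2) \<le> 2 * (norm (a n))\<^sup>2 + 2 * (norm (b n))\<^sup>2" if "0 \<le> n" for n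
    by simp
qed

lemma summable_inner_sq:
  fixes a b :: "nat \<Rightarrow> 'a::real_inner"
  assumes "summable (\<lambda>n. (norm (a n))\<^sup>2)" "summable (\<lambda>n. (norm (b n))\<^sup>2)"
  shows "summable (\<lambda>n. inner (a n) (b n))"
proof -
  have e: "inner (a n) (b n) = ((norm (a n + b n))\<^sup>2 - (norm (a n))\<^sup>2 - (norm (b n))\<^sup>2) / 2" for n
    by (simp add: power2_norm_eq_inner inner_simps inner_commute)
  show ?thesis unfolding e using assms summable_add_sq[OF assms]
    by (intro summable_divide summable_diff)
qed

instantiation h2 :: real_vector
begin

lift_definition zero_h2 :: h2 is "\<lambda>_. 0" by simp
lift_definition plus_h2 :: "h2 \<Rightarrow> h2 \<Rightarrow> h2" is "\<lambda>a b n. a n + b n" by (rule summable_add_sq)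
lift_definition uminus_h2 :: "h2 \<Rightarrow> h2" is "\<lambda>a n. - a n" by simp
lift_definition minus_h2 :: "h2 \<Rightarrow> h2 \<Rightarrow> h2" is "\<lambda>a b n. a n - b n"
  subgoal for a b using summable_add_sq[of a "\<lambda>n. - b n"] by simp done
lift_definition scaleR_h2 :: "real \<Rightarrow> h2 \<Rightarrow> h2" is "\<lambda>r a n. r *\<^sub>R a n"
  by (simp add: power_mult_distrib summable_mult)
instance
proof
  fix a b c :: h2 and r s :: real
  show "a + b + c = a + (b + c)" by transfer (simp add: add.assoc)
  show "a + b = b + a" by transfer (simp add: add.commute)
  show "0 + a = a" by transfer simp
  show "- a + a = 0" by transfer simp
  show "a - b = a + - b" by transfer simp
  show "r *\<^sub>R (a + b) = r *\<^sub>R a + r *\<^sub>R b" by transfer (simp add: algebra_simps)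
  show "(r + s) *\<^sub>R a = r *\<^sub>R a + s *\<^sub>R a" by transfer (simp add: algebra_simps)
  show "r *\<^sub>R s *\<^sub>R a = (r * s) *\<^sub>R a" by transfer (simp add: algebra_simps)
  show "1 *\<^sub>R a = a" by transfer simp
qed

end

instantiation h2 :: real_inner
begin

definition inner_h2 :: "h2 \<Rightarrow> h2 \<Rightarrow> real" where "inner_h2 a b = (\<Sum>n. inner (hcoeff a n) (hcoeff b n))"
definition norm_h2 :: "h2 \<Rightarrow> real" where "norm_h2 a = sqrt (inner a a)"
definition dist_h2 :: "h2 \<Rightarrow> h2 \<Rightarrow> real" where "dist_h2 a b = norm (a - b)"
definition sgn_h2 :: "h2 \<Rightarrow> h2" where "sgn_h2 a = a /\<^sub>R norm a"
definition uniformity_h2 :: "(h2 \<times> h2) filter" where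
  "uniformity_h2 = (INF e\<in>{0<..}. principal {(x, y). dist x y < e})"
definition open_h2 :: "h2 set \<Rightarrow> bool" where
  "open_h2 U = (\<forall>x\<in>U. eventually (\<lambda>(x', y). x' = x \<longrightarrow> y \<in> U) uniformity)"

instance
proof
  fix a b c :: h2 and r s :: real
  note sm = summable_inner_sq[OF summable_hcoeff summable_hcoeff]
  show "dist a b = norm (a - b)" by (rule dist_h2_def)
  show "sgn a = a /\<^sub>R norm a" by (rule sgn_h2_def)
  show "uniformity = (INF e\<in>{0 <..}. principal {(x :: h2, y). dist x y < e})" by (rule uniformity_h2_def)
  show "open U = (\<forall>x\<in>U. eventually (\<lambda>(x', y). x' = x \<longrightarrow> y \<in> U) uniformity)" for U :: "h2 set"
    by (rule open_h2_def)
  show "inner a b = inner b a" by (simp add: inner_h2_def inner_commute)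
  show "inner (a + b) c = inner a c + inner b c"
    unfolding inner_h2_def by (simp add: plus_h2.rep_eq inner_add_left suminf_add sm)
  show "inner (r *\<^sub>R a) b = r * inner a b"
    unfolding inner_h2_def by (simp add: scaleR_h2.rep_eq suminf_mult sm)
  show "0 \<le> inner a a" unfolding inner_h2_def by (intro suminf_nonneg sm) auto
  show "(inner a a = 0) = (a = 0)"
  proof
    assume "inner a a = 0"
    then have "\<And>n. inner (hcoeff a n) (hcoeff a n) = 0"
      unfolding inner_h2_def using suminf_eq_zero_iff[OF sm[of a a]] by simp
    then have "hcoeff a = hcoeff 0" by (auto simp: zero_h2.rep_eq)
    then show "a = 0" by (simp add: hcoeff_inject)
  qed (simp add: inner_h2_def zero_h2.rep_eq)
  show "norm a = sqrt (inner a a)" by (rule norm_h2_def)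
qed

end

lemmas hcoeff_simps [simp] = zero_h2.rep_eq plus_h2.rep_eq uminus_h2.rep_eq minus_h2.rep_eq scaleR_h2.rep_eq

lemma h2_eqI: "(\<And>n. hcoeff a n = hcoeff b n) \<Longrightarrow> a = b"
  using hcoeff_inject by blast

lemma norm_h2_sq: "(norm (a::h2))\<^sup>2 = (\<Sum>n. (norm (hcoeff a n))\<^sup>2)"
  by (simp add: power2_norm_eq_inner inner_h2_def)

lemma sum_hcoeff_le_norm_sq: "(\<Sum>n<N. (norm (hcoeff a n))\<^sup>2) \<le> (norm a)\<^sup>2"
  unfolding norm_h2_sq by (rule sum_le_suminf[OF summable_hcoeff]) auto

lemma norm_hcoeff_le: "norm (hcoeff a n) \<le> norm a"
proof -
  have "(norm (hcoeff a n))\<^sup>2 \<le> (\<Sum>k<Suc n. (norm (hcoeff a k))\<^sup>2)"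
    by (rule member_le_sum) auto
  with sum_hcoeff_le_norm_sq[of a "Suc n"] have "(norm (hcoeff a n))\<^sup>2 \<le> (norm a)\<^sup>2" by linarith
  then show ?thesis by (rule power2_le_imp_le) simp
qed

text \<open>The usual way to build an element of \<open>h2\<close>: \<open>h2_of\<close> is
  meaningful only on square-summable sequences, and one bound on the partial sums yields both
  membership and the norm estimate.\<close>

lemma h2_of_bounded:
  assumes "\<And>N. (\<Sum>n<N. (norm (c n))\<^sup>2) \<le> C\<^sup>2" "C \<ge> 0"
  shows "hcoeff (h2_of c) = c" "norm (h2_of c) \<le> C"
proof -
  have s: "summable (\<lambda>n. (norm (c n))\<^sup>2)"
    by (rule summableI_nonneg_bounded[of _ "C\<^sup>2"]) (use assms in auto)
  then show e: "hcoeff (h2_of c) = c" by (simp add: h2_of_inverse)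
  have "(norm (h2_of c))\<^sup>2 \<le> C\<^sup>2" unfolding norm_h2_sq e
    using s assms(1) by (rule suminf_le_const)
  then show "norm (h2_of c) \<le> C" using assms(2) by (rule power2_le_imp_le)
qed

instance h2 :: complete_space
proof
  fix X :: "nat \<Rightarrow> h2" assume X: "Cauchy X"
  have "Cauchy (\<lambda>m. hcoeff (X m) k)" for k
  proof (rule metric_CauchyI)
    fix e :: real assume "e > 0"
    then obtain M where M: "\<forall>m\<ge>M. \<forall>n\<ge>M. dist (X m) (X n) < e" using X metric_CauchyD by blast
    have "dist (hcoeff (X m) k) (hcoeff (X n) k) \<le> dist (X m) (X n)" for m n
      using norm_hcoeff_le[of "X m - X n" k] by (simp add: dist_norm)
    then show "\<exists>M. \<forall>m\<ge>M. \<forall>n\<ge>M. dist (hcoeff (X m) k) (hcoeff (X n) k) < e"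
      using M by (meson le_less_trans)
  qed
  then have a: "(\<lambda>m. hcoeff (X m) k) \<longlonglongrightarrow> lim (\<lambda>m. hcoeff (X m) k)" for k
    using Cauchy_convergent convergent_LIMSEQ_iff by blast
  define a where "a k = lim (\<lambda>m. hcoeff (X m) k)" for k
  note a = a[folded a_def]
  have est: "\<exists>M. \<forall>m\<ge>M. \<forall>N. (\<Sum>k<N. (norm (hcoeff (X m) k - a k))\<^sup>2) \<le> e\<^sup>2" if e: "e > 0" for e :: real
  proof -
    obtain M where M: "\<forall>m\<ge>M. \<forall>n\<ge>M. dist (X m) (X n) < e" using X metric_CauchyD e by blast
    show ?thesis
    proof (intro exI[of _ M] allI impI)
      fix m N assume m: "M \<le> m"
      show "(\<Sum>k<N. (norm (hcoeff (X m) k - a k))\<^sup>2) \<le> e\<^sup>2"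
      proof (rule LIMSEQ_le_const2)
        show "(\<lambda>n. \<Sum>k<N. (norm (hcoeff (X m) k - hcoeff (X n) k))\<^sup>2) \<longlonglongrightarrow> (\<Sum>k<N. (norm (hcoeff (X m) k - a k))\<^sup>2)"
          by (intro tendsto_intros a)
        show "\<exists>M. \<forall>n\<ge>M. (\<Sum>k<N. (norm (hcoeff (X m) k - hcoeff (X n) k))\<^sup>2) \<le> e\<^sup>2"
        proof (intro exI[of _ M] allI impI)
          fix n assume "M \<le> n"
          then have "norm (X m - X n) < e" using M m by (simp add: dist_norm)
          then have "(norm (X m - X n))\<^sup>2 \<le> e\<^sup>2" by (simp add: power_mono)
          then show "(\<Sum>k<N. (norm (hcoeff (X m) k - hcoeff (X n) k))\<^sup>2) \<le> e\<^sup>2"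
            using sum_hcoeff_le_norm_sq[of "X m - X n" N] by simp
        qed
      qed
    qed
  qed
  obtain M where M: "\<forall>m\<ge>M. \<forall>N. (\<Sum>k<N. (norm (hcoeff (X m) k - a k))\<^sup>2) \<le> 1\<^sup>2" using est[of 1] by auto
  \<comment> \<open>The coefficientwise limit \<open>a\<close> is not yet known to be
    square-summable, but its difference from a late \<open>X M\<close> is. The limit is therefore
    obtained as \<open>X M - d M\<close>.\<close>
  define d where "d m = h2_of (\<lambda>k. hcoeff (X m) k - a k)" for m
  define L where "L = X M - d M"
  have dM: "hcoeff (d M) = (\<lambda>k. hcoeff (X M) k - a k)"
    unfolding d_def by (rule h2_of_bounded(1)[of _ 1]) (use M in auto)
  have L: "hcoeff L k = a k" for k by (simp add: L_def dM)
  have "X \<longlonglongrightarrow> L"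
  proof (rule metric_LIMSEQ_I)
    fix r :: real assume r: "r > 0"
    then obtain M where M: "\<forall>m\<ge>M. \<forall>N. (\<Sum>k<N. (norm (hcoeff (X m) k - a k))\<^sup>2) \<le> (r/2)\<^sup>2"
      using est[of "r/2"] by auto
    have "dist (X n) L < r" if "n \<ge> M" for n
    proof -
      have b: "hcoeff (d n) = (\<lambda>k. hcoeff (X n) k - a k)" "norm (d n) \<le> r/2"
        unfolding d_def by (rule h2_of_bounded[of _ "r/2"]; use M that r in auto)+
      have "X n - L = d n" by (rule h2_eqI) (simp add: b L)
      then show ?thesis using b r by (simp add: dist_norm)
    qed
    then show "\<exists>M. \<forall>n\<ge>M. dist (X n) L < r" by blast
  qed
  then show "convergent X" by (auto simp: convergent_def)
qed

section \<open>Evaluation and the Parseval identity\<close>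

text \<open>The value 0 off the disc matches the normalization in \<open>H2\<close>, so that
  \<open>fn\<close> is a bijection from \<open>h2\<close> onto \<open>H2\<close> and equality of
  functions is equality of coefficients.\<close>

definition fn :: "h2 \<Rightarrow> complex \<Rightarrow> complex" where
  "fn a z = (if norm z < 1 then (\<Sum>n. hcoeff a n * z ^ n) else 0)"

lemma summable_hcoeff_power:
  assumes "norm z < 1"
  shows "summable (\<lambda>n. norm (hcoeff a n * z ^ n))" "summable (\<lambda>n. hcoeff a n * z ^ n)"
proof -
  show "summable (\<lambda>n. norm (hcoeff a n * z ^ n))"
  proof (rule summable_comparison_test'[of "\<lambda>n. norm a * norm z ^ n" 0])
    show "summable (\<lambda>n. norm a * norm z ^ n)" using assms by (intro summable_mult summable_geometric) simp
    show "norm (norm (hcoeff a n * z ^ n)) \<le> norm a * norm z ^ n" if "0 \<le> n" for n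
      by (simp add: norm_mult norm_power mult_right_mono norm_hcoeff_le)
  qed
  then show "summable (\<lambda>n. hcoeff a n * z ^ n)" by (rule summable_norm_cancel)
qed

lemma fn_sums: "norm z < 1 \<Longrightarrow> (\<lambda>n. hcoeff a n * z ^ n) sums fn a z"
  using summable_hcoeff_power(2)[of z a] by (simp add: fn_def summable_sums)

lemma fn_outside: "\<not> norm z < 1 \<Longrightarrow> fn a z = 0"
  by (simp add: fn_def)

lemma fn_holomorphic [holomorphic_intros]: "fn a holomorphic_on ball 0 1"
  by (rule power_series_holomorphic[of 0 1 "hcoeff a"]) (simp add: fn_sums)

lemma h2_coeff_fn: "h2_coeff (fn a) n = hcoeff a n"
proof -
  define F where "F = Abs_fps (hcoeff a)"
  have "norm (1/2 :: complex) \<le> fps_conv_radius F"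
    unfolding fps_conv_radius_def F_def by (rule conv_radius_geI) (simp add: summable_hcoeff_power)
  moreover have "ereal 0 < ereal (norm (1/2 :: complex))" by simp
  ultimately have r: "fps_conv_radius F > 0" unfolding zero_ereal_def by (rule order.strict_trans2[rotated])
  have "eventually (\<lambda>z. z \<in> ball 0 (1::real)) (nhds (0::complex))" by (rule eventually_nhds_in_open) auto
  then have "eventually (\<lambda>z. eval_fps F z = fn a z) (nhds 0)"
    by eventually_elim (simp add: eval_fps_def F_def fn_def)
  with r have "fn a has_fps_expansion F" by (simp add: has_fps_expansion_def)
  from fps_nth_fps_expansion[OF this] show ?thesis by (simp add: h2_coeff_def F_def)
qed

lemma fn_in_H2: "fn a \<in> H2"
  unfolding H2_def using summable_hcoeff[of a] fn_outside[of _ a]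
  by (auto simp: h2_coeff_fn fn_holomorphic)

definition of_fn :: "(complex \<Rightarrow> complex) \<Rightarrow> h2" where
  "of_fn f = h2_of (h2_coeff f)"

lemma of_fn_fn [simp]: "of_fn (fn a) = a"
proof -
  have "h2_coeff (fn a) = hcoeff a" using h2_coeff_fn by blast
  then show ?thesis by (simp add: of_fn_def hcoeff_inverse)
qed

lemma fn_inject: "fn a = fn b \<longleftrightarrow> a = b"
  by (metis of_fn_fn)

lemma fn_of_coeff_eq:
  assumes "f holomorphic_on ball 0 1" "\<And>z. \<not> norm z < 1 \<Longrightarrow> f z = 0" "hcoeff a = h2_coeff f"
  shows "fn a = f"
proof
  fix z
  show "fn a z = f z"
  proof (cases "norm z < 1")
    case True
    have "(\<lambda>n. h2_coeff f n * z ^ n) sums f z"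
      using holomorphic_power_series[OF assms(1), of z] True by (simp add: h2_coeff_def)
    then show ?thesis using fn_sums[OF True, of a] assms(3) sums_unique2 by metis
  qed (simp add: assms fn_outside)
qed

lemma fn_of_fn: "f \<in> H2 \<Longrightarrow> fn (of_fn f) = f"
  by (rule fn_of_coeff_eq) (auto simp: H2_def of_fn_def h2_of_inverse)

lemma H2_eq_range_fn: "H2 = range fn"
proof
  show "H2 \<subseteq> range fn" using fn_of_fn by (metis rangeI subsetI)
qed (use fn_in_H2 in auto)

lemma fn_eqI:
  assumes "\<And>z. norm z < 1 \<Longrightarrow> fn a z = fn b z" shows "a = b"
proof -
  have "fn a = fn b" using assms by (intro ext) (metis fn_outside)
  then show ?thesis by (simp add: fn_inject)
qed

lemma fn_zero [simp]: "fn 0 z = 0"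
  by (simp add: fn_def)

lemma fn_add [simp]: "fn (a + b) z = fn a z + fn b z"
  using sums_unique2[OF fn_sums[of z "a + b"] , of "fn a z + fn b z"] sums_add[OF fn_sums[of z a] fn_sums[of z b]]
  by (cases "norm z < 1") (simp_all add: fn_outside algebra_simps)

lemma fn_minus [simp]: "fn (- a) z = - fn a z"
  using fn_add[of a "- a" z] by (simp add: eq_neg_iff_add_eq_0 add.commute)

lemma fn_diff [simp]: "fn (a - b) z = fn a z - fn b z"
  using fn_add[of a "- b" z] by simp

section \<open>Inner products and reproducing kernels\<close>

lemma h2_inner_fn: "h2_inner (fn a) (fn b) = (\<Sum>n. hcoeff a n * cnj (hcoeff b n))"
  by (simp add: h2_inner_def h2_coeff_fn)

lemma h2_norm_fn: "h2_norm (fn a) = norm a"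
  by (simp add: h2_norm_def h2_coeff_fn flip: norm_h2_sq)

lemma summable_hcoeff_cnj: "summable (\<lambda>n. hcoeff a n * cnj (hcoeff b n))"
proof (rule summable_comparison_test'[of "\<lambda>n. (norm (hcoeff a n))\<^sup>2 + (norm (hcoeff b n))\<^sup>2" 0])
  show "summable (\<lambda>n. (norm (hcoeff a n))\<^sup>2 + (norm (hcoeff b n))\<^sup>2)"
    by (intro summable_add summable_hcoeff)
  have "x * y \<le> x\<^sup>2 + y\<^sup>2" if "0 \<le> x" "0 \<le> y" for x y :: real
    using sum_squares_bound[of x y] mult_nonneg_nonneg[OF that] by linarith
  then show "norm (hcoeff a n * cnj (hcoeff b n)) \<le> (norm (hcoeff a n))\<^sup>2 + (norm (hcoeff b n))\<^sup>2" if "0 \<le> n" for n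
    by (simp add: norm_mult)
qed

lemma Re_h2_inner_fn: "Re (h2_inner (fn a) (fn b)) = inner a b"
  unfolding h2_inner_fn inner_h2_def
  by (subst bounded_linear.suminf[OF bounded_linear_Re summable_hcoeff_cnj])
     (simp add: inner_complex_def)

text \<open>This is \<open>c\<close> times the Szego kernel at \<open>z\<close>. The real inner
  product sees only real parts, so the scalar \<open>c\<close> is carried along to recover the full
  complex value of a function.\<close>

definition kernel :: "complex \<Rightarrow> complex \<Rightarrow> h2" where
  "kernel c z = h2_of (\<lambda>n. c * cnj z ^ n)"

lemma kernel_sums:
  assumes "norm z < 1"
  shows "(\<lambda>n. (norm (c * cnj z ^ n))\<^sup>2) sums ((norm c)\<^sup>2 / (1 - (norm z)\<^sup>2))"
proof -
  have "(norm z)\<^sup>2 < 1" using assms by (simp add: power_less_one_iff)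
  then have "(\<lambda>n. (norm c)\<^sup>2 * ((norm z)\<^sup>2) ^ n) sums ((norm c)\<^sup>2 * (1 / (1 - (norm z)\<^sup>2)))"
    by (intro sums_mult geometric_sums) simp
  moreover have "(norm (c * cnj z ^ n))\<^sup>2 = (norm c)\<^sup>2 * ((norm z)\<^sup>2) ^ n" for n
    by (simp add: norm_mult norm_power power_mult_distrib flip: power_mult) (simp add: mult.commute)
  ultimately show ?thesis by simp
qed

lemma hcoeff_kernel: "norm z < 1 \<Longrightarrow> hcoeff (kernel c z) n = c * cnj z ^ n"
  using kernel_sums[of z c] by (simp add: kernel_def h2_of_inverse sums_iff)

lemma norm_kernel:
  assumes "norm z < 1" shows "(norm (kernel c z))\<^sup>2 = (norm c)\<^sup>2 / (1 - (norm z)\<^sup>2)"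
  using kernel_sums[OF assms, of c] by (simp add: norm_h2_sq hcoeff_kernel assms sums_iff)

lemma inner_kernel:
  assumes "norm z < 1" shows "inner a (kernel c z) = Re (cnj c * fn a z)"
proof -
  have "inner a (kernel c z) = Re (\<Sum>n. hcoeff a n * cnj (hcoeff (kernel c z) n))"
    by (simp add: h2_inner_fn flip: Re_h2_inner_fn)
  also have "(\<lambda>n. hcoeff a n * cnj (hcoeff (kernel c z) n)) = (\<lambda>n. cnj c * (hcoeff a n * z ^ n))"
    using assms by (simp add: hcoeff_kernel algebra_simps)
  also have "suminf \<dots> = cnj c * fn a z"
    using sums_mult[OF fn_sums[OF assms]] by (simp add: sums_iff)
  finally show ?thesis .
qed

text \<open>Cauchy-Schwarz against the kernel at \<open>z\<close> with scalar \<open>fn a z\<close>,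
  for which the inner product becomes \<open>(norm (fn a z))\<^sup>2\<close>.\<close>

lemma norm_fn_le:
  assumes "norm z < 1" shows "norm (fn a z) \<le> norm a / sqrt (1 - (norm z)\<^sup>2)"
proof (cases "fn a z = 0")
  case False
  have pos: "0 < 1 - (norm z)\<^sup>2" using assms by (simp add: power_less_one_iff)
  have "norm (kernel (fn a z) z) = sqrt ((norm (kernel (fn a z) z))\<^sup>2)" by simp
  also have "\<dots> = norm (fn a z) / sqrt (1 - (norm z)\<^sup>2)"
    unfolding norm_kernel[OF assms] by (simp add: real_sqrt_divide)
  finally have nk: "norm (kernel (fn a z) z) = norm (fn a z) / sqrt (1 - (norm z)\<^sup>2)" .
  have "inner a (kernel (fn a z) z) = (norm (fn a z))\<^sup>2"
    unfolding inner_kernel[OF assms] by (metis Re_complex_of_real complex_norm_square mult.commute)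
  then have "(norm (fn a z))\<^sup>2 \<le> norm a * (norm (fn a z) / sqrt (1 - (norm z)\<^sup>2))"
    using norm_cauchy_schwarz[of a "kernel (fn a z) z"] nk by simp
  then have "norm (fn a z) * norm (fn a z) \<le> norm (fn a z) * (norm a / sqrt (1 - (norm z)\<^sup>2))"
    by (simp add: power2_eq_square mult.commute)
  then show ?thesis using False by (subst (asm) mult_le_cancel_left_pos) auto
qed (use assms in \<open>simp add: abs_square_le_1\<close>)

lemma tendsto_fn:
  assumes "(X \<longlongrightarrow> a) F" shows "((\<lambda>n. fn (X n) z) \<longlongrightarrow> fn a z) F"
proof (cases "norm z < 1")
  case True
  have "(norm z)\<^sup>2 < 1" using True by (simp add: power_less_one_iff)
  then have "((\<lambda>n. norm (X n - a) / sqrt (1 - (norm z)\<^sup>2)) \<longlongrightarrow> 0 / sqrt (1 - (norm z)\<^sup>2)) F"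
    using assms by (intro tendsto_divide tendsto_const tendsto_norm_zero LIM_zero) auto
  then have g: "((\<lambda>n. norm (X n - a) / sqrt (1 - (norm z)\<^sup>2)) \<longlongrightarrow> 0) F" by simp
  have "norm (fn (X n) z - fn a z) \<le> norm (X n - a) / sqrt (1 - (norm z)\<^sup>2)" for n
    using norm_fn_le[OF True, of "X n - a"] by simp
  then have "((\<lambda>n. fn (X n) z - fn a z) \<longlongrightarrow> 0) F"
    by (intro Lim_null_comparison[OF _ g] always_eventually allI)
  then show ?thesis by (rule LIM_zero_cancel)
qed (simp add: fn_outside)

section \<open>Mean squares on circles\<close>

lemma cis_has_integral:
  assumes "k \<in> \<int>" "k \<noteq> 0"
  shows "((\<lambda>t. cis (k * t)) has_integral 0) {0..2*pi}"
proof -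
  have "((\<lambda>t. cis (k * t)) has_integral (cis (k * (2*pi)) / (\<i> * of_real k) - cis (k * 0) / (\<i> * of_real k))) {0..2*pi}"
  proof (rule fundamental_theorem_of_calculus)
    show "((\<lambda>t. cis (k * t) / (\<i> * of_real k)) has_vector_derivative cis (k * x)) (at x within {0..2*pi})" for x
      unfolding has_vector_derivative_def
      by (auto intro!: derivative_eq_intros simp: assms scaleR_conv_of_real field_simps)
  qed simp
  moreover have "cis (k * (2*pi)) = 1" using cis_multiple_2pi[OF assms(1)] by (simp add: mult.commute mult.left_commute)
  ultimately show ?thesis by simp
qed

lemma trig_poly_parseval:
  "((\<lambda>t. (norm (\<Sum>n<N. c n * cis (real n * t)))\<^sup>2) has_integral 2 * pi * (\<Sum>n<N. (norm (c n))\<^sup>2)) {0..2*pi}"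
proof (induction N)
  case (Suc N)
  have ortho: "((\<lambda>t. inner (c n * cis (real n * t)) (c N * cis (real N * t))) has_integral 0) {0..2*pi}" if "n < N" for n
  proof -
    have e: "inner (c n * cis (real n * t)) (c N * cis (real N * t)) = Re (c n * cnj (c N) * cis ((real n - real N) * t))" for t
    proof -
      have "cis ((real n - real N) * t) = cis (real n * t) * cnj (cis (real N * t))"
        by (simp add: cis_cnj cis_mult algebra_simps)
      then show ?thesis by (simp add: inner_complex_def algebra_simps)
    qed
    have "bounded_linear (\<lambda>z. Re (c n * cnj (c N) * z))"
      by (rule bounded_linear_compose[OF bounded_linear_Re bounded_linear_mult_right])
    from has_integral_linear[OF cis_has_integral[of "real n - real N"] this] show ?thesis
      using that unfolding e o_def by simp
  qed
  have "((\<lambda>t. \<Sum>n<N. inner (c n * cis (real n * t)) (c N * cis (real N * t))) has_integral (\<Sum>n<N. 0)) {0..2*pi}"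
    by (intro has_integral_sum ortho) auto
  then have o: "((\<lambda>t. 2 * inner (\<Sum>n<N. c n * cis (real n * t)) (c N * cis (real N * t))) has_integral 2 * 0) {0..2*pi}"
    by (intro has_integral_mult_right) (simp add: inner_sum_left)
  have "((\<lambda>t::real. (norm (c N))\<^sup>2) has_integral 2 * pi * (norm (c N))\<^sup>2) {0..2*pi}"
    using has_integral_const_real[of "(norm (c N))\<^sup>2" 0 "2*pi"] by simp
  from has_integral_add[OF has_integral_add[OF Suc o] this]
  have "((\<lambda>t. (norm (\<Sum>n<N. c n * cis (real n * t)))\<^sup>2 + 2 * inner (\<Sum>n<N. c n * cis (real n * t)) (c N * cis (real N * t)) + (norm (c N))\<^sup>2)
    has_integral 2 * pi * (\<Sum>n<Suc N. (norm (c n))\<^sup>2)) {0..2*pi}" by (simp add: algebra_simps)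
  moreover have "(norm (x + c N * cis (real N * t)))\<^sup>2 = (norm x)\<^sup>2 + 2 * inner x (c N * cis (real N * t)) + (norm (c N))\<^sup>2" for x t
  proof -
    have "(norm (c N))\<^sup>2 = inner (c N * cis (real N * t)) (c N * cis (real N * t))"
      by (simp add: norm_mult flip: power2_norm_eq_inner)
    then show ?thesis unfolding power2_norm_eq_inner[of "x + _"] power2_norm_eq_inner[of x]
      by (simp add: inner_simps inner_commute)
  qed
  ultimately show ?case by simp
qed simp

text \<open>On a circle inside the disc the Taylor sums converge with a uniform bound, so dominated
  convergence carries Parseval's identity over from trigonometric polynomials.\<close>

lemma circle_parseval:
  assumes f: "f holomorphic_on ball 0 1" and r: "0 \<le> r" "r < 1"
  shows "(\<lambda>t. (norm (f (of_real r * cis t)))\<^sup>2) integrable_on {0..2*pi}"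
    and "(\<lambda>n. (norm (h2_coeff f n))\<^sup>2 * r ^ (2 * n)) sums
          (integral {0..2*pi} (\<lambda>t. (norm (f (of_real r * cis t)))\<^sup>2) / (2 * pi))"
proof -
  define c where "c n = h2_coeff f n * of_real r ^ n" for n
  define g where "g N t = (\<Sum>n<N. c n * cis (real n * t))" for N t
  have pw: "(\<lambda>n. h2_coeff f n * z ^ n) sums f z" if "norm z < 1" for z
    using holomorphic_power_series[OF f, of z] that by (simp add: h2_coeff_def)
  \<comment> \<open>Convergence at the intermediate radius \<open>(1 + r) / 2\<close> gives absolute
    convergence at \<open>r\<close>.\<close>
  have sc: "summable (\<lambda>n. norm (c n))"
    unfolding c_def
  proof (rule powser_insidea)
    show "summable (\<lambda>n. h2_coeff f n * of_real ((1 + r) / 2) ^ n)"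
      using pw[of "of_real ((1 + r) / 2)"] r by (simp add: sums_iff del: of_real_divide of_real_add)
    show "norm (complex_of_real r) < norm (complex_of_real ((1 + r) / 2))"
      using r by (simp del: of_real_divide of_real_add)
  qed
  have conv: "(\<lambda>N. g N t) \<longlonglongrightarrow> f (of_real r * cis t)" for t
  proof -
    have "norm (of_real r * cis t) < 1" using r by (simp add: norm_mult)
    from pw[OF this] have "(\<lambda>n. c n * cis (real n * t)) sums f (of_real r * cis t)"
      by (simp add: c_def power_mult_distrib Complex.DeMoivre mult.assoc)
    then show ?thesis by (simp add: sums_def g_def)
  qed
  have bd: "norm (g N t) \<le> (\<Sum>n. norm (c n))" for N t
  proof -
    have "norm (g N t) \<le> (\<Sum>n<N. norm (c n))"
      unfolding g_def by (rule order.trans[OF norm_sum]) (simp add: norm_mult)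
    also have "\<dots> \<le> (\<Sum>n. norm (c n))" by (rule sum_le_suminf[OF sc]) auto
    finally show ?thesis .
  qed
  have int: "((\<lambda>t. (norm (g N t))\<^sup>2) has_integral 2 * pi * (\<Sum>n<N. (norm (c n))\<^sup>2)) {0..2*pi}" for N
    unfolding g_def by (rule trig_poly_parseval)
  have *: "(\<lambda>t. (norm (f (of_real r * cis t)))\<^sup>2) integrable_on {0..2*pi}"
    "(\<lambda>N. integral {0..2*pi} (\<lambda>t. (norm (g N t))\<^sup>2)) \<longlonglongrightarrow> integral {0..2*pi} (\<lambda>t. (norm (f (of_real r * cis t)))\<^sup>2)"
  proof (rule_tac [!] dominated_convergence[where h = "\<lambda>_. (\<Sum>n. norm (c n))\<^sup>2"])
    show "(\<lambda>t. (norm (g N t))\<^sup>2) integrable_on {0..2*pi}" for N using int by blast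
    then show "(\<lambda>t. (norm (g N t))\<^sup>2) integrable_on {0..2*pi}" for N .
    show "norm ((norm (g N t))\<^sup>2) \<le> (\<Sum>n. norm (c n))\<^sup>2" for N t using bd[of N t] by (simp add: power_mono)
    then show "norm ((norm (g N t))\<^sup>2) \<le> (\<Sum>n. norm (c n))\<^sup>2" for N t .
    show "(\<lambda>N. (norm (g N t))\<^sup>2) \<longlonglongrightarrow> (norm (f (of_real r * cis t)))\<^sup>2" for t by (intro tendsto_intros conv)
    then show "(\<lambda>N. (norm (g N t))\<^sup>2) \<longlonglongrightarrow> (norm (f (of_real r * cis t)))\<^sup>2" for t .
  qed auto
  show "(\<lambda>t. (norm (f (of_real r * cis t)))\<^sup>2) integrable_on {0..2*pi}" by (rule *(1))
  have "(\<lambda>N. 2 * pi * (\<Sum>n<N. (norm (c n))\<^sup>2) / (2 * pi)) \<longlonglongrightarrow> integral {0..2*pi} (\<lambda>t. (norm (f (of_real r * cis t)))\<^sup>2) / (2 * pi)"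
    using *(2) unfolding integral_unique[OF int] by (intro tendsto_intros) auto
  then have "(\<lambda>N. (\<Sum>n<N. (norm (c n))\<^sup>2)) \<longlonglongrightarrow> integral {0..2*pi} (\<lambda>t. (norm (f (of_real r * cis t)))\<^sup>2) / (2 * pi)"
    by simp
  moreover have "(norm (c n))\<^sup>2 = (norm (h2_coeff f n))\<^sup>2 * r ^ (2 * n)" for n
    using r by (simp add: c_def norm_mult norm_power power_mult_distrib power_mult[symmetric] mult.commute)
  ultimately show "(\<lambda>n. (norm (h2_coeff f n))\<^sup>2 * r ^ (2 * n)) sums
          (integral {0..2*pi} (\<lambda>t. (norm (f (of_real r * cis t)))\<^sup>2) / (2 * pi))"
    by (simp add: sums_def)
qed

section \<open>Bounded analytic multipliers\<close>

lemma HinfI: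
  "u holomorphic_on ball 0 1 \<Longrightarrow> (\<And>z. norm z < 1 \<Longrightarrow> norm (u z) \<le> B) \<Longrightarrow> u \<in> Hinf"
  unfolding Hinf_def by (auto intro!: exI[of _ B])

lemma Hinf_holomorphic: "u \<in> Hinf \<Longrightarrow> u holomorphic_on ball 0 1"
  unfolding Hinf_def by auto

lemma Hinf_bound:
  assumes "u \<in> Hinf"
  obtains B where "B > 0" "\<And>z. norm z < 1 \<Longrightarrow> norm (u z) \<le> B"
proof -
  obtain B where B: "\<forall>z\<in>ball 0 1. norm (u z) \<le> B" using assms unfolding Hinf_def by auto
  have "norm (u z) \<le> max B 1" if "norm z < 1" for z using B that by force
  then show ?thesis using that[of "max B 1"] by auto
qed

lemma Hinf_const [simp]: "(\<lambda>_. c) \<in> Hinf"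
  by (rule HinfI[of _ "norm c"]) auto

lemma Hinf_id [simp]: "(\<lambda>z. z) \<in> Hinf"
  by (rule HinfI[of _ 1]) auto

lemma Hinf_mult [simp]:
  assumes "u \<in> Hinf" "v \<in> Hinf" shows "(\<lambda>z. u z * v z) \<in> Hinf"
proof -
  obtain B C where B: "B > 0" "\<And>z. norm z < 1 \<Longrightarrow> norm (u z) \<le> B"
    and C: "C > 0" "\<And>z. norm z < 1 \<Longrightarrow> norm (v z) \<le> C"
    using assms Hinf_bound by metis
  show ?thesis
    by (rule HinfI[of _ "B * C"])
       (use B C assms in \<open>auto intro!: holomorphic_on_mult mult_mono simp: Hinf_holomorphic norm_mult less_imp_le\<close>)
qed

lemma Hinf_add [simp]:
  assumes "u \<in> Hinf" "v \<in> Hinf" shows "(\<lambda>z. u z + v z) \<in> Hinf"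
proof -
  obtain B C where B: "B > 0" "\<And>z. norm z < 1 \<Longrightarrow> norm (u z) \<le> B"
    and C: "C > 0" "\<And>z. norm z < 1 \<Longrightarrow> norm (v z) \<le> C"
    using assms Hinf_bound by metis
  show ?thesis
    by (rule HinfI[of _ "B + C"])
       (use B C assms in \<open>auto intro!: holomorphic_on_add norm_triangle_mono simp: Hinf_holomorphic\<close>)
qed

lemma Hinf_poly [simp]: "poly p \<in> Hinf"
proof (induction p)
  case (pCons c p)
  have "poly (pCons c p) = (\<lambda>z. c + z * poly p z)" by auto
  then show ?case using pCons by (simp only:) simp
qed simp

lemma Hinf_cong: "u \<in> Hinf \<Longrightarrow> (\<And>z. norm z < 1 \<Longrightarrow> u z = v z) \<Longrightarrow> v \<in> Hinf"
  unfolding Hinf_def using holomorphic_cong[of "ball 0 1" "ball 0 1" u v] by auto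

definition mul :: "(complex \<Rightarrow> complex) \<Rightarrow> h2 \<Rightarrow> h2" where
  "mul u a = of_fn (\<lambda>z. u z * fn a z)"

text \<open>The pointwise bound on \<open>u\<close> compares mean squares over circles of radius
  \<open>r < 1\<close>, and Parseval turns these into weighted coefficient sums. Letting
  \<open>r\<close> tend to 1 avoids boundary values altogether.\<close>

lemma mul_aux:
  assumes u: "u \<in> Hinf" and B: "\<And>z. norm z < 1 \<Longrightarrow> norm (u z) \<le> B" "B \<ge> 0"
  shows "fn (mul u a) = (\<lambda>z. u z * fn a z)" "norm (mul u a) \<le> B * norm a"
proof -
  define f where "f z = u z * fn a z" for z
  have hol: "f holomorphic_on ball 0 1"
    unfolding f_def by (intro holomorphic_intros Hinf_holomorphic u)
  have bd: "(\<Sum>n<N. (norm (h2_coeff f n))\<^sup>2 * r ^ (2 * n)) \<le> (B * norm a)\<^sup>2" if r: "0 < r" "r < 1" for N r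
  proof -
    define I where "I g = integral {0..2*pi} (\<lambda>t. (norm (g (of_real r * cis t) :: complex))\<^sup>2)" for g
    have pf: "(\<lambda>n. (norm (h2_coeff f n))\<^sup>2 * r ^ (2 * n)) sums (I f / (2*pi))"
      unfolding I_def by (rule circle_parseval(2)) (use hol r in auto)
    have pa: "(\<lambda>n. (norm (h2_coeff (fn a) n))\<^sup>2 * r ^ (2 * n)) sums (I (fn a) / (2*pi))"
      unfolding I_def by (rule circle_parseval(2)) (use fn_holomorphic r in auto)
    have "(\<Sum>n<N. (norm (h2_coeff f n))\<^sup>2 * r ^ (2 * n)) \<le> I f / (2*pi)"
      unfolding sums_unique[OF pf] by (rule sum_le_suminf) (use pf r in \<open>auto simp: sums_iff\<close>)
    also have "I f \<le> integral {0..2*pi} (\<lambda>t. B\<^sup>2 * (norm (fn a (of_real r * cis t)))\<^sup>2)"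
      unfolding I_def
    proof (rule integral_le)
      show "(\<lambda>t. (norm (f (of_real r * cis t)))\<^sup>2) integrable_on {0..2*pi}"
        by (rule circle_parseval(1)) (use hol r in auto)
      show "(\<lambda>t. B\<^sup>2 * (norm (fn a (of_real r * cis t)))\<^sup>2) integrable_on {0..2*pi}"
        by (intro integrable_on_mult_right circle_parseval(1)) (use fn_holomorphic r in auto)
      show "(norm (f (of_real r * cis t)))\<^sup>2 \<le> B\<^sup>2 * (norm (fn a (of_real r * cis t)))\<^sup>2" for t
        unfolding f_def norm_mult power_mult_distrib
        by (intro mult_right_mono power_mono B) (use r in \<open>auto simp: norm_mult\<close>)
    qed
    also have "\<dots> = B\<^sup>2 * I (fn a)" by (simp add: I_def)
    also have "B\<^sup>2 * I (fn a) / (2*pi) = B\<^sup>2 * (\<Sum>n. (norm (hcoeff a n))\<^sup>2 * r ^ (2 * n))"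
      using sums_unique[OF pa] by (simp add: h2_coeff_fn flip: times_divide_eq_right)
    also have "\<dots> \<le> B\<^sup>2 * (\<Sum>n. (norm (hcoeff a n))\<^sup>2)"
    proof (intro mult_left_mono suminf_le summable_hcoeff)
      show "(norm (hcoeff a n))\<^sup>2 * r ^ (2 * n) \<le> (norm (hcoeff a n))\<^sup>2" for n
        using r by (intro mult_left_le) (auto simp: power_le_one)
    qed (use pa in \<open>auto simp: sums_iff h2_coeff_fn\<close>)
    finally show ?thesis by (simp add: power_mult_distrib divide_right_mono flip: norm_h2_sq)
  qed
  \<comment> \<open>Only finitely many coefficients are kept while \<open>r\<close> tends to 1, so
    no interchange of limits is needed.\<close>
  have sb: "(\<Sum>n<N. (norm (h2_coeff f n))\<^sup>2) \<le> (B * norm a)\<^sup>2" for N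
  proof (rule tendsto_upperbound)
    have "((\<lambda>r. \<Sum>n<N. (norm (h2_coeff f n))\<^sup>2 * r ^ (2 * n)) \<longlongrightarrow> (\<Sum>n<N. (norm (h2_coeff f n))\<^sup>2 * 1 ^ (2 * n))) (at_left (1::real))"
      by (intro tendsto_intros)
    then show "((\<lambda>r. \<Sum>n<N. (norm (h2_coeff f n))\<^sup>2 * r ^ (2 * n)) \<longlongrightarrow> (\<Sum>n<N. (norm (h2_coeff f n))\<^sup>2)) (at_left (1::real))"
      by simp
    have "eventually (\<lambda>r. r \<in> {0<..<1}) (at_left (1::real))" by (rule eventually_at_left_real) simp
    then show "eventually (\<lambda>r. (\<Sum>n<N. (norm (h2_coeff f n))\<^sup>2 * r ^ (2 * n)) \<le> (B * norm a)\<^sup>2) (at_left 1)"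
      by eventually_elim (use bd in auto)
  qed simp
  have B0: "B * norm a \<ge> 0" using B by simp
  note h2_of_hcoeff = h2_of_bounded[OF sb B0]
  show "fn (mul u a) = (\<lambda>z. u z * fn a z)"
    unfolding mul_def of_fn_def using hol h2_of_hcoeff(1)
    by (intro fn_of_coeff_eq) (auto simp: f_def[abs_def] fn_outside)
  show "norm (mul u a) \<le> B * norm a"
    using h2_of_hcoeff(2) by (simp add: mul_def of_fn_def f_def[abs_def])
qed

lemma fn_mul_eq: "u \<in> Hinf \<Longrightarrow> fn (mul u a) = (\<lambda>z. u z * fn a z)"
  using Hinf_bound mul_aux(1) less_imp_le by metis

lemma fn_mul [simp]: "u \<in> Hinf \<Longrightarrow> fn (mul u a) z = u z * fn a z"
  by (simp add: fn_mul_eq)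

lemmas norm_mul_le = mul_aux(2)

lemma fn_scaleR [simp]: "fn (r *\<^sub>R a) z = of_real r * fn a z"
proof (cases "norm z < 1")
  case True
  have "(\<lambda>n. hcoeff (r *\<^sub>R a) n * z ^ n) sums (of_real r * fn a z)"
    using sums_mult[OF fn_sums[OF True, of a], of "of_real r"] by (simp add: scaleR_conv_of_real mult.assoc)
  then show ?thesis using fn_sums[OF True] sums_unique2 by blast
qed (simp add: fn_outside)

lemma mul_add: "u \<in> Hinf \<Longrightarrow> mul u (a + b) = mul u a + mul u b"
  by (rule fn_eqI) (simp add: algebra_simps)

lemma mul_diff: "u \<in> Hinf \<Longrightarrow> mul u (a - b) = mul u a - mul u b"
  by (rule fn_eqI) (simp add: algebra_simps)

lemma mul_scaleR: "u \<in> Hinf \<Longrightarrow> mul u (r *\<^sub>R a) = r *\<^sub>R mul u a"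
  by (rule fn_eqI) simp

lemma mul_zero [simp]: "u \<in> Hinf \<Longrightarrow> mul u 0 = 0"
  by (rule fn_eqI) simp

lemma mul_mul: "u \<in> Hinf \<Longrightarrow> v \<in> Hinf \<Longrightarrow> mul u (mul v a) = mul (\<lambda>z. u z * v z) a"
  by (rule fn_eqI) simp

lemma mul_commute: "u \<in> Hinf \<Longrightarrow> v \<in> Hinf \<Longrightarrow> mul u (mul v a) = mul v (mul u a)"
  by (rule fn_eqI) simp

lemma mul_plus_fun: "u \<in> Hinf \<Longrightarrow> v \<in> Hinf \<Longrightarrow> mul (\<lambda>z. u z + v z) a = mul u a + mul v a"
  by (rule fn_eqI) (simp add: algebra_simps)

lemma mul_const_real: "mul (\<lambda>_. of_real r) a = r *\<^sub>R a"
  by (rule fn_eqI) simp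

lemma mul_const_one [simp]: "mul (\<lambda>_. 1) a = a"
  by (rule fn_eqI) simp

lemma mul_const_zero [simp]: "mul (\<lambda>_. 0) a = 0"
  by (rule fn_eqI) simp

lemma bounded_linear_mul: "u \<in> Hinf \<Longrightarrow> bounded_linear (mul u)"
proof -
  assume u: "u \<in> Hinf"
  obtain B where B: "B > 0" "\<And>z. norm z < 1 \<Longrightarrow> norm (u z) \<le> B" using Hinf_bound[OF u] by blast
  show ?thesis
  proof (rule bounded_linear_intro[where K = B])
    show "norm (mul u a) \<le> norm a * B" for a
      using norm_mul_le[OF u B(2)] B(1) by (simp add: mult.commute)
  qed (simp_all add: u mul_add mul_scaleR)
qed

lemma tendsto_mul [tendsto_intros]:
  "u \<in> Hinf \<Longrightarrow> (X \<longlongrightarrow> a) F \<Longrightarrow> ((\<lambda>n. mul u (X n)) \<longlongrightarrow> mul u a) F"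
  using bounded_linear.tendsto[OF bounded_linear_mul] .

lemma hcoeff_mul_const: "hcoeff (mul (\<lambda>_. c) a) n = c * hcoeff a n"
proof -
  have "fn (h2_of (\<lambda>n. c * hcoeff a n)) z = c * fn a z" if z: "norm z < 1" for z
  proof -
    have "summable (\<lambda>n. (norm (c * hcoeff a n))\<^sup>2)"
      by (simp add: norm_mult power_mult_distrib summable_mult summable_hcoeff)
    then have "hcoeff (h2_of (\<lambda>n. c * hcoeff a n)) = (\<lambda>n. c * hcoeff a n)" by (simp add: h2_of_inverse)
    then have "(\<lambda>n. hcoeff (h2_of (\<lambda>n. c * hcoeff a n)) n * z ^ n) sums (c * fn a z)"
      using sums_mult[OF fn_sums[OF z, of a], of c] by (simp add: mult.assoc)
    then show ?thesis using fn_sums[OF z] sums_unique2 by blast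
  qed
  then have "mul (\<lambda>_. c) a = h2_of (\<lambda>n. c * hcoeff a n)" by (intro fn_eqI) simp
  moreover have "summable (\<lambda>n. (norm (c * hcoeff a n))\<^sup>2)"
    by (simp add: norm_mult power_mult_distrib summable_mult summable_hcoeff)
  ultimately show ?thesis by (simp add: h2_of_inverse)
qed

text \<open>Complex scalars act through \<open>mul\<close>, since \<open>h2\<close> is only a real
  vector space; their adjoint is conjugation.\<close>

lemma inner_mul_const: "inner (mul (\<lambda>_. c) a) b = inner a (mul (\<lambda>_. cnj c) b)"
  unfolding inner_h2_def hcoeff_mul_const by (simp add: inner_complex_def algebra_simps)

section \<open>Polynomials and approximation in H^2\<close>

definition hpoly :: "complex poly \<Rightarrow> h2" where
  "hpoly p = h2_of (poly.coeff p)"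

lemma hcoeff_hpoly [simp]: "hcoeff (hpoly p) n = poly.coeff p n"
proof -
  have "summable (\<lambda>n. (norm (poly.coeff p n))\<^sup>2)"
    by (rule summable_finite[of "{..degree p}"]) (auto simp: coeff_eq_0 not_le)
  then show ?thesis by (simp add: hpoly_def h2_of_inverse)
qed

lemma fn_hpoly: "norm z < 1 \<Longrightarrow> fn (hpoly p) z = poly p z"
proof -
  assume z: "norm z < 1"
  have "(\<lambda>n. poly.coeff p n * z ^ n) sums poly p z"
    unfolding poly_altdef by (rule sums_finite) (auto simp: coeff_eq_0 not_le)
  then show ?thesis using fn_sums[OF z, of "hpoly p"] sums_unique2 by auto
qed

lemma hpoly_pCons: "hpoly (pCons c p) = hpoly [:c:] + mul (\<lambda>z. z) (hpoly p)"
  by (rule fn_eqI) (simp add: fn_hpoly)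

lemma mul_hpoly_commute: "fn w \<in> Hinf \<Longrightarrow> mul (fn w) (hpoly p) = mul (poly p) w"
  by (rule fn_eqI) (simp add: fn_hpoly)

lemma hpoly_dense: obtains p where "(\<lambda>n. hpoly (p n)) \<longlonglongrightarrow> a"
proof -
  define p where "p n = (\<Sum>k<n. monom (hcoeff a k) k)" for n
  have c: "poly.coeff (p n) k = (if k < n then hcoeff a k else 0)" for n k
    by (simp add: p_def coeff_sum)
  have e: "(norm (hpoly (p n) - a))\<^sup>2 = (norm a)\<^sup>2 - (\<Sum>k<n. (norm (hcoeff a k))\<^sup>2)" for n
  proof -
    have "(norm (hpoly (p n) - a))\<^sup>2 = (\<Sum>k. (norm (hcoeff (hpoly (p n) - a) (k + n)))\<^sup>2) + (\<Sum>k<n. (norm (hcoeff (hpoly (p n) - a) k))\<^sup>2)"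
      unfolding norm_h2_sq by (rule suminf_split_initial_segment[OF summable_hcoeff])
    also have "\<dots> = (\<Sum>k. (norm (hcoeff a (k + n)))\<^sup>2)" by (simp add: c)
    also have "\<dots> = (norm a)\<^sup>2 - (\<Sum>k<n. (norm (hcoeff a k))\<^sup>2)"
      unfolding norm_h2_sq by (rule suminf_minus_initial_segment[OF summable_hcoeff])
    finally show ?thesis .
  qed
  have "(\<lambda>n. \<Sum>k<n. (norm (hcoeff a k))\<^sup>2) \<longlonglongrightarrow> (norm a)\<^sup>2"
    unfolding norm_h2_sq using summable_hcoeff summable_LIMSEQ by blast
  then have "(\<lambda>n. (norm a)\<^sup>2 - (\<Sum>k<n. (norm (hcoeff a k))\<^sup>2)) \<longlonglongrightarrow> (norm a)\<^sup>2 - (norm a)\<^sup>2"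
    by (intro tendsto_intros)
  then have "(\<lambda>n. (norm (hpoly (p n) - a))\<^sup>2) \<longlonglongrightarrow> 0" by (simp add: e)
  then have "(\<lambda>n. sqrt ((norm (hpoly (p n) - a))\<^sup>2)) \<longlonglongrightarrow> sqrt 0" by (rule tendsto_real_sqrt)
  then have "(\<lambda>n. hpoly (p n)) \<longlonglongrightarrow> a" by (simp add: tendsto_norm_zero_iff LIM_zero_iff)
  then show ?thesis by (rule that)
qed

lemma fn_kernel_self:
  assumes "norm z < 1" shows "fn (kernel 1 z) z = of_real (1 / (1 - (norm z)\<^sup>2))"
proof -
  have "(norm z)\<^sup>2 < 1" using assms by (simp add: power_less_one_iff)
  then have "(\<lambda>n. (of_real ((norm z)\<^sup>2) :: complex) ^ n) sums (1 / (1 - of_real ((norm z)\<^sup>2)))"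
    by (intro geometric_sums) (simp add: norm_power)
  moreover have "(of_real ((norm z)\<^sup>2) :: complex) ^ n = hcoeff (kernel 1 z) n * z ^ n" for n
    using assms by (simp add: hcoeff_kernel complex_norm_square power_mult_distrib del: of_real_power)
  ultimately show ?thesis using fn_sums[OF assms, of "kernel 1 z"] sums_unique2 by simp
qed

text \<open>Tested on polynomials approximating the reproducing kernel at \<open>z\<close>, the multiplier inequality
  becomes the pointwise bound at \<open>z\<close>.\<close>

lemma multiplier_bound:
  assumes "\<And>p. norm (mul (poly p) w) \<le> C * norm (hpoly p)" "norm z < 1"
  shows "norm (fn w z) \<le> C"
proof -
  have pos: "0 < 1 - (norm z)\<^sup>2" using assms by (simp add: power_less_one_iff)
  obtain p where p: "(\<lambda>n. hpoly (p n)) \<longlonglongrightarrow> kernel 1 z" using hpoly_dense by blast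
  have "norm (fn (hpoly (p n)) z * fn w z) \<le> C * norm (hpoly (p n)) / sqrt (1 - (norm z)\<^sup>2)" for n
  proof -
    have "fn (hpoly (p n)) z * fn w z = fn (mul (poly (p n)) w) z" using assms by (simp add: fn_hpoly)
    also have "norm \<dots> \<le> norm (mul (poly (p n)) w) / sqrt (1 - (norm z)\<^sup>2)" by (rule norm_fn_le[OF assms(2)])
    also have "\<dots> \<le> C * norm (hpoly (p n)) / sqrt (1 - (norm z)\<^sup>2)"
      using pos by (intro divide_right_mono assms) simp
    finally show ?thesis .
  qed
  moreover have "(\<lambda>n. norm (fn (hpoly (p n)) z * fn w z)) \<longlonglongrightarrow> norm (fn (kernel 1 z) z * fn w z)"
    by (intro tendsto_intros tendsto_fn p)
  moreover have "(\<lambda>n. C * norm (hpoly (p n)) / sqrt (1 - (norm z)\<^sup>2)) \<longlonglongrightarrow> C * norm (kernel 1 z) / sqrt (1 - (norm z)\<^sup>2)"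
    using pos by (intro tendsto_intros p) auto
  ultimately have le: "norm (fn (kernel 1 z) z * fn w z) \<le> C * norm (kernel 1 z) / sqrt (1 - (norm z)\<^sup>2)"
    by (intro LIMSEQ_le) auto
  have "norm (kernel 1 z) = sqrt ((norm (kernel 1 z))\<^sup>2)" by simp
  also have "\<dots> = 1 / sqrt (1 - (norm z)\<^sup>2)" unfolding norm_kernel[OF assms(2)] by (simp add: real_sqrt_divide)
  finally have nk: "norm (kernel 1 z) = 1 / sqrt (1 - (norm z)\<^sup>2)" .
  have "C * norm (kernel 1 z) / sqrt (1 - (norm z)\<^sup>2) = C / (sqrt (1 - (norm z)\<^sup>2) * sqrt (1 - (norm z)\<^sup>2))"
    unfolding nk by simp
  then have "C * norm (kernel 1 z) / sqrt (1 - (norm z)\<^sup>2) = C / (1 - (norm z)\<^sup>2)"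
    using pos by simp
  moreover have "norm (fn (kernel 1 z) z * fn w z) = norm (fn w z) / (1 - (norm z)\<^sup>2)"
    unfolding fn_kernel_self[OF assms(2)] norm_mult norm_of_real using pos by simp
  ultimately show ?thesis using le pos by (simp add: divide_le_cancel)
qed

text \<open>Kernels have dense span, so pointwise convergence with bounded norms is weak
  convergence. As the norms do not exceed that of the limit, \<open>(norm (X n - a))\<^sup>2\<close>
  is at most \<open>2 * (norm a)\<^sup>2 - 2 * inner (X n) a\<close>, which tends to 0.\<close>

lemma tendsto_of_pointwise:
  assumes le: "\<And>n. norm (X n) \<le> norm a" and pw: "\<And>z. norm z < 1 \<Longrightarrow> (\<lambda>n. fn (X n) z) \<longlonglongrightarrow> fn a z"
  shows "X \<longlonglongrightarrow> a"
proof -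
  define V where "V = {b. (\<lambda>n. inner (X n) b) \<longlonglongrightarrow> inner a b}"
  have "closed V"
    unfolding closed_sequential_limits
  proof (intro allI impI, elim conjE)
    fix x l assume x: "\<forall>n. x n \<in> V" "x \<longlonglongrightarrow> l"
    have "(\<lambda>n. inner (X n) l) \<longlonglongrightarrow> inner a l"
    proof (rule metric_LIMSEQ_I)
      fix e :: real assume e: "e > 0"
      \<comment> \<open>Chosen so that the error \<open>2 * norm a * d\<close> from replacing
        \<open>l\<close> by \<open>x j\<close> stays within \<open>e / 2\<close>; the summand 1
        covers the case of a zero limit.\<close>
      define d where "d = e / (4 * (norm a + 1))"
      have d: "d > 0" using e by (simp add: d_def add_nonneg_pos)
      obtain j where j: "dist (x j) l < d" using metric_LIMSEQ_D[OF x(2) d] by blast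
      have "(\<lambda>n. inner (X n) (x j)) \<longlonglongrightarrow> inner a (x j)" using x(1) by (simp add: V_def)
      then obtain N where N: "\<And>n. n \<ge> N \<Longrightarrow> dist (inner (X n) (x j)) (inner a (x j)) < e / 2"
        using metric_LIMSEQ_D[of _ _ "e/2"] e by (meson half_gt_zero)
      have "dist (inner (X n) l) (inner a l) < e" if n: "n \<ge> N" for n
      proof -
        have "\<bar>inner (X n - a) (l - x j)\<bar> \<le> norm (X n - a) * norm (l - x j)" by (rule Cauchy_Schwarz_ineq2)
        also have "\<dots> \<le> (2 * norm a) * d"
          using le[of n] norm_triangle_ineq4[of "X n" a] j
          by (intro mult_mono) (auto simp: dist_norm norm_minus_commute)
        also have "\<dots> = e / 2 * (norm a / (norm a + 1))" by (simp add: d_def divide_simps)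
        also have "\<dots> \<le> e / 2 * 1"
          using e by (intro mult_left_mono) (simp_all add: divide_le_eq not_less add_nonneg_nonneg)
        finally have "\<bar>inner (X n - a) (l - x j)\<bar> \<le> e / 2" by simp
        moreover have "inner (X n - a) (l - x j) = (inner (X n) l - inner a l) - (inner (X n) (x j) - inner a (x j))"
          by (simp add: inner_simps)
        ultimately show ?thesis using N[OF n] unfolding dist_real_def by linarith
      qed
      then show "\<exists>N. \<forall>n\<ge>N. dist (inner (X n) l) (inner a l) < e" by blast
    qed
    then show "l \<in> V" by (simp add: V_def)
  qed
  moreover have "subspace V"
    unfolding subspace_def V_def by (auto simp: inner_simps intro!: tendsto_intros)
  moreover have "b = 0" if b: "\<And>k. k \<in> V \<Longrightarrow> inner b k = 0" for b
  proof (rule fn_eqI)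
    fix z :: complex assume z: "norm z < 1"
    have "kernel c z \<in> V" for c
      unfolding V_def using z by (auto simp: inner_kernel intro!: tendsto_intros pw)
    then have "inner b (kernel (fn b z) z) = 0" by (rule b)
    then have "Re (cnj (fn b z) * fn b z) = 0" using z by (simp add: inner_kernel)
    then show "fn b z = fn 0 z" by (simp add: complex_eq_iff)
  qed
  ultimately have "V = UNIV" by (rule closed_subspace_eq_UNIV)
  then have w: "(\<lambda>n. inner (X n) a) \<longlonglongrightarrow> inner a a" by (auto simp: V_def)
  have "(\<lambda>n. 2 * (norm a)\<^sup>2 - 2 * inner (X n) a) \<longlonglongrightarrow> 2 * (norm a)\<^sup>2 - 2 * inner a a"
    by (intro tendsto_intros w)
  then have w2: "(\<lambda>n. 2 * (norm a)\<^sup>2 - 2 * inner (X n) a) \<longlonglongrightarrow> 0" by (simp add: power2_norm_eq_inner)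
  have "(\<lambda>n. (norm (X n - a))\<^sup>2) \<longlonglongrightarrow> 0"
  proof (rule Lim_null_comparison[OF _ w2], rule always_eventually, rule allI)
    fix n
    have "(norm (X n))\<^sup>2 \<le> (norm a)\<^sup>2" using le[of n] by (simp add: power_mono)
    moreover have "(norm (X n - a))\<^sup>2 = (norm (X n))\<^sup>2 - 2 * inner (X n) a + (norm a)\<^sup>2"
      by (simp add: power2_norm_eq_inner inner_simps inner_commute)
    moreover have "norm ((norm (X n - a))\<^sup>2) = (norm (X n - a))\<^sup>2" by simp
    ultimately show "norm ((norm (X n - a))\<^sup>2) \<le> 2 * (norm a)\<^sup>2 - 2 * inner (X n) a" by linarith
  qed
  then have "(\<lambda>n. sqrt ((norm (X n - a))\<^sup>2)) \<longlonglongrightarrow> sqrt 0" by (rule tendsto_real_sqrt)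
  then show ?thesis by (simp add: tendsto_norm_zero_iff LIM_zero_iff)
qed

lemma mul_tendsto_self:
  assumes "\<And>n. u n \<in> Hinf" "\<And>n z. norm z < 1 \<Longrightarrow> norm (u n z) \<le> 1"
    and "\<And>z. norm z < 1 \<Longrightarrow> (\<lambda>n. u n z) \<longlonglongrightarrow> 1"
  shows "(\<lambda>n. mul (u n) a) \<longlonglongrightarrow> a"
proof (rule tendsto_of_pointwise)
  show "norm (mul (u n) a) \<le> norm a" for n
    using norm_mul_le[of "u n" 1 a] assms by simp
  show "(\<lambda>n. fn (mul (u n) a) z) \<longlonglongrightarrow> fn a z" if "norm z < 1" for z
    using tendsto_mult[OF assms(3)[OF that] tendsto_const, of "fn a z"] assms(1) by simp
qed

section \<open>Isometric multipliers and invariant subspaces\<close>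

definition shift :: "h2 \<Rightarrow> h2" where
  "shift a = h2_of (case_nat 0 (hcoeff a))"

lemma hcoeff_shift: "hcoeff (shift a) = case_nat 0 (hcoeff a)"
proof -
  have "summable (\<lambda>n. (norm (case_nat 0 (hcoeff a) n))\<^sup>2)"
    by (subst summable_Suc_iff[symmetric]) (simp add: summable_hcoeff)
  then show ?thesis by (simp add: shift_def h2_of_inverse)
qed

lemma mul_id: "mul (\<lambda>z. z) a = shift a"
proof (rule fn_eqI)
  fix z :: complex assume z: "norm z < 1"
  have "(\<lambda>n. hcoeff (shift a) (Suc n) * z ^ Suc n) sums (z * fn a z)"
    using sums_mult[OF fn_sums[OF z], of z a] by (simp add: hcoeff_shift algebra_simps)
  then have "(\<lambda>n. hcoeff (shift a) n * z ^ n) sums (z * fn a z)"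
    by (subst (asm) sums_Suc_iff) (simp add: hcoeff_shift)
  then show "fn (mul (\<lambda>z. z) a) z = fn (shift a) z"
    using fn_sums[OF z, of "shift a"] sums_unique2 by simp
qed

lemma norm_const_plus_shift: "(norm (hpoly [:c:] + shift a))\<^sup>2 = (norm c)\<^sup>2 + (norm a)\<^sup>2"
  using suminf_split_head[OF summable_hcoeff, of "hpoly [:c:] + shift a"]
  by (simp add: norm_h2_sq hcoeff_shift)

lemma norm_shift: "norm (shift a) = norm a"
proof -
  have "hpoly [:0:] = 0" by (rule h2_eqI) simp
  then have "(norm (shift a))\<^sup>2 = (norm a)\<^sup>2" using norm_const_plus_shift[of 0 a] by simp
  then show ?thesis by (simp add: power2_eq_iff_nonneg)
qed

text \<open>The backward shift, that is, the adjoint of multiplication by the variable.\<close>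

definition bshift :: "h2 \<Rightarrow> h2" where
  "bshift a = h2_of (\<lambda>n. hcoeff a (Suc n))"

lemma hcoeff_bshift [simp]: "hcoeff (bshift a) n = hcoeff a (Suc n)"
  using summable_ignore_initial_segment[OF summable_hcoeff, of a 1] by (simp add: bshift_def h2_of_inverse)

lemma const_plus_shift_bshift: "hpoly [:hcoeff a 0:] + shift (bshift a) = a"
  by (rule h2_eqI) (simp add: hcoeff_shift coeff_pCons split: nat.splits)

lemma Hinf_split:
  assumes "u \<in> Hinf"
  obtains u1 where "u1 \<in> Hinf" "\<And>z. norm z < 1 \<Longrightarrow> u z = u 0 + z * u1 z"
proof -
  define g where "g z = (if z = 0 then deriv u 0 else (u z - u 0) / (z - 0))" for z
  obtain B where B: "B > 0" "\<And>z. norm z < 1 \<Longrightarrow> norm (u z) \<le> B" using Hinf_bound[OF assms] by blast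
  have hol: "g holomorphic_on ball 0 1"
    unfolding g_def by (rule pole_lemma_open) (use assms Hinf_holomorphic in auto)
  have "compact (g ` cball 0 (1/2))"
    by (rule compact_continuous_image[OF holomorphic_on_imp_continuous_on[OF holomorphic_on_subset[OF hol]]]) auto
  then obtain C where C: "\<And>z. z \<in> cball 0 (1/2) \<Longrightarrow> norm (g z) \<le> C"
    using compact_imp_bounded bounded_iff by (metis imageI)
  \<comment> \<open>Compactness controls the quotient near 0. Beyond radius 1/2 the numerator is at
    most \<open>2 * B\<close> and dividing by \<open>z\<close> at most doubles it.\<close>
  have "norm (g z) \<le> max C (4 * B)" if z: "norm z < 1" for z
  proof (cases "norm z \<le> 1/2")
    case False
    then have "z \<noteq> 0" by auto
    have "norm (u z - u 0) \<le> 2 * B" using norm_triangle_ineq4[of "u z" "u 0"] B(2)[OF z] B(2)[of 0] by simp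
    then have "norm (u z - u 0) / norm z \<le> (2 * B) / (1/2)"
      using False B(1) by (intro frac_le) auto
    then show ?thesis using \<open>z \<noteq> 0\<close> by (simp add: g_def norm_divide)
  qed (use C[of z] in auto)
  then have "g \<in> Hinf" by (rule HinfI[OF hol])
  moreover have "u z = u 0 + z * g z" for z by (simp add: g_def)
  ultimately show ?thesis using that by blast
qed

text \<open>The working form of inner functions, stated on coefficients instead of boundary values.
  Divisibility, closed ranges and Beurling's theorem use nothing but this isometry.\<close>

definition isom_mult :: "(complex \<Rightarrow> complex) \<Rightarrow> bool" where
  "isom_mult w \<longleftrightarrow> w \<in> Hinf \<and> (\<forall>a. norm (mul w a) = norm a)"

lemma isom_mult_Hinf [simp]: "isom_mult w \<Longrightarrow> w \<in> Hinf"
  by (simp add: isom_mult_def)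

lemma isom_mult_id: "isom_mult (\<lambda>z. z)"
  by (simp add: isom_mult_def mul_id norm_shift)

lemma isom_mult_inner:
  assumes "isom_mult w" shows "inner (mul w a) (mul w b) = inner a b"
proof -
  have "norm (mul w a + mul w b) = norm (a + b)" "norm (mul w a) = norm a" "norm (mul w b) = norm b"
    using assms by (auto simp: isom_mult_def simp flip: mul_add)
  moreover have "inner x y = ((norm (x + y))\<^sup>2 - (norm x)\<^sup>2 - (norm y)\<^sup>2) / 2" for x y :: h2
    by (simp add: power2_norm_eq_inner inner_simps inner_commute)
  ultimately show ?thesis by metis
qed

lemma isom_mult_inject: "isom_mult w \<Longrightarrow> mul w a = mul w b \<longleftrightarrow> a = b"
  using mul_diff[of w a b] by (metis isom_mult_def norm_eq_zero right_minus_eq)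

lemma isom_mult_le_1:
  assumes "isom_mult w" "norm z < 1" shows "norm (w z) \<le> 1"
proof -
  have "mul (poly p) (mul w (hpoly 1)) = mul w (hpoly p)" for p
    by (rule fn_eqI) (use assms in \<open>simp add: fn_hpoly\<close>)
  then have "norm (fn (mul w (hpoly 1)) z) \<le> 1"
    using assms by (intro multiplier_bound) (auto simp: isom_mult_def)
  then show ?thesis using assms by (simp add: fn_hpoly)
qed

text \<open>The isometry cancels the divisor in norm: multiplying \<open>h\<close> by a polynomial
  has the same norm as multiplying that polynomial by \<open>b\<close>. So \<open>h\<close> obeys a
  multiplier inequality and is bounded by \<open>B\<close>.\<close>

lemma isom_mult_division:
  assumes "isom_mult w" "b \<in> Hinf" "\<And>z. norm z < 1 \<Longrightarrow> w z * fn h z = b z"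
  shows "fn h \<in> Hinf"
proof -
  obtain B where B: "B > 0" "\<And>z. norm z < 1 \<Longrightarrow> norm (b z) \<le> B" using Hinf_bound[OF assms(2)] by blast
  have e: "mul w (mul (poly p) h) = mul b (hpoly p)" for p
    by (rule fn_eqI) (use assms in \<open>simp add: fn_hpoly flip: assms(3)\<close>)
  have "norm (mul (poly p) h) \<le> B * norm (hpoly p)" for p
  proof -
    have "norm (mul (poly p) h) = norm (mul b (hpoly p))"
      using assms(1) by (metis e isom_mult_def)
    also have "\<dots> \<le> B * norm (hpoly p)" using B by (intro norm_mul_le assms(2)) auto
    finally show ?thesis .
  qed
  then show ?thesis by (intro HinfI[OF fn_holomorphic] multiplier_bound)
qed

section \<open>Closed ranges and invariant subspaces\<close>

lemma closed_mul_image: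
  assumes "isom_mult w" "closed M" "subspace M" shows "closed (mul w ` M)"
proof -
  have "complete (mul w ` M)"
    by (rule complete_isometric_image[of 1])
       (use assms in \<open>auto simp: isom_mult_def bounded_linear_mul complete_eq_closed\<close>)
  then show ?thesis by (simp add: complete_eq_closed)
qed

lemma subspace_mul_image: "w \<in> Hinf \<Longrightarrow> subspace M \<Longrightarrow> subspace (mul w ` M)"
  using linear_subspace_image bounded_linear.linear[OF bounded_linear_mul] by blast

lemma closed_range_mul: "isom_mult w \<Longrightarrow> closed (range (mul w))"
  using closed_mul_image[of w UNIV] by simp

lemma subspace_range_mul: "w \<in> Hinf \<Longrightarrow> subspace (range (mul w))"
  by (rule subspace_mul_image) auto

text \<open>Invariance under all bounded multipliers contains invariance under the constant \<i>, so
  these real subspaces are complex ones.\<close>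

definition hinf_sub :: "h2 set \<Rightarrow> bool" where
  "hinf_sub M \<longleftrightarrow> subspace M \<and> (\<forall>u\<in>Hinf. \<forall>a\<in>M. mul u a \<in> M)"

lemma hinf_sub_range: "w \<in> Hinf \<Longrightarrow> hinf_sub (range (mul w))"
  unfolding hinf_sub_def using subspace_range_mul[of w] by (auto simp: mul_commute[of _ w])

lemma subspace_closure:
  fixes M :: "'a::real_normed_vector set"
  assumes "subspace M" shows "subspace (closure M)"
proof (rule subspaceI)
  show "0 \<in> closure M" using assms closure_subset subspace_0 by blast
next
  fix a b assume "a \<in> closure M" "b \<in> closure M"
  then obtain x y where "\<And>n. x n \<in> M" "x \<longlonglongrightarrow> a" "\<And>n. y n \<in> M" "y \<longlonglongrightarrow> b"
    unfolding closure_sequential by blast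
  then show "a + b \<in> closure M"
    unfolding closure_sequential using assms
    by (intro exI[of _ "\<lambda>n. x n + y n"]) (auto intro: tendsto_add subspace_add)
next
  fix a c assume "a \<in> closure M"
  then obtain x where "\<And>n. x n \<in> M" "x \<longlonglongrightarrow> a" unfolding closure_sequential by blast
  then show "c *\<^sub>R a \<in> closure M"
    unfolding closure_sequential using assms
    by (intro exI[of _ "\<lambda>n. c *\<^sub>R x n"]) (auto intro: tendsto_intros subspace_scale)
qed

lemma hinf_sub_closure: "hinf_sub M \<Longrightarrow> hinf_sub (closure M)"
  unfolding hinf_sub_def
proof (intro conjI ballI; (elim conjE)?)
  assume "subspace M" then show "subspace (closure M)" by (rule subspace_closure)
next
  fix u a assume M: "\<forall>u\<in>Hinf. \<forall>a\<in>M. mul u a \<in> M" and u: "u \<in> Hinf" and "a \<in> closure M"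
  then obtain x where "\<And>n. x n \<in> M" "x \<longlonglongrightarrow> a" unfolding closure_sequential by blast
  then show "mul u a \<in> closure M"
    unfolding closure_sequential using M u by (intro exI[of _ "\<lambda>n. mul u (x n)"]) (auto intro: tendsto_mul)
qed


text \<open>Every element of \<open>M\<close> is divisible by every power of the variable, so all
  its coefficients vanish.\<close>

lemma shift_image_imp_zero:
  assumes "M \<subseteq> shift ` M" "a \<in> M" shows "a = 0"
proof -
  have "\<forall>a\<in>M. hcoeff a n = 0" for n
  proof (induction n)
    case 0
    show ?case using assms(1) by (auto simp: hcoeff_shift)
  next
    case (Suc n)
    show ?case
    proof
      fix a assume "a \<in> M"
      then obtain b where "b \<in> M" "a = shift b" using assms(1) by blast
      then show "hcoeff a (Suc n) = 0" using Suc by (simp add: hcoeff_shift)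
    qed
  qed
  then show ?thesis by (intro h2_eqI) (use assms(2) in simp)
qed

text \<open>A unit vector \<open>w\<close> of \<open>M\<close> orthogonal to the shift of
  \<open>M\<close> multiplies polynomials isometrically, hence is an inner function. Any element of
  \<open>M\<close> orthogonal to its range is then shown to vanish.\<close>

theorem beurling:
  assumes "closed M" "hinf_sub M" "a \<in> M" "a \<noteq> 0"
  obtains w where "isom_mult w" "M = range (mul w)"
proof -
  have sub: "subspace M" and inv: "\<And>u b. u \<in> Hinf \<Longrightarrow> b \<in> M \<Longrightarrow> mul u b \<in> M"
    using assms(2) by (auto simp: hinf_sub_def)
  have shM: "shift b \<in> M" if "b \<in> M" for b using inv[of "\<lambda>z. z"] that by (simp add: mul_id)
  have clz: "closed (shift ` M)" and subz: "subspace (shift ` M)"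
    using closed_mul_image[OF isom_mult_id assms(1) sub] subspace_mul_image[of "\<lambda>z. z", OF _ sub]
    by (simp_all add: mul_id[abs_def])
  obtain b where b: "b \<in> M" "b \<notin> shift ` M" using shift_image_imp_zero[of M a] assms(3,4) by blast
  obtain p where p: "p \<in> shift ` M" "\<And>k. k \<in> shift ` M \<Longrightarrow> inner (b - p) k = 0"
    using orthogonal_projection_exists[OF clz subz] by blast
  define w where "w = (1 / norm (b - p)) *\<^sub>R (b - p)"
  have "b - p \<noteq> 0" using b p by auto
  then have nw: "norm w = 1" by (simp add: w_def)
  have "p \<in> M" using p shM by auto
  then have wM: "w \<in> M" unfolding w_def using b by (intro subspace_scale subspace_diff sub)
  have worth: "inner (mul (\<lambda>_. c) w) (shift m) = 0" if "m \<in> M" for c m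
  proof -
    have "mul (\<lambda>_. cnj c) (shift m) = shift (mul (\<lambda>_. cnj c) m)"
      by (simp add: mul_commute[of "\<lambda>_. cnj c"] flip: mul_id)
    moreover have "inner w (shift (mul (\<lambda>_. cnj c) m)) = 0"
      using p(2) inv[of "\<lambda>_. cnj c"] that by (simp add: w_def)
    ultimately show ?thesis by (simp add: inner_mul_const)
  qed
  have norm_const: "norm (mul (\<lambda>_. c) a) = norm c * norm a" for c a
  proof -
    have "(norm (mul (\<lambda>_. c) a))\<^sup>2 = inner a (mul (\<lambda>_. cnj c * c) a)"
      by (simp add: power2_norm_eq_inner inner_mul_const mul_mul)
    also have "(\<lambda>_::complex. cnj c * c) = (\<lambda>_. of_real ((norm c)\<^sup>2))"
      by (metis complex_norm_square mult.commute)
    also have "inner a (mul \<dots> a) = (norm c * norm a)\<^sup>2"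
      unfolding mul_const_real by (simp add: power_mult_distrib power2_norm_eq_inner)
    finally show ?thesis by (simp add: power2_eq_iff_nonneg)
  qed
  \<comment> \<open>Splitting off the constant term leaves two orthogonal pieces, so the squared
    coefficients add up one at a time.\<close>
  have iso: "norm (mul (poly p) w) = norm (hpoly p)" for p
  proof (induction p)
    case 0
    have "poly 0 = (\<lambda>_. 0::complex)" by auto
    moreover have "hpoly 0 = 0" by (rule h2_eqI) simp
    ultimately show ?case by simp
  next
    case (pCons c p)
    have e: "mul (poly (pCons c p)) w = mul (\<lambda>_. c) w + shift (mul (poly p) w)"
      unfolding mul_id[symmetric] by (rule fn_eqI) (simp add: algebra_simps)
    have "(norm (mul (poly (pCons c p)) w))\<^sup>2 = (norm (mul (\<lambda>_. c) w))\<^sup>2 + (norm (shift (mul (poly p) w)))\<^sup>2"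
      unfolding e using worth[OF inv[OF Hinf_poly wM]]
      by (simp add: power2_norm_eq_inner inner_simps inner_commute)
    also have "\<dots> = (norm c)\<^sup>2 + (norm (hpoly p))\<^sup>2" by (simp add: norm_const nw norm_shift pCons)
    also have "\<dots> = (norm (hpoly (pCons c p)))\<^sup>2"
      unfolding hpoly_pCons[of c p] mul_id norm_const_plus_shift ..
    finally show ?case by (rule power2_eq_imp_eq) simp_all
  qed
  have wH: "fn w \<in> Hinf"
    by (rule HinfI[OF fn_holomorphic], rule multiplier_bound[where C = 1]) (simp_all add: iso)
  have isow: "isom_mult (fn w)"
    unfolding isom_mult_def
  proof (intro conjI allI wH)
    fix x
    obtain q where q: "(\<lambda>n. hpoly (q n)) \<longlonglongrightarrow> x" using hpoly_dense by blast
    have "(\<lambda>n. norm (mul (fn w) (hpoly (q n)))) \<longlonglongrightarrow> norm (mul (fn w) x)"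
      by (intro tendsto_intros wH q)
    moreover have "(\<lambda>n. norm (mul (fn w) (hpoly (q n)))) \<longlonglongrightarrow> norm x"
      unfolding mul_hpoly_commute[OF wH] iso by (intro tendsto_intros q)
    ultimately show "norm (mul (fn w) x) = norm x" by (rule LIMSEQ_unique)
  qed
  have sub1: "range (mul (fn w)) \<subseteq> M"
  proof clarify
    fix x
    obtain q where q: "(\<lambda>n. hpoly (q n)) \<longlonglongrightarrow> x" using hpoly_dense by blast
    show "mul (fn w) x \<in> M"
    proof (rule closed_sequentially[OF assms(1)])
      show "mul (fn w) (hpoly (q n)) \<in> M" for n unfolding mul_hpoly_commute[OF wH] by (intro inv wM) simp
      show "(\<lambda>n. mul (fn w) (hpoly (q n))) \<longlonglongrightarrow> mul (fn w) x" by (intro tendsto_intros wH q)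
    qed
  qed
  have "M \<subseteq> range (mul (fn w))"
  proof
    fix f assume f: "f \<in> M"
    obtain g where g: "g \<in> range (mul (fn w))" "\<And>k. k \<in> range (mul (fn w)) \<Longrightarrow> inner (f - g) k = 0"
      using orthogonal_projection_exists[OF closed_range_mul[OF isow] subspace_range_mul[OF wH]] by blast
    define h where "h = f - g"
    have hM: "h \<in> M" using f g sub1 unfolding h_def by (intro subspace_diff sub) auto
    have ho: "inner (mul (\<lambda>_. c) h) (mul (fn w) x) = 0" for c x
      using g(2)[of "mul (fn w) (mul (\<lambda>_. cnj c) x)"] wH
      by (simp add: inner_mul_const h_def mul_commute[of "\<lambda>_. cnj c" "fn w"])
    \<comment> \<open>Constant terms of \<open>u\<close> and of \<open>poly q\<close> are removed
      simultaneously. The three mixed products vanish by \<open>ho\<close>, by \<open>worth\<close>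
      and, after cancelling the shift, by induction.\<close>
    have *: "inner (mul u h) (mul (poly q) w) = 0" if "u \<in> Hinf" for u q
      using that
    proof (induction q arbitrary: u)
      case 0
      have "poly 0 = (\<lambda>_. 0::complex)" by auto
      then show ?case by simp
    next
      case (pCons c q)
      obtain u1 where u1: "u1 \<in> Hinf" "\<And>z. norm z < 1 \<Longrightarrow> u z = u 0 + z * u1 z"
        using Hinf_split[OF pCons.prems] by blast
      have e: "mul (poly (pCons c q)) w = mul (\<lambda>_. c) w + shift (mul (poly q) w)"
        unfolding mul_id[symmetric] by (rule fn_eqI) (simp add: algebra_simps)
      have eu: "mul u h = mul (\<lambda>_. u 0) h + shift (mul u1 h)"
        unfolding mul_id[symmetric]
      proof (rule fn_eqI)
        fix z :: complex assume "norm z < 1"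
        then have "u z * fn h z = (u 0 + z * u1 z) * fn h z" using u1(2) by metis
        then show "fn (mul u h) z = fn (mul (\<lambda>_. u 0) h + mul (\<lambda>z. z) (mul u1 h)) z"
          by (simp add: u1(1) pCons.prems algebra_simps)
      qed
      have "inner (mul (\<lambda>_. u 0) h) (mul (poly (pCons c q)) w) = 0"
        unfolding mul_hpoly_commute[OF wH, symmetric] by (rule ho)
      moreover have "inner (shift (mul u1 h)) (mul (\<lambda>_. c) w) = 0"
        using worth[OF inv[OF u1(1) hM]] by (simp add: inner_commute)
      moreover have "inner (shift (mul u1 h)) (shift (mul (poly q) w)) = 0"
        using isom_mult_inner[OF isom_mult_id] pCons.IH[OF u1(1)] by (simp add: mul_id)
      ultimately show ?case unfolding eu e inner_add_left inner_add_right by simp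
    qed
    \<comment> \<open>With \<open>u\<close> equal to \<open>fn w\<close>, polynomial limits reach
      every \<open>x\<close>. Taking \<open>x = h\<close> then shows that
      \<open>mul (fn w) h\<close> is zero.\<close>
    have "inner (mul (fn w) h) (mul (fn w) x) = 0" for x
    proof -
      obtain q where q: "(\<lambda>n. hpoly (q n)) \<longlonglongrightarrow> x" using hpoly_dense by blast
      have "(\<lambda>n. inner (mul (fn w) h) (mul (fn w) (hpoly (q n)))) \<longlonglongrightarrow> inner (mul (fn w) h) (mul (fn w) x)"
        by (intro tendsto_intros wH q)
      then show ?thesis unfolding mul_hpoly_commute[OF wH] *[OF wH] by (simp add: LIMSEQ_const_iff)
    qed
    then have "mul (fn w) h = mul (fn w) 0" using wH by (metis inner_eq_zero_iff mul_zero)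
    then have "h = 0" using isow by (simp only: isom_mult_inject)
    then show "f \<in> range (mul (fn w))" using g by (simp add: h_def)
  qed
  with sub1 isow that show ?thesis by blast
qed

section \<open>Bounded regularizers\<close>

instance h2 :: banach ..

lemma norm_mul_const_le: "norm (mul (\<lambda>_. c) a) \<le> norm c * norm a"
  by (rule norm_mul_le) auto

lemma hcoeff_bshift_funpow: "hcoeff ((bshift ^^ n) g) m = hcoeff g (m + n)"
  by (induction n arbitrary: m) simp_all

lemma norm_bshift_sq: "(norm (bshift a))\<^sup>2 = (norm a)\<^sup>2 - (norm (hcoeff a 0))\<^sup>2"
  using norm_const_plus_shift[of "hcoeff a 0" "bshift a"] by (simp add: const_plus_shift_bshift)

lemma norm_bshift_le: "norm (bshift a) \<le> norm a"
  by (rule power2_le_imp_le) (simp_all add: norm_bshift_sq)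

lemma norm_bshift_funpow_le: "norm ((bshift ^^ n) a) \<le> norm a"
  by (induction n) (auto intro: order_trans[OF norm_bshift_le])

lemma bounded_linear_bshift: "bounded_linear bshift"
proof (rule bounded_linear_intro[where K = 1])
  show "bshift (a + b) = bshift a + bshift b" for a b by (rule h2_eqI) simp
  show "bshift (r *\<^sub>R a) = r *\<^sub>R bshift a" for r a by (rule h2_eqI) simp
qed (simp add: norm_bshift_le)

lemma bounded_linear_hcoeff: "bounded_linear (\<lambda>a. hcoeff a n)"
  by (rule bounded_linear_intro[where K = 1]) (simp_all add: norm_hcoeff_le)

text \<open>With \<open>G = \<Sum>n. z ^ n S*\<^sup>n g\<close> one has \<open>g = G - z S* G\<close> and \<open>G 0 = g z\<close>, and \<open>Re (W z)\<close> becomes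
  \<open>\<langle>G + z S* G, G - z S* G\<rangle> = \<parallel>G\<parallel>\<^sup>2 - \<bar>z\<bar>\<^sup>2 (\<parallel>G\<parallel>\<^sup>2 - \<bar>G 0\<bar>\<^sup>2)\<close>.\<close>

lemma harmonic_majorant:
  obtains W where "W holomorphic_on ball 0 1" "\<And>z. norm z < 1 \<Longrightarrow> (norm (fn g z))\<^sup>2 \<le> Re (W z)"
proof -
  \<comment> \<open>The coefficients are twice the inner products of the iterated backward shifts of
    \<open>g\<close> with \<open>g\<close>; \<open>W\<close> is thus the holomorphic function twice
    \<langle>G, g\<rangle> minus the squared norm of \<open>g\<close>.\<close>
  define d where "d n = 2 * (\<Sum>m. hcoeff g (m + n) * cnj (hcoeff g m))" for n
  define W where "W z = (\<Sum>n. d n * z ^ n) - of_real ((norm g)\<^sup>2)" for z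
  have sm: "summable (\<lambda>m. hcoeff g (m + n) * cnj (hcoeff g m))" for n
    using summable_hcoeff_cnj[of "(bshift ^^ n) g" g] by (simp add: hcoeff_bshift_funpow)
  have Re_d: "Re (d n * c) = 2 * inner (mul (\<lambda>_. c) ((bshift ^^ n) g)) g" for n c
  proof -
    have "inner (mul (\<lambda>_. c) ((bshift ^^ n) g)) g = (\<Sum>m. Re (c * (hcoeff g (m + n) * cnj (hcoeff g m))))"
      unfolding inner_h2_def hcoeff_mul_const hcoeff_bshift_funpow by (simp add: inner_complex_def algebra_simps)
    also have "\<dots> = Re (\<Sum>m. c * (hcoeff g (m + n) * cnj (hcoeff g m)))"
      by (rule bounded_linear.suminf[OF bounded_linear_Re, symmetric]) (intro summable_mult sm)
    also have "(\<Sum>m. c * (hcoeff g (m + n) * cnj (hcoeff g m))) = c * (d n / 2)"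
      unfolding d_def by (simp add: suminf_mult[OF sm])
    finally show ?thesis by (simp add: algebra_simps)
  qed
  have nd: "norm (d n) \<le> 2 * (norm g)\<^sup>2" for n
  proof (cases "d n = 0")
    case False
    \<comment> \<open>A unimodular factor rotates \<open>d n\<close> onto the positive axis, so that
      the real inner product detects its modulus.\<close>
    define c where "c = cnj (d n) / norm (d n)"
    have "Re (d n * c) = norm (d n)"
    proof -
      have "d n * c = of_real ((norm (d n))\<^sup>2) / norm (d n)"
        unfolding c_def by (simp add: complex_norm_square del: of_real_power)
      then have "d n * c = of_real (norm (d n))" using False by (simp add: power2_eq_square)
      then show ?thesis by simp
    qed
    then have "norm (d n) = 2 * inner (mul (\<lambda>_. c) ((bshift ^^ n) g)) g" using Re_d[of n c] by linarith
    also have "inner (mul (\<lambda>_. c) ((bshift ^^ n) g)) g \<le> norm (mul (\<lambda>_. c) ((bshift ^^ n) g)) * norm g"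
      by (rule norm_cauchy_schwarz)
    also have "\<dots> \<le> (norm c * norm ((bshift ^^ n) g)) * norm g" by (intro mult_right_mono norm_mul_const_le) simp
    also have "\<dots> \<le> (1 * norm g) * norm g"
      using False by (intro mult_right_mono mult_mono norm_bshift_funpow_le) (auto simp: c_def norm_divide)
    finally show ?thesis by (simp add: power2_eq_square)
  qed simp
  have sd: "summable (\<lambda>n. d n * z ^ n)" if "norm z < 1" for z
  proof (rule summable_comparison_test'[of "\<lambda>n. 2 * (norm g)\<^sup>2 * norm z ^ n" 0])
    show "summable (\<lambda>n. 2 * (norm g)\<^sup>2 * norm z ^ n)" using that by (intro summable_mult summable_geometric) simp
    show "norm (d n * z ^ n) \<le> 2 * (norm g)\<^sup>2 * norm z ^ n" if "0 \<le> n" for n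
      unfolding norm_mult norm_power by (intro mult_right_mono nd) simp
  qed
  have "(\<lambda>z. \<Sum>n. d n * z ^ n) holomorphic_on ball 0 1"
    by (rule power_series_holomorphic[of 0 1 d]) (use sd summable_sums in auto)
  then have hol: "W holomorphic_on ball 0 1"
    unfolding W_def by (intro holomorphic_intros)
  have "(norm (fn g z))\<^sup>2 \<le> Re (W z)" if z: "norm z < 1" for z
  proof -
    define x where "x n = mul (\<lambda>_. z ^ n) ((bshift ^^ n) g)" for n
    have nx: "norm (x n) \<le> norm z ^ n * norm g" for n
    proof -
      have "norm (x n) \<le> norm (z ^ n) * norm ((bshift ^^ n) g)" unfolding x_def by (rule norm_mul_const_le)
      also have "\<dots> \<le> norm (z ^ n) * norm g" by (intro mult_left_mono norm_bshift_funpow_le) simp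
      finally show ?thesis by (simp add: norm_power)
    qed
    have sx: "summable x"
    proof (rule summable_comparison_test'[of "\<lambda>n. norm z ^ n * norm g" 0])
      show "summable (\<lambda>n. norm z ^ n * norm g)" using z by (intro summable_mult2 summable_geometric) simp
    qed (rule nx)
    define G where "G = suminf x"
    have "(\<lambda>n. hcoeff (x n) 0) sums hcoeff G 0"
      unfolding G_def by (rule bounded_linear.sums[OF bounded_linear_hcoeff summable_sums[OF sx]])
    moreover have "hcoeff (x n) 0 = hcoeff g n * z ^ n" for n
      by (simp add: x_def hcoeff_mul_const hcoeff_bshift_funpow)
    ultimately have G0: "hcoeff G 0 = fn g z" using fn_sums[OF z, of g] sums_unique2 by simp
    \<comment> \<open>Summing this recursion gives the fixed-point equation by which
      \<open>g\<close> is expressed through \<open>G\<close>.\<close>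
    have xS: "x (Suc n) = mul (\<lambda>_. z) (bshift (x n))" for n
      by (rule h2_eqI) (simp add: x_def hcoeff_mul_const hcoeff_bshift_funpow)
    have "(\<lambda>n. x (Suc n)) sums mul (\<lambda>_. z) (bshift G)"
      unfolding xS G_def
      by (intro bounded_linear.sums[OF bounded_linear_mul] bounded_linear.sums[OF bounded_linear_bshift] summable_sums[OF sx]) simp
    then have "(\<Sum>n. x (Suc n)) = mul (\<lambda>_. z) (bshift G)" by (rule sums_unique[symmetric])
    then have g: "g = G - mul (\<lambda>_. z) (bshift G)"
      using suminf_split_head[OF sx] by (simp add: G_def x_def)
    have "(\<lambda>n. 2 * inner (x n) g) sums (2 * inner G g)"
      unfolding G_def
      by (intro sums_mult bounded_linear.sums[OF bounded_linear_inner_left] summable_sums[OF sx])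
    moreover have "(\<lambda>n. Re (d n * z ^ n)) sums Re (\<Sum>n. d n * z ^ n)"
      using bounded_linear.sums[OF bounded_linear_Re summable_sums[OF sd[OF z]]] .
    ultimately have "Re (\<Sum>n. d n * z ^ n) = 2 * inner G g" unfolding Re_d x_def using sums_unique2 by blast
    then have "Re (W z) = inner (G + mul (\<lambda>_. z) (bshift G)) g"
    proof -
      have "(norm g)\<^sup>2 = inner (G - mul (\<lambda>_. z) (bshift G)) g" using g by (simp add: power2_norm_eq_inner)
      then show ?thesis
        using \<open>Re (\<Sum>n. d n * z ^ n) = 2 * inner G g\<close>
        unfolding W_def minus_complex.sel Re_complex_of_real by (simp add: inner_simps)
    qed
    also have "\<dots> = (norm G)\<^sup>2 - (norm (mul (\<lambda>_. z) (bshift G)))\<^sup>2"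
      using arg_cong[OF g, of "inner (G + mul (\<lambda>_. z) (bshift G))"]
      by (simp add: power2_norm_eq_inner inner_simps inner_commute)
    also have "\<dots> \<ge> (norm (hcoeff G 0))\<^sup>2"
    proof -
      have "norm (mul (\<lambda>_. z) (bshift G)) \<le> 1 * norm (bshift G)"
        using norm_mul_const_le[of z "bshift G"] z mult_right_mono[of "norm z" 1 "norm (bshift G)"] by simp
      then have "(norm (mul (\<lambda>_. z) (bshift G)))\<^sup>2 \<le> (norm (bshift G))\<^sup>2" by (simp add: power_mono)
      then show ?thesis by (simp add: norm_bshift_sq)
    qed
    finally show ?thesis by (simp add: G0)
  qed
  with hol that show ?thesis by blast
qed

text \<open>Boundedness of the products comes from
  \<open>e n * norm (fn f z) \<le> 1 + e n * (norm (fn f z))\<^sup>2\<close>, the right side being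
  dominated by the modulus of the denominator. The last clause lets any \<open>k m\<close> be
  replaced by a bounded multiple of \<open>k 0\<close>, so one fixed regularizer loses nothing in a
  generated ideal.\<close>

lemma bounded_regularizer:
  obtains k where "\<And>n. k n \<in> Hinf" "\<And>n z. norm z < 1 \<Longrightarrow> norm (k n z) \<le> 1"
    "\<And>z. norm z < 1 \<Longrightarrow> (\<lambda>n. k n z) \<longlonglongrightarrow> 1"
    "\<And>n. fn (mul (k n) f) \<in> Hinf" "\<And>n. fn (mul (k n) g) \<in> Hinf"
    "\<And>n m. \<exists>q\<in>Hinf. \<forall>z\<in>ball 0 1. k m z = k n z * q z"
proof -
  obtain W1 W2 where W1: "W1 holomorphic_on ball 0 1" "\<And>z. norm z < 1 \<Longrightarrow> (norm (fn f z))\<^sup>2 \<le> Re (W1 z)"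
    and W2: "W2 holomorphic_on ball 0 1" "\<And>z. norm z < 1 \<Longrightarrow> (norm (fn g z))\<^sup>2 \<le> Re (W2 z)"
    using harmonic_majorant by metis
  define W where "W z = W1 z + W2 z" for z
  define e where "e n = 1 / real (Suc n)" for n
  define k where "k n z = 1 / (1 + of_real (e n) * W z)" for n z
  have e: "0 < e n" "e n \<le> 1" for n by (auto simp: e_def)
  have Wf: "(norm (fn f z))\<^sup>2 \<le> Re (W z)" and Wg: "(norm (fn g z))\<^sup>2 \<le> Re (W z)" if "norm z < 1" for z
    using W1(2)[OF that] W2(2)[OF that] zero_le_power2[of "norm (fn f z)"] zero_le_power2[of "norm (fn g z)"]
    unfolding W_def plus_complex.sel by linarith+
  have W0: "0 \<le> Re (W z)" if "norm z < 1" for z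
    using Wf[OF that] zero_le_power2[of "norm (fn f z)"] by linarith
  have nW: "1 + e n * Re (W z) \<le> norm (1 + of_real (e n) * W z)" for n z
    using complex_Re_le_cmod[of "1 + of_real (e n) * W z"] by simp
  have ge1: "1 \<le> norm (1 + of_real (e n) * W z)" if "norm z < 1" for n z
    using nW[of n z] W0[OF that] e(1)[of n] by (smt (verit) mult_nonneg_nonneg)
  then have nz: "1 + of_real (e n) * W z \<noteq> 0" if "norm z < 1" for n z
    using that by (metis norm_zero not_one_le_zero)
  have holW: "W holomorphic_on ball 0 1" unfolding W_def using W1 W2 by (intro holomorphic_intros)
  have holk: "k n holomorphic_on ball 0 1" for n
    unfolding k_def by (intro holomorphic_intros holW) (use nz in auto)
  have k1: "norm (k n z) \<le> 1" if "norm z < 1" for n z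
    using ge1[OF that, of n] by (simp add: k_def norm_divide divide_le_eq)
  have kH: "k n \<in> Hinf" for n using holk k1 by (rule HinfI)
  have k_lim: "(\<lambda>n. k n z) \<longlonglongrightarrow> 1" for z
  proof -
    have "e \<longlonglongrightarrow> 0" unfolding e_def[abs_def] by (rule lim_inverse_n'[THEN LIMSEQ_Suc])
    then have "(\<lambda>n. 1 / (1 + of_real (e n) * W z)) \<longlonglongrightarrow> 1 / (1 + of_real 0 * W z)"
      by (intro tendsto_intros) auto
    then show ?thesis by (simp add: k_def)
  qed
  have kb: "fn (mul (k n) h) \<in> Hinf" if h: "\<And>z. norm z < 1 \<Longrightarrow> (norm (fn h z))\<^sup>2 \<le> Re (W z)" for h n
  proof (rule HinfI[OF fn_holomorphic])
    fix z :: complex assume z: "norm z < 1"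
    have "e n * norm (fn h z) \<le> 1 + e n * (norm (fn h z))\<^sup>2"
    proof -
      have "norm (fn h z) \<le> 1 + (norm (fn h z))\<^sup>2"
        using sum_squares_bound[of 1 "norm (fn h z)"] norm_ge_zero[of "fn h z"]
        unfolding mult_1_right one_power2 by linarith
      then have "e n * norm (fn h z) \<le> e n * (1 + (norm (fn h z))\<^sup>2)" using e(1)[of n] by (intro mult_left_mono) auto
      then show ?thesis using e(2)[of n] by (simp add: algebra_simps)
    qed
    also have "\<dots> \<le> 1 + e n * Re (W z)" using h[OF z] e(1)[of n] by (simp add: mult_left_mono)
    also have "\<dots> \<le> norm (1 + of_real (e n) * W z)" by (rule nW)
    finally have *: "e n * norm (fn h z) \<le> norm (1 + of_real (e n) * W z)" .
    have "norm (fn (mul (k n) h) z) = norm (fn h z) / norm (1 + of_real (e n) * W z)"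
      by (simp add: kH) (simp add: k_def norm_divide norm_mult)
    also have "\<dots> \<le> norm (1 + of_real (e n) * W z) / e n / norm (1 + of_real (e n) * W z)"
      using * e(1)[of n] by (intro divide_right_mono) (simp_all add: pos_le_divide_eq mult.commute)
    also have "\<dots> = 1 / e n" using nz[OF z, of n] by simp
    finally show "norm (fn (mul (k n) h) z) \<le> 1 / e n" .
  qed
  have quot: "\<exists>q\<in>Hinf. \<forall>z\<in>ball 0 1. k m z = k n z * q z" for n m
  proof -
    define q where "q z = (1 + of_real (e n) * W z) * k m z" for z
    \<comment> \<open>Division with remainder of one denominator by the other: as linear polynomials
      in \<open>W\<close> they have a constant quotient and a constant remainder.\<close>
    have qe: "q z = of_real (e n / e m) + of_real (1 - e n / e m) * k m z" if "norm z < 1" for z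
    proof -
      have "q z = (1 + of_real (e n) * W z) / (1 + of_real (e m) * W z)" by (simp add: q_def k_def)
      moreover have "(1 + of_real (e n) * W z) = of_real (e n / e m) * (1 + of_real (e m) * W z) + of_real (1 - e n / e m)"
        using e(1)[of m] by (simp add: algebra_simps)
      ultimately show ?thesis using nz[OF that, of m] by (simp add: k_def add_divide_distrib)
    qed
    have "q \<in> Hinf" by (rule Hinf_cong[of "\<lambda>z. of_real (e n / e m) + of_real (1 - e n / e m) * k m z"])
       (use kH qe in \<open>auto intro!: Hinf_add Hinf_mult\<close>)
    moreover have "\<forall>z\<in>ball 0 1. k m z = k n z * q z" using nz by (auto simp: q_def k_def)
    ultimately show ?thesis by blast
  qed
  show ?thesis using that[of k] kH k1 k_lim kb[OF Wf] kb[OF Wg] quot by blast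
qed

section \<open>Pairwise coprime divisors\<close>

abbreviation one :: h2 where "one \<equiv> hpoly 1"

lemma fn_one [simp]: "norm z < 1 \<Longrightarrow> fn one z = 1"
  by (simp add: fn_hpoly)

lemma mul_fn_one [simp]: "fn a \<in> Hinf \<Longrightarrow> mul (fn a) one = a"
  by (rule fn_eqI) simp

lemma fn_hpoly_Hinf: "fn (hpoly p) \<in> Hinf"
  by (rule Hinf_cong[of "poly p"]) (simp_all add: fn_hpoly)

lemma mul_fn_commute: "fn a \<in> Hinf \<Longrightarrow> fn b \<in> Hinf \<Longrightarrow> mul (fn a) b = mul (fn b) a"
  by (rule fn_eqI) simp

text \<open>Membership in the range only supplies a square-summable quotient; its boundedness is
  \<open>isom_mult_division\<close>.\<close>

lemma range_mul_hinf_dvd: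
  assumes "isom_mult w" "mul u one \<in> range (mul w)" "u \<in> Hinf"
  shows "hinf_dvd w u"
proof -
  obtain h where h: "mul u one = mul w h" using assms(2) by blast
  have e: "w z * fn h z = u z" if "norm z < 1" for z
    using arg_cong[OF h, of "\<lambda>x. fn x z"] assms that by simp
  have "fn h \<in> Hinf" by (rule isom_mult_division[OF assms(1,3) e])
  then show ?thesis unfolding hinf_dvd_def using e by (intro bexI[of _ "fn h"]) auto
qed

text \<open>Multiplying by \<open>q\<close> and then by the isometry \<open>w\<close> is the
  isometry \<open>v\<close>, so \<open>q\<close> preserves norms as well.\<close>

lemma isom_mult_cofactor:
  assumes "isom_mult w" "isom_mult v" "q \<in> Hinf" "\<And>z. norm z < 1 \<Longrightarrow> v z = w z * q z"
  shows "isom_mult q"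
  unfolding isom_mult_def
proof (intro conjI allI assms)
  fix a
  have "mul v a = mul w (mul q a)" by (rule fn_eqI) (use assms in simp)
  then show "norm (mul q a) = norm a" using assms(1,2) by (metis isom_mult_def)
qed

lemma isom_mult_mult:
  assumes "isom_mult v" "isom_mult w" shows "isom_mult (\<lambda>z. v z * w z)"
  unfolding isom_mult_def
proof (intro conjI allI)
  fix a show "norm (mul (\<lambda>z. v z * w z) a) = norm a"
    using assms mul_mul[of v w a] by (metis isom_mult_def)
qed (use assms in simp)

lemma isom_mult_const_one: "isom_mult (\<lambda>_. 1)"
  by (simp add: isom_mult_def)

lemma isom_mult_prod:
  "finite S \<Longrightarrow> (\<And>i. i \<in> S \<Longrightarrow> isom_mult (w i)) \<Longrightarrow> isom_mult (\<lambda>z. \<Prod>i\<in>S. w i z)"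
  by (induction S rule: finite_induct) (simp_all add: isom_mult_const_one isom_mult_mult)

text \<open>Coprimality as an approximate Bezout identity: the closure of the sum of the two ranges
  is invariant, so containing \<open>one\<close> means being all of H^2.\<close>

definition coprime_mult :: "(complex \<Rightarrow> complex) \<Rightarrow> (complex \<Rightarrow> complex) \<Rightarrow> bool" where
  "coprime_mult v w \<longleftrightarrow> one \<in> closure {mul v a + mul w b |a b. True}"

text \<open>Euclid's lemma in the limit: the approximate Bezout identity is multiplied by
  \<open>h\<close>, after which both terms lie in the closed range of \<open>w\<close>.\<close>

lemma coprime_mult_dvd:
  assumes "isom_mult v" "isom_mult w" "coprime_mult v w" "h \<in> Hinf" "hinf_dvd w (\<lambda>z. v z * h z)"
  shows "hinf_dvd w h"
proof -
  obtain q where q: "q \<in> Hinf" "\<And>z. norm z < 1 \<Longrightarrow> v z * h z = w z * q z"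
    using assms(5) unfolding hinf_dvd_def by auto
  obtain x where x: "\<And>n. \<exists>a b. x n = mul v a + mul w b" "x \<longlonglongrightarrow> one"
    using assms(3) unfolding coprime_mult_def closure_sequential by blast
  have "mul h (x n) \<in> range (mul w)" for n
  proof -
    obtain a b where ab: "x n = mul v a + mul w b" using x(1) by blast
    have "mul h (x n) = mul w (mul q a + mul h b)"
    proof (rule fn_eqI)
      fix z :: complex assume z: "norm z < 1"
      have "fn (mul h (x n)) z = (v z * h z) * fn a z + w z * (h z * fn b z)"
        using assms by (simp add: ab algebra_simps)
      also have "\<dots> = fn (mul w (mul q a + mul h b)) z"
        unfolding q(2)[OF z] using assms q by (simp add: algebra_simps)
      finally show "fn (mul h (x n)) z = fn (mul w (mul q a + mul h b)) z" .
    qed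
    then show ?thesis by blast
  qed
  moreover have "(\<lambda>n. mul h (x n)) \<longlonglongrightarrow> mul h one" by (intro tendsto_intros assms x)
  ultimately have "mul h one \<in> range (mul w)"
    by (rule closed_sequentially[OF closed_range_mul[OF assms(2)]])
  then show ?thesis using assms by (intro range_mul_hinf_dvd)
qed

lemma coprime_prod_cancel:
  assumes "finite S" "\<And>i. i \<in> S \<Longrightarrow> isom_mult (v i) \<and> coprime_mult (v i) w"
    "isom_mult w" "h \<in> Hinf" "hinf_dvd w (\<lambda>z. (\<Prod>i\<in>S. v i z) * h z)"
  shows "hinf_dvd w h"
  using assms(1,2,5)
proof (induction S rule: finite_induct)
  case (insert i S)
  have P: "isom_mult (\<lambda>z. \<Prod>i\<in>S. v i z)" using insert by (intro isom_mult_prod) auto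
  have "hinf_dvd w (\<lambda>z. (\<Prod>i\<in>S. v i z) * h z)"
  proof (rule coprime_mult_dvd[of "v i"])
    show "hinf_dvd w (\<lambda>z. v i z * ((\<Prod>i\<in>S. v i z) * h z))" using insert by (simp add: mult.assoc)
  qed (use insert assms P in auto)
  then show ?case using insert by blast
qed simp

text \<open>A new divisor divides the product times the remaining cofactor; being coprime to each
  earlier factor, it divides the cofactor.\<close>

lemma coprime_prod_dvd:
  assumes "finite S" "\<And>i. i \<in> S \<Longrightarrow> isom_mult (v i) \<and> hinf_dvd (v i) p"
    "\<And>i j. i \<in> S \<Longrightarrow> j \<in> S \<Longrightarrow> i \<noteq> j \<Longrightarrow> coprime_mult (v i) (v j)" "p \<in> Hinf"
  shows "hinf_dvd (\<lambda>z. \<Prod>i\<in>S. v i z) p"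
  using assms(1-3)
proof (induction S rule: finite_induct)
  case empty
  show ?case using assms(4) by (auto simp: hinf_dvd_def)
next
  case (insert i S)
  then obtain h where h: "h \<in> Hinf" "\<And>z. norm z < 1 \<Longrightarrow> p z = (\<Prod>i\<in>S. v i z) * h z"
    unfolding hinf_dvd_def by auto
  obtain g where g: "g \<in> Hinf" "\<And>z. norm z < 1 \<Longrightarrow> p z = v i z * g z"
    using insert.prems(1)[of i] unfolding hinf_dvd_def by auto
  have "hinf_dvd (v i) (\<lambda>z. (\<Prod>i\<in>S. v i z) * h z)"
    unfolding hinf_dvd_def using g h by (intro bexI[of _ g]) auto
  then have "hinf_dvd (v i) h"
    using insert h by (intro coprime_prod_cancel[of S v "v i" h]) auto
  then obtain k where k: "k \<in> Hinf" "\<And>z. norm z < 1 \<Longrightarrow> h z = v i z * k z"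
    unfolding hinf_dvd_def by auto
  show ?case
    unfolding hinf_dvd_def using k h insert.hyps by (intro bexI[of _ k]) auto
qed

lemma isom_mult_norm_eq_1:
  assumes "isom_mult w" "norm z < 1" "norm (w z) = 1"
  obtains c where "norm c = 1" "\<And>x. norm x < 1 \<Longrightarrow> w x = c"
proof -
  have "w constant_on ball 0 1"
    by (rule maximum_modulus_principle[of w "ball 0 1" "ball 0 1" z])
       (use assms Hinf_holomorphic isom_mult_le_1 in auto)
  then obtain c where "\<And>x. x \<in> ball 0 1 \<Longrightarrow> w x = c" unfolding constant_on_def by blast
  then show ?thesis using that[of c] assms by auto
qed

text \<open>The coefficient of \<open>f\<close> must be bounded because \<open>f\<close> itself need
  not be, while the bounded \<open>w\<close> may take any H^2 coefficient.\<close>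

definition ideal :: "h2 \<Rightarrow> (complex \<Rightarrow> complex) \<Rightarrow> h2 set" where
  "ideal f w = {mul a f + mul w b |a b. a \<in> Hinf}"

lemma hinf_subI:
  assumes "0 \<in> M" "\<And>a b. a \<in> M \<Longrightarrow> b \<in> M \<Longrightarrow> a + b \<in> M" "\<And>u a. u \<in> Hinf \<Longrightarrow> a \<in> M \<Longrightarrow> mul u a \<in> M"
  shows "hinf_sub M"
  unfolding hinf_sub_def subspace_def using assms mul_const_real Hinf_const by metis

lemma hinf_sub_ideal:
  assumes w: "w \<in> Hinf" shows "hinf_sub (ideal f w)"
proof (rule hinf_subI)
  show "0 \<in> ideal f w"
    unfolding ideal_def using w by (auto intro!: exI[of _ "\<lambda>_. 0"] exI[of _ 0])
next
  fix x y assume "x \<in> ideal f w" "y \<in> ideal f w"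
  then obtain a b c d where *: "x = mul a f + mul w b" "y = mul c f + mul w d" "a \<in> Hinf" "c \<in> Hinf"
    unfolding ideal_def by blast
  then have "x + y = mul (\<lambda>z. a z + c z) f + mul w (b + d)"
    using w by (simp add: mul_plus_fun mul_add)
  then show "x + y \<in> ideal f w" unfolding ideal_def using * by auto
next
  fix u x assume u: "u \<in> Hinf" and "x \<in> ideal f w"
  then obtain a b where *: "x = mul a f + mul w b" "a \<in> Hinf" unfolding ideal_def by blast
  then have "mul u x = mul (\<lambda>z. u z * a z) f + mul w (mul u b)"
    using w u by (simp add: mul_add mul_mul mult.commute)
  then show "mul u x \<in> ideal f w" unfolding ideal_def using * u by auto
qed

lemma hinf_sub_plus:
  assumes "hinf_sub M" "hinf_sub N" shows "hinf_sub {x + y |x y. x \<in> M \<and> y \<in> N}"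
proof (rule hinf_subI)
  have "0 \<in> M" "0 \<in> N" using assms subspace_0 by (auto simp: hinf_sub_def)
  then show "0 \<in> {x + y |x y. x \<in> M \<and> y \<in> N}" by force
next
  fix a b assume "a \<in> {x + y |x y. x \<in> M \<and> y \<in> N}" "b \<in> {x + y |x y. x \<in> M \<and> y \<in> N}"
  then obtain x y x' y' where "a = x + y" "x \<in> M" "y \<in> N" "b = x' + y'" "x' \<in> M" "y' \<in> N" by blast
  then show "a + b \<in> {x + y |x y. x \<in> M \<and> y \<in> N}"
    using assms subspace_add unfolding hinf_sub_def
    by (intro CollectI exI[of _ "x + x'"] exI[of _ "y + y'"]) auto
next
  fix u a assume "u \<in> Hinf" "a \<in> {x + y |x y. x \<in> M \<and> y \<in> N}"
  then show "mul u a \<in> {x + y |x y. x \<in> M \<and> y \<in> N}"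
    using assms unfolding hinf_sub_def by (force simp: mul_add)
qed

lemma generator_mem_ideal: "w \<in> Hinf \<Longrightarrow> f \<in> ideal f w"
  unfolding ideal_def by (intro CollectI exI[of _ "\<lambda>_. 1"] exI[of _ 0]) simp

lemma multiple_mem_ideal: "mul w b \<in> ideal f w"
  unfolding ideal_def by (intro CollectI exI[of _ "\<lambda>_. 0"] exI[of _ b]) simp

lemma ideal_subset:
  assumes "hinf_sub M" "f \<in> M" "range (mul w) \<subseteq> M" shows "ideal f w \<subseteq> M"
  using assms subspace_add unfolding ideal_def hinf_sub_def by blast

text \<open>Modulo \<open>\<psi>\<close>, the combinations \<open>f + \<alpha> g\<close> generate pairwise coprime ideals relative to the ideal
  generated by \<open>f\<close> and \<open>g\<close>. Since \<open>\<psi>\<close> has only countably many pairwise coprime nonconstant divisors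
  (compare the values at a point where \<open>\<psi>\<close> does not vanish), all but countably many \<open>\<alpha>\<close> generate
  the same ideal as \<open>f\<close> and \<open>g\<close>.\<close>

lemma generic_combination:
  assumes \<psi>: "isom_mult \<psi>" and eps: "0 < \<epsilon>"
  obtains \<alpha> :: real where "0 < \<alpha>" "\<alpha> < \<epsilon>" "g \<in> closure (ideal (f + \<alpha> *\<^sub>R g) \<psi>)"
proof -
  define M where "M \<alpha> = closure (ideal (f + \<alpha> *\<^sub>R g) \<psi>)" for \<alpha> :: real
  define N where "N = closure {x + y |x y. x \<in> ideal f \<psi> \<and> y \<in> ideal g \<psi>}"
  have \<psi>H: "\<psi> \<in> Hinf" using \<psi> by simp
  have subM: "hinf_sub (M \<alpha>)" "closed (M \<alpha>)" for \<alpha>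
    unfolding M_def by (auto intro!: hinf_sub_closure hinf_sub_ideal \<psi>H)
  have subN: "hinf_sub N" "closed N"
    unfolding N_def by (auto intro!: hinf_sub_closure hinf_sub_plus hinf_sub_ideal \<psi>H)
  have "0 \<in> ideal h \<psi>" for h using hinf_sub_ideal[OF \<psi>H] subspace_0 unfolding hinf_sub_def by blast
  then have fgN: "f \<in> N" "g \<in> N" "mul \<psi> b \<in> N" for b
    unfolding N_def using generator_mem_ideal[OF \<psi>H] multiple_mem_ideal
    by (intro subsetD[OF closure_subset] CollectI; metis add.right_neutral add.left_neutral)+
  have \<psi>M: "mul \<psi> b \<in> M \<alpha>" for \<alpha> b
    unfolding M_def using multiple_mem_ideal closure_subset by blast
  have genM: "f + \<alpha> *\<^sub>R g \<in> M \<alpha>" for \<alpha>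
    unfolding M_def using generator_mem_ideal[OF \<psi>H] closure_subset by blast
  have MN: "M \<alpha> \<subseteq> N" for \<alpha>
    unfolding M_def
    by (intro closure_minimal subN ideal_subset) (use fgN subN in \<open>auto simp: hinf_sub_def intro!: subspace_add subspace_scale\<close>)
  have one0: "mul \<psi> one \<noteq> 0"
  proof
    assume "mul \<psi> one = 0"
    then have "mul \<psi> one = mul \<psi> 0" using \<psi>H by simp
    then have "one = 0" using \<psi> isom_mult_inject by blast
    then show False using fn_one[of 0] by simp
  qed
  obtain \<omega> where \<omega>: "isom_mult \<omega>" "N = range (mul \<omega>)" using beurling[OF subN(2,1) fgN(3) one0] by blast
  have "\<exists>w. isom_mult w \<and> M \<alpha> = range (mul w)" for \<alpha> using beurling[OF subM(2,1) \<psi>M one0] by metis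
  then obtain w where w: "\<And>\<alpha>. isom_mult (w \<alpha>)" "\<And>\<alpha>. M \<alpha> = range (mul (w \<alpha>))" by metis
  have "mul (w \<alpha>) one \<in> range (mul \<omega>)" for \<alpha> using MN[of \<alpha>] w \<omega> by auto
  then have "hinf_dvd \<omega> (w \<alpha>)" for \<alpha> using \<omega> w by (intro range_mul_hinf_dvd) auto
  \<comment> \<open>The quotient \<open>\<eta> \<alpha>\<close> measures how far
    \<open>M \<alpha>\<close> falls short of \<open>N\<close>. Where it is a unimodular constant the
    two subspaces agree.\<close>
  then obtain \<eta> where \<eta>H: "\<And>\<alpha>. \<eta> \<alpha> \<in> Hinf" and \<eta>: "\<And>\<alpha> z. norm z < 1 \<Longrightarrow> w \<alpha> z = \<omega> z * \<eta> \<alpha> z"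
    unfolding hinf_dvd_def by (metis mem_ball_0)
  have iso\<eta>: "isom_mult (\<eta> \<alpha>)" for \<alpha>
    using isom_mult_cofactor[OF \<omega>(1) w(1) \<eta>H \<eta>] .
  have w_mul: "mul (w \<alpha>) a = mul \<omega> (mul (\<eta> \<alpha>) a)" for \<alpha> a
    by (rule fn_eqI) (use \<omega> w \<eta>H \<eta> in \<open>simp add: mult.assoc\<close>)
  have "hinf_dvd \<omega> \<psi>" using \<omega> fgN \<psi>H by (intro range_mul_hinf_dvd) auto
  then obtain p where p: "p \<in> Hinf" "\<And>z. norm z < 1 \<Longrightarrow> \<psi> z = \<omega> z * p z" unfolding hinf_dvd_def by auto
  have isop: "isom_mult p" using isom_mult_cofactor[OF \<omega>(1) \<psi> p] .
  have \<eta>p: "hinf_dvd (\<eta> \<alpha>) p" for \<alpha>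
  proof (rule range_mul_hinf_dvd[OF iso\<eta> _ p(1)])
    obtain k where "mul \<psi> one = mul (w \<alpha>) k" using \<psi>M[of one \<alpha>] w by auto
    moreover have "mul \<psi> one = mul \<omega> (mul p one)"
      by (rule fn_eqI) (use \<omega> p \<psi>H in simp)
    ultimately have "mul \<omega> (mul p one) = mul \<omega> (mul (\<eta> \<alpha>) k)" by (simp add: w_mul)
    then show "mul p one \<in> range (mul (\<eta> \<alpha>))" using isom_mult_inject[OF \<omega>(1)] by auto
  qed
  \<comment> \<open>The difference of two combinations recovers \<open>g\<close>, and then
    \<open>f\<close>, so \<open>M \<alpha>\<close> and \<open>M \<beta>\<close> together are dense
    in \<open>N\<close>. Cancelling the isometry \<omega> turns this into density of the two ranges
    in H^2.\<close>
  have cop: "coprime_mult (\<eta> \<alpha>) (\<eta> \<beta>)" if ne: "\<alpha> \<noteq> \<beta>" for \<alpha> \<beta>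
  proof -
    define T where "T = {x + y |x y. x \<in> M \<alpha> \<and> y \<in> M \<beta>}"
    have subT: "hinf_sub T" unfolding T_def by (intro hinf_sub_plus subM)
    have spT: "subspace T" using subT by (simp add: hinf_sub_def)
    have "0 \<in> M \<gamma>" for \<gamma> using subM subspace_0 unfolding hinf_sub_def by blast
    then have MT: "M \<alpha> \<subseteq> T" "M \<beta> \<subseteq> T" unfolding T_def by force+
    have fa: "f + \<alpha> *\<^sub>R g \<in> T" "f + \<beta> *\<^sub>R g \<in> T" using MT genM by auto
    have "(1 / (\<alpha> - \<beta>)) *\<^sub>R ((f + \<alpha> *\<^sub>R g) - (f + \<beta> *\<^sub>R g)) \<in> T"
      by (intro subspace_scale subspace_diff spT fa)
    also have "(1 / (\<alpha> - \<beta>)) *\<^sub>R ((f + \<alpha> *\<^sub>R g) - (f + \<beta> *\<^sub>R g)) = g"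
    proof -
      have "(f + \<alpha> *\<^sub>R g) - (f + \<beta> *\<^sub>R g) = (\<alpha> - \<beta>) *\<^sub>R g" by (simp add: scaleR_left_diff_distrib)
      then show ?thesis using ne by simp
    qed
    finally have gT: "g \<in> T" .
    have "(f + \<alpha> *\<^sub>R g) - \<alpha> *\<^sub>R g \<in> T" by (intro subspace_diff subspace_scale spT fa gT)
    then have fT: "f \<in> T" by simp
    have \<psi>T: "range (mul \<psi>) \<subseteq> T" using \<psi>M MT by blast
    have "N \<subseteq> closure T"
      unfolding N_def using ideal_subset[OF subT fT \<psi>T] ideal_subset[OF subT gT \<psi>T] subspace_add[OF spT]
      by (intro closure_mono) blast
    then have "mul \<omega> one \<in> closure T" using \<omega> by auto
    then obtain x where x: "\<And>n. x n \<in> T" "x \<longlonglongrightarrow> mul \<omega> one" unfolding closure_sequential by blast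
    have "\<exists>a b. x n = mul \<omega> (mul (\<eta> \<alpha>) a + mul (\<eta> \<beta>) b)" for n
      using x(1)[of n] \<omega> unfolding T_def w by (auto simp: w_mul mul_add)
    then obtain a b where ab: "\<And>n. x n = mul \<omega> (mul (\<eta> \<alpha>) (a n) + mul (\<eta> \<beta>) (b n))" by metis
    have "(\<lambda>n. mul (\<eta> \<alpha>) (a n) + mul (\<eta> \<beta>) (b n)) \<longlonglongrightarrow> one"
    proof (rule LIM_zero_cancel, rule tendsto_norm_zero_cancel)
      have "norm (x n - mul \<omega> one) = norm (mul (\<eta> \<alpha>) (a n) + mul (\<eta> \<beta>) (b n) - one)" for n
        unfolding ab using \<omega>(1) by (simp add: isom_mult_def flip: mul_diff)
      then show "(\<lambda>n. norm (mul (\<eta> \<alpha>) (a n) + mul (\<eta> \<beta>) (b n) - one)) \<longlonglongrightarrow> 0"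
        using tendsto_norm_zero[OF LIM_zero[OF x(2)]] by simp
    qed
    then show ?thesis unfolding coprime_mult_def closure_sequential
      by (intro CollectI exI[of _ "\<lambda>n. mul (\<eta> \<alpha>) (a n) + mul (\<eta> \<beta>) (b n)"]) auto
  qed
  have "mul p one \<noteq> 0"
  proof
    assume "mul p one = 0"
    then have "norm (mul p one) = 0" by simp
    then have "one = 0" using isop by (metis isom_mult_def norm_eq_zero)
    then show False using fn_one[of 0] by simp
  qed
  then obtain z where z: "norm z < 1" "p z \<noteq> 0" using fn_eqI[of "mul p one" 0] p(1) by auto
  have const: "g \<in> M \<alpha>" if eq1: "norm (\<eta> \<alpha> z) = 1" for \<alpha>
  proof -
    obtain c where c: "norm c = 1" "\<And>x. norm x < 1 \<Longrightarrow> \<eta> \<alpha> x = c"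
      using isom_mult_norm_eq_1[OF iso\<eta> z(1) eq1] by blast
    obtain h where h: "g = mul \<omega> h" using fgN \<omega> by blast
    have "g = mul (w \<alpha>) (mul (\<lambda>_. 1 / c) h)"
      unfolding h w_mul by (rule fn_eqI) (use c \<omega> \<eta>H in \<open>auto simp: c(2)\<close>)
    then show ?thesis using w by blast
  qed
  have "\<exists>\<alpha>\<in>{0<..<\<epsilon>}. g \<in> M \<alpha>"
  proof (rule ccontr)
    assume neg: "\<not> ?thesis"
    \<comment> \<open>The parameters are sorted by how far the quotient stays below modulus 1 at
      \<open>z\<close>. An uncountable interval cannot be a countable union of finite sets, so one
      class is infinite.\<close>
    define A where "A m = {\<alpha> \<in> {0<..<\<epsilon>}. norm (\<eta> \<alpha> z) \<le> 1 - 1 / real (Suc m)}" for m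
    have "{0<..<\<epsilon>} \<subseteq> (\<Union>m. A m)"
    proof
      fix \<alpha> assume \<alpha>: "\<alpha> \<in> {0<..<\<epsilon>}"
      then have "norm (\<eta> \<alpha> z) \<noteq> 1" using neg const by blast
      then have "0 < 1 - norm (\<eta> \<alpha> z)" using isom_mult_le_1[OF iso\<eta> z(1), of \<alpha>] by simp
      then obtain m where "1 / real (Suc m) < 1 - norm (\<eta> \<alpha> z)" using nat_approx_posE by blast
      then have "\<alpha> \<in> A m" using \<alpha> unfolding A_def by simp
      then show "\<alpha> \<in> (\<Union>m. A m)" by blast
    qed
    then have "uncountable (\<Union>m. A m)"
      using uncountable_open_interval[of 0 \<epsilon>] eps countable_subset by blast
    then obtain m where inf: "infinite (A m)" using countable_finite by blast
    \<comment> \<open>Any \<open>k\<close> of the pairwise coprime quotients have a product dividing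
      \<open>p\<close>, and the remaining cofactor has modulus at most 1.\<close>
    have "norm (p z) \<le> (1 - 1 / real (Suc m)) ^ k" for k
    proof -
      obtain S where S: "S \<subseteq> A m" "finite S" "card S = k"
        using infinite_arbitrarily_large[OF inf] by blast
      have isoP: "isom_mult (\<lambda>z. \<Prod>\<alpha>\<in>S. \<eta> \<alpha> z)" using S iso\<eta> by (intro isom_mult_prod) auto
      have "hinf_dvd (\<lambda>z. \<Prod>\<alpha>\<in>S. \<eta> \<alpha> z) p"
        using S iso\<eta> \<eta>p cop p by (intro coprime_prod_dvd) auto
      then obtain q where q: "q \<in> Hinf" "\<And>z. norm z < 1 \<Longrightarrow> p z = (\<Prod>\<alpha>\<in>S. \<eta> \<alpha> z) * q z"
        unfolding hinf_dvd_def by auto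
      have "norm (q z) \<le> 1" using isom_mult_le_1[OF isom_mult_cofactor[OF isoP isop q] z(1)] .
      then have "norm (p z) \<le> norm (\<Prod>\<alpha>\<in>S. \<eta> \<alpha> z) * 1"
        unfolding q(2)[OF z(1)] norm_mult by (intro mult_left_mono) auto
      also have "\<dots> = (\<Prod>\<alpha>\<in>S. norm (\<eta> \<alpha> z))" by (simp add: prod_norm)
      also have "\<dots> \<le> (\<Prod>\<alpha>\<in>S. 1 - 1 / real (Suc m))"
        using S unfolding A_def by (intro prod_mono) auto
      finally show ?thesis using S by simp
    qed
    moreover have "(\<lambda>k. (1 - 1 / real (Suc m)) ^ k) \<longlonglongrightarrow> 0"
      by (rule LIMSEQ_realpow_zero) auto
    ultimately have "norm (p z) \<le> 0" by (intro LIMSEQ_le_const) auto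
    then show False using z by simp
  qed
  then show ?thesis using that unfolding M_def by auto
qed

section \<open>Closures of module graphs\<close>

lemma closureI_sequentially:
  fixes x :: "nat \<Rightarrow> 'a::metric_space"
  shows "(\<And>n. x n \<in> S) \<Longrightarrow> x \<longlonglongrightarrow> l \<Longrightarrow> l \<in> closure S"
  unfolding closure_sequential by blast

text \<open>The domain of a closed relation need not be complete, but its graph is, so the category
  argument runs on pairs. Each open condition asks that the ideal of the first coordinate come
  within \<open>1 / real (Suc n)\<close> of \<open>one\<close>.\<close>

lemma cyclic_vector_exists:
  fixes \<Gamma> :: "(h2 \<times> h2) set"
  assumes cl: "closed \<Gamma>" and sub: "subspace \<Gamma>" and dense: "closure (fst ` \<Gamma>) = UNIV" and \<psi>: "isom_mult \<psi>"
  obtains v u where "(v, u) \<in> \<Gamma>" "one \<in> closure (ideal v \<psi>)"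
proof -
  define X where "X = top_of_set \<Gamma>"
  define B where "B n a b = {p :: h2 \<times> h2. norm (mul a (fst p) + mul \<psi> b - one) < 1 / real (Suc n)}" for n a b
  define U where "U n = \<Gamma> \<inter> (\<Union>a\<in>Hinf. \<Union>b. B n a b)" for n
  have topX: "topspace X = \<Gamma>" by (simp add: X_def)
  have opB: "open (B n a b)" if "a \<in> Hinf" for n a b
    unfolding B_def
    by (intro open_Collect_less continuous_on_norm continuous_on_diff continuous_on_add continuous_on_const
          bounded_linear.continuous_on[OF bounded_linear_mul[OF that] continuous_on_fst[OF continuous_on_id]])
  have opU: "openin X (U n)" for n
    unfolding U_def X_def using opB by (intro openin_open_Int open_UN) auto
  have dU: "X closure_of (U n) = topspace X" for n
    unfolding dense_intersects_open
  proof (intro allI impI)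
    fix T assume "openin X T \<and> T \<noteq> {}"
    then obtain p0 where T: "openin X T" "p0 \<in> T" by blast
    then obtain S where S: "open S" "T = \<Gamma> \<inter> S" unfolding X_def by (auto simp: openin_open)
    have p0: "p0 \<in> \<Gamma>" using T S by blast
    obtain r where r: "r > 0" "ball p0 r \<subseteq> S" using S T open_contains_ball by blast
    have "one \<in> closure (fst ` \<Gamma>)" using dense by simp
    then obtain y where y: "y \<in> fst ` \<Gamma>" "dist y one < 1 / real (Suc n)"
      unfolding closure_approachable by (metis of_nat_0_less_iff zero_less_Suc zero_less_divide_1_iff)
    then obtain p1 where p1: "p1 \<in> \<Gamma>" "norm (fst p1 - one) < 1 / real (Suc n)"
      by (auto simp: dist_norm)
    \<comment> \<open>This keeps the perturbed pair inside the ball of radius \<open>r\<close>; the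
      summand 1 avoids division by zero. Both coordinates move together, so the pair stays in
      \<Gamma>, while genericity concerns the first coordinate only.\<close>
    define \<epsilon> where "\<epsilon> = r / (norm p1 + 1)"
    have eps: "\<epsilon> > 0" unfolding \<epsilon>_def using r by (intro divide_pos_pos add_nonneg_pos) auto
    obtain \<alpha> :: real where \<alpha>: "0 < \<alpha>" "\<alpha> < \<epsilon>" "fst p1 \<in> closure (ideal (fst p0 + \<alpha> *\<^sub>R fst p1) \<psi>)"
      using generic_combination[OF \<psi> eps] by blast
    define p where "p = p0 + \<alpha> *\<^sub>R p1"
    have p\<Gamma>: "p \<in> \<Gamma>" unfolding p_def by (intro subspace_add subspace_scale sub p0 p1)
    have "\<alpha> * norm p1 \<le> \<alpha> * (norm p1 + 1)" using \<alpha> by simp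
    also have "\<dots> < \<epsilon> * (norm p1 + 1)" using \<alpha> by (intro mult_strict_right_mono add_nonneg_pos) auto
    also have "\<dots> = r"
    proof -
      have "norm p1 + 1 \<noteq> 0" by (metis add_nonneg_pos norm_ge_zero order_less_irrefl zero_less_one)
      then show ?thesis by (simp add: \<epsilon>_def)
    qed
    finally have "p \<in> ball p0 r" using \<alpha> by (simp add: p_def dist_norm)
    then have pT: "p \<in> T" using S r p\<Gamma> by blast
    obtain x where x: "x \<in> ideal (fst p) \<psi>" "dist x (fst p1) < 1 / real (Suc n) - norm (fst p1 - one)"
      using \<alpha>(3) p1(2) unfolding closure_approachable p_def by (metis diff_gt_0_iff_gt fst_add fst_scaleR)
    then obtain a b where ab: "x = mul a (fst p) + mul \<psi> b" "a \<in> Hinf" unfolding ideal_def by blast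
    have "norm (x - one) \<le> norm (x - fst p1) + norm (fst p1 - one)" by (metis norm_diff_triangle_ineq diff_add_cancel norm_triangle_ineq add_diff_eq)
    then have "norm (x - one) < 1 / real (Suc n)" using x(2) by (simp add: dist_norm)
    then have "p \<in> B n a b" by (simp add: B_def ab)
    then have "p \<in> U n" unfolding U_def using p\<Gamma> ab(2) by blast
    then show "U n \<inter> T \<noteq> {}" using pT by blast
  qed
  have "X closure_of \<Inter> (range U) = topspace X"
  proof (rule Baire_category)
    have "completely_metrizable_space X"
      unfolding X_def using cl
      by (intro completely_metrizable_space_closedin[OF completely_metrizable_space_euclidean]) auto
    then show "completely_metrizable_space X \<or> locally_compact_space X \<and> regular_space X" ..
  qed (use opU dU in auto)
  moreover have "0 \<in> \<Gamma>" using sub subspace_0 by blast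
  ultimately have "\<Inter> (range U) \<noteq> {}" using topX by auto
  then obtain p where p: "\<And>n. p \<in> U n" by blast
  have "one \<in> closure (ideal (fst p) \<psi>)"
    unfolding closure_approachable
  proof (intro allI impI)
    fix e :: real assume "e > 0"
    then obtain n where n: "1 / real (Suc n) < e" using nat_approx_posE by blast
    from p[of n] obtain a b where ab: "a \<in> Hinf" "p \<in> B n a b" unfolding U_def by blast
    then show "\<exists>y\<in>ideal (fst p) \<psi>. dist y one < e"
      using n unfolding ideal_def B_def by (intro bexI[of _ "mul a (fst p) + mul \<psi> b"]) (auto simp: dist_norm)
  qed
  moreover have "(fst p, snd p) \<in> \<Gamma>" using p[of 0] by (simp add: U_def)
  ultimately show ?thesis using that by blast
qed

section \<open>Relations invariant under multiplication\<close>

lemma mul_pair_tendsto: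
  "u \<in> Hinf \<Longrightarrow> (X \<longlongrightarrow> (f, g)) F \<Longrightarrow>
    ((\<lambda>n. (mul u (fst (X n)), mul u (snd (X n)))) \<longlongrightarrow> (mul u f, mul u g)) F"
  using tendsto_fst[of X "(f, g)"] tendsto_snd[of X "(f, g)"]
  by (intro tendsto_Pair tendsto_mul) simp_all

definition mul_inv :: "(h2 \<times> h2) set \<Rightarrow> bool" where
  "mul_inv \<Gamma> \<longleftrightarrow> subspace \<Gamma> \<and> (\<forall>u\<in>Hinf. \<forall>f g. (f, g) \<in> \<Gamma> \<longrightarrow> (mul u f, mul u g) \<in> \<Gamma>)"

lemma mul_invD: "mul_inv \<Gamma> \<Longrightarrow> u \<in> Hinf \<Longrightarrow> (f, g) \<in> \<Gamma> \<Longrightarrow> (mul u f, mul u g) \<in> \<Gamma>"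
  unfolding mul_inv_def by blast

lemma mul_inv_closure:
  assumes "mul_inv \<Gamma>" shows "mul_inv (closure \<Gamma>)"
  unfolding mul_inv_def
proof (intro conjI ballI allI impI)
  show "subspace (closure \<Gamma>)" using assms subspace_closure unfolding mul_inv_def by blast
  fix u f g assume u: "u \<in> Hinf" and "(f, g) \<in> closure \<Gamma>"
  then obtain x where x: "\<And>n. x n \<in> \<Gamma>" "x \<longlonglongrightarrow> (f, g)" unfolding closure_sequential by blast
  then show "(mul u f, mul u g) \<in> closure \<Gamma>"
    unfolding closure_sequential using mul_pair_tendsto[OF u x(2)] mul_invD[OF assms u]
    by (intro exI[of _ "\<lambda>n. (mul u (fst (x n)), mul u (snd (x n)))"]) auto
qed

lemma approximate_bounded_pair:
  assumes "mul_inv \<Gamma>" "(f, g) \<in> \<Gamma>"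
  obtains x where "\<And>n. x n \<in> \<Gamma>" "\<And>n. fn (fst (x n)) \<in> Hinf" "\<And>n. fn (snd (x n)) \<in> Hinf" "x \<longlonglongrightarrow> (f, g)"
proof -
  obtain k where k: "\<And>n. k n \<in> Hinf" "\<And>n z. norm z < 1 \<Longrightarrow> norm (k n z) \<le> 1"
    "\<And>z. norm z < 1 \<Longrightarrow> (\<lambda>n. k n z) \<longlonglongrightarrow> 1"
    "\<And>n. fn (mul (k n) f) \<in> Hinf" "\<And>n. fn (mul (k n) g) \<in> Hinf"
    "\<And>n m. \<exists>q\<in>Hinf. \<forall>z\<in>ball 0 1. k m z = k n z * q z" by (rule bounded_regularizer[of f g]) (rule that)
  have "(\<lambda>n. (mul (k n) f, mul (k n) g)) \<longlonglongrightarrow> (f, g)"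
    using k by (intro tendsto_Pair mul_tendsto_self)
  then show ?thesis using that[of "\<lambda>n. (mul (k n) f, mul (k n) g)"] k mul_invD[OF assms(1)] assms(2) by simp
qed

text \<open>The elements of \<open>F\<close> approach \<open>one\<close> only in norm, so their
  products with unbounded \<open>f\<close> and \<open>g\<close> need not converge. A regularizer
  makes \<open>f\<close> and \<open>g\<close> bounded, the limit in \<open>F\<close> is taken, and
  the regularizer is removed last.\<close>

lemma cancel_approximate_unit:
  assumes "closed \<Gamma>" "mul_inv \<Gamma>" "one \<in> closure F"
    "\<And>w. w \<in> F \<Longrightarrow> fn w \<in> Hinf" "\<And>w. w \<in> F \<Longrightarrow> (mul (fn w) f, mul (fn w) g) \<in> \<Gamma>"
  shows "(f, g) \<in> \<Gamma>"
proof -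
  obtain w where w: "\<And>n. w n \<in> F" "w \<longlonglongrightarrow> one" using assms(3) unfolding closure_sequential by blast
  obtain k where k: "\<And>n. k n \<in> Hinf" "\<And>n z. norm z < 1 \<Longrightarrow> norm (k n z) \<le> 1"
    "\<And>z. norm z < 1 \<Longrightarrow> (\<lambda>n. k n z) \<longlonglongrightarrow> 1"
    "\<And>n. fn (mul (k n) f) \<in> Hinf" "\<And>n. fn (mul (k n) g) \<in> Hinf"
    "\<And>n m. \<exists>q\<in>Hinf. \<forall>z\<in>ball 0 1. k m z = k n z * q z" by (rule bounded_regularizer[of f g]) (rule that)
  have "(mul (k n) f, mul (k n) g) \<in> \<Gamma>" for n
  proof (rule closed_sequentially[OF assms(1)])
    \<comment> \<open>The roles of factor and vector are exchanged: the bounded product acts as the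
      multiplier on the convergent sequence \<open>w\<close>.\<close>
    have c: "mul (k n) (mul (fn (w j)) h) = mul (fn (mul (k n) h)) (w j)" if "fn (mul (k n) h) \<in> Hinf" for j h
      by (rule fn_eqI) (use k assms(4)[OF w(1)] that in \<open>simp add: mult.assoc mult.commute\<close>)
    show "(mul (k n) (mul (fn (w j)) f), mul (k n) (mul (fn (w j)) g)) \<in> \<Gamma>" for j
      by (intro mul_invD[OF assms(2)] k assms(5) w)
    have "(\<lambda>j. (mul (fn (mul (k n) f)) (w j), mul (fn (mul (k n) g)) (w j)))
      \<longlonglongrightarrow> (mul (fn (mul (k n) f)) one, mul (fn (mul (k n) g)) one)"
      by (intro tendsto_Pair tendsto_mul k w)
    then show "(\<lambda>j. (mul (k n) (mul (fn (w j)) f), mul (k n) (mul (fn (w j)) g)))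
      \<longlonglongrightarrow> (mul (k n) f, mul (k n) g)"
      by (simp add: c k)
  qed
  moreover have "(\<lambda>n. (mul (k n) f, mul (k n) g)) \<longlonglongrightarrow> (f, g)"
    using k by (intro tendsto_Pair mul_tendsto_self)
  ultimately show ?thesis by (rule closed_sequentially[OF assms(1)])
qed

text \<open>This is the graph of a map between the quotients of H^2 by \<theta> H^2 and \<phi> H^2,
  lifted to H^2. The assumption \<open>single\<close> is well-definedness of that map; the same
  property for the closure of \<open>G\<close> is closability and has to be proved.\<close>

locale module_graph =
  fixes \<theta> \<phi> :: "complex \<Rightarrow> complex" and G :: "(h2 \<times> h2) set"
  assumes \<theta>: "isom_mult \<theta>" and \<phi>: "isom_mult \<phi>" and inv: "mul_inv G"
    and kernel: "(mul \<theta> h, mul \<phi> k) \<in> G"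
    and single: "(mul \<theta> h, g) \<in> G \<Longrightarrow> g \<in> range (mul \<phi>)"
    and dense: "closure (fst ` G) = UNIV"
begin

text \<open>The reference pair \<open>f\<close>, \<open>g\<close> is meant to be bounded, which
  makes the determinant continuous in the other pair.\<close>

definition det :: "h2 \<Rightarrow> h2 \<Rightarrow> h2 \<times> h2 \<Rightarrow> h2" where
  "det f g p = mul (fn f) (snd p) - mul (fn g) (fst p)"

lemma \<theta>H [simp]: "\<theta> \<in> Hinf" and \<phi>H [simp]: "\<phi> \<in> Hinf"
  using \<theta> \<phi> by auto

lemma subspace_G: "subspace G"
  using inv unfolding mul_inv_def by blast

lemma det_bounded:
  assumes "(f1, g1) \<in> G" "(f2, g2) \<in> G" "fn f1 \<in> Hinf" "fn g1 \<in> Hinf" "fn f2 \<in> Hinf" "fn g2 \<in> Hinf"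
  shows "det f2 g2 (f1, g1) \<in> range (mul \<phi>)"
proof -
  have "(mul (fn f2) f1, mul (fn f2) g1) - (mul (fn f1) f2, mul (fn f1) g2) \<in> G"
    using assms by (intro subspace_diff subspace_G mul_invD[OF inv])
  moreover have "mul (fn f2) f1 = mul (fn f1) f2" using assms by (intro mul_fn_commute)
  ultimately have "(mul \<theta> 0, mul (fn f2) g1 - mul (fn f1) g2) \<in> G" by simp
  then have "mul (fn f2) g1 - mul (fn f1) g2 \<in> range (mul \<phi>)" by (rule single)
  moreover have "mul (fn f1) g2 = mul (fn g2) f1" using assms by (intro mul_fn_commute)
  ultimately show ?thesis by (simp add: det_def)
qed

lemma det_closure:
  assumes b: "fn f2 \<in> Hinf" "fn g2 \<in> Hinf"
    and G: "\<And>f g. (f, g) \<in> G \<Longrightarrow> fn f \<in> Hinf \<Longrightarrow> fn g \<in> Hinf \<Longrightarrow> det f2 g2 (f, g) \<in> range (mul \<phi>)"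
    and p: "p \<in> closure G"
  shows "det f2 g2 p \<in> range (mul \<phi>)"
proof -
  have lim: "(\<lambda>n. det f2 g2 (x n)) \<longlonglongrightarrow> det f2 g2 q" if "x \<longlonglongrightarrow> q" for x q
    unfolding det_def using b that by (intro tendsto_intros)
  have 1: "det f2 g2 q \<in> range (mul \<phi>)" if qG: "q \<in> G" for q
  proof -
    obtain x where x: "\<And>n. x n \<in> G" "\<And>n. fn (fst (x n)) \<in> Hinf" "\<And>n. fn (snd (x n)) \<in> Hinf" "x \<longlonglongrightarrow> q"
      using approximate_bounded_pair[OF inv, of "fst q" "snd q"] qG by auto
    have "det f2 g2 (x n) \<in> range (mul \<phi>)" for n using G[of "fst (x n)" "snd (x n)"] x by simp
    then show ?thesis using closed_sequentially[OF closed_range_mul[OF \<phi>] _ lim[OF x(4)]] by blast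
  qed
  obtain x where x: "\<And>n. x n \<in> G" "x \<longlonglongrightarrow> p" using p unfolding closure_sequential by blast
  show ?thesis using closed_sequentially[OF closed_range_mul[OF \<phi>] _ lim[OF x(2)]] 1 x(1) by blast
qed

text \<open>The closure is reached in one argument at a time; antisymmetry of the determinant
  exchanges the two pairs in between.\<close>

lemma det_mem:
  assumes "(f2, g2) \<in> closure G" "fn f2 \<in> Hinf" "fn g2 \<in> Hinf" "p \<in> closure G"
  shows "det f2 g2 p \<in> range (mul \<phi>)"
proof (rule det_closure[OF assms(2,3) _ assms(4)])
  fix f g assume fg: "(f, g) \<in> G" "fn f \<in> Hinf" "fn g \<in> Hinf"
  have "det f g (f2, g2) \<in> range (mul \<phi>)"
    using fg det_bounded by (intro det_closure[OF fg(2,3) _ assms(1)]) blast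
  then have "- det f g (f2, g2) \<in> range (mul \<phi>)" by (intro subspace_neg subspace_range_mul) simp_all
  moreover have "- det f g (f2, g2) = det f2 g2 (f, g)"
    using fg assms by (simp add: det_def mul_fn_commute[of f2] mul_fn_commute[of g2])
  ultimately show "det f2 g2 (f, g) \<in> range (mul \<phi>)" by simp
qed

lemma mul_\<theta>_snd:
  assumes "(f, g) \<in> G" shows "mul \<theta> g \<in> range (mul \<phi>)"
  using mul_invD[OF inv \<theta>H assms] by (rule single)

text \<open>For a bounded pair \<open>(f, k)\<close> of \<open>G\<close> the determinant puts
  \<open>f\<close> times \<open>g\<close> minus \<open>k\<close> times \<theta> \<open>h\<close>
  into \<phi> H^2. Since \<phi> divides \<theta> \<open>k\<close>, the product of \<open>f\<close>
  and \<open>g\<close> alone lies there, and such \<open>f\<close> approximate \<open>one\<close>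
  because the domain is dense.\<close>

lemma closure_single:
  assumes "(mul \<theta> h, g) \<in> closure G" shows "g \<in> range (mul \<phi>)"
proof -
  define F where "F = {f. fn f \<in> Hinf \<and> (\<exists>g. fn g \<in> Hinf \<and> (f, g) \<in> G)}"
  have mem: "mul (fn f) g \<in> range (mul \<phi>)" if "f \<in> F" for f
  proof -
    obtain k where k: "fn f \<in> Hinf" "fn k \<in> Hinf" "(f, k) \<in> G" using \<open>f \<in> F\<close> unfolding F_def by blast
    then have "(f, k) \<in> closure G" using closure_subset by blast
    then have d: "det f k (mul \<theta> h, g) \<in> range (mul \<phi>)" using k assms by (intro det_mem)
    obtain m where m: "mul \<theta> k = mul \<phi> m" using mul_\<theta>_snd[OF k(3)] by blast
    have e: "\<phi> z * fn m z = \<theta> z * fn k z" for z using arg_cong[OF m, of "\<lambda>x. fn x z"] by simp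
    have mH: "fn m \<in> Hinf" by (rule isom_mult_division[OF \<phi> _ e]) (use k in simp)
    have "mul (fn k) (mul \<theta> h) = mul \<phi> (mul (fn m) h)"
    proof (rule fn_eqI)
      fix z :: complex assume "norm z < 1"
      have "fn (mul (fn k) (mul \<theta> h)) z = (\<theta> z * fn k z) * fn h z" using k by simp
      then show "fn (mul (fn k) (mul \<theta> h)) z = fn (mul \<phi> (mul (fn m) h)) z"
        unfolding e[symmetric] using mH by simp
    qed
    then have "mul (fn k) (mul \<theta> h) \<in> range (mul \<phi>)" by blast
    then have "det f k (mul \<theta> h, g) + mul (fn k) (mul \<theta> h) \<in> range (mul \<phi>)"
      using d by (intro subspace_add subspace_range_mul) simp_all
    then show ?thesis by (simp add: det_def)
  qed
  have "fst ` G \<subseteq> closure F"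
  proof clarify
    fix f g assume "(f, g) \<in> G"
    then obtain x where x: "\<And>n. x n \<in> G" "\<And>n. fn (fst (x n)) \<in> Hinf" "\<And>n. fn (snd (x n)) \<in> Hinf" "x \<longlonglongrightarrow> (f, g)"
      using approximate_bounded_pair[OF inv] by metis
    then have "fst (x n) \<in> F" for n unfolding F_def by (metis (mono_tags, lifting) mem_Collect_eq prod.collapse)
    moreover have "(\<lambda>n. fst (x n)) \<longlonglongrightarrow> f" using tendsto_fst[OF x(4)] by simp
    ultimately have "f \<in> closure F" by (rule closureI_sequentially)
    then show "fst (f, g) \<in> closure F" by simp
  qed
  then have "closure (fst ` G) \<subseteq> closure F" by (rule closure_minimal) simp
  then have one: "one \<in> closure F" using dense by blast
  \<comment> \<open>Cancellation is available for relations, so the subspace \<phi> H^2 is disguised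
    as one whose first coordinate is free.\<close>
  define R where "R = (UNIV :: h2 set) \<times> range (mul \<phi>)"
  have invR: "mul_inv R"
    unfolding mul_inv_def R_def using hinf_sub_range[OF \<phi>H]
    by (auto simp: hinf_sub_def intro!: subspace_Times)
  have clR: "closed R" unfolding R_def by (intro closed_Times closed_range_mul \<phi>) simp
  have "(0, g) \<in> R"
  proof (rule cancel_approximate_unit[OF clR invR one])
    show "(mul (fn w) 0, mul (fn w) g) \<in> R" if "w \<in> F" for w using mem[OF that] by (simp add: R_def)
    show "fn w \<in> Hinf" if "w \<in> F" for w using that by (simp add: F_def)
  qed
  then show ?thesis by (simp add: R_def)
qed

text \<open>Regularizing a cyclic pair keeps it cyclic: every \<open>mul (k m) v0\<close> is a
  bounded multiple of \<open>v\<close>, and these tend back to \<open>v0\<close>.\<close>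

lemma cyclic_bounded_pair:
  assumes \<psi>: "isom_mult \<psi>"
  obtains v u where "(v, u) \<in> closure G" "fn v \<in> Hinf" "fn u \<in> Hinf" "one \<in> closure (ideal v \<psi>)"
proof -
  have invc: "mul_inv (closure G)" by (rule mul_inv_closure[OF inv])
  have "closure (fst ` closure G) = UNIV"
    using dense closure_mono[OF image_mono[OF closure_subset], of fst G] by blast
  then obtain v0 u0 where vu: "(v0, u0) \<in> closure G" "one \<in> closure (ideal v0 \<psi>)"
    using cyclic_vector_exists[of "closure G" \<psi>] \<psi> invc unfolding mul_inv_def by auto
  obtain k where k: "\<And>n. k n \<in> Hinf" "\<And>n z. norm z < 1 \<Longrightarrow> norm (k n z) \<le> 1"
    "\<And>z. norm z < 1 \<Longrightarrow> (\<lambda>n. k n z) \<longlonglongrightarrow> 1"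
    "\<And>n. fn (mul (k n) v0) \<in> Hinf" "\<And>n. fn (mul (k n) u0) \<in> Hinf"
    "\<And>n m. \<exists>q\<in>Hinf. \<forall>z\<in>ball 0 1. k m z = k n z * q z" by (rule bounded_regularizer[of v0 u0]) (rule that)
  define v where "v = mul (k 0) v0"
  have "mul (k m) v0 \<in> ideal v \<psi>" for m
  proof -
    obtain q where q: "q \<in> Hinf" "\<forall>z\<in>ball 0 1. k m z = k 0 z * q z" using k(6) by blast
    have "mul (k m) v0 = mul q v"
      unfolding v_def by (rule fn_eqI) (use k(1) q in simp)
    then show ?thesis
      using hinf_sub_ideal generator_mem_ideal \<psi> q(1) unfolding hinf_sub_def by (metis isom_mult_Hinf)
  qed
  moreover have "(\<lambda>m. mul (k m) v0) \<longlonglongrightarrow> v0" using k by (intro mul_tendsto_self)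
  ultimately have "v0 \<in> closure (ideal v \<psi>)" by (rule closureI_sequentially)
  moreover have "range (mul \<psi>) \<subseteq> closure (ideal v \<psi>)" using multiple_mem_ideal closure_subset by blast
  ultimately have "ideal v0 \<psi> \<subseteq> closure (ideal v \<psi>)"
    using \<psi> by (intro ideal_subset hinf_sub_closure hinf_sub_ideal) auto
  then have "one \<in> closure (ideal v \<psi>)" using vu(2) closure_minimal[of "ideal v0 \<psi>" "closure (ideal v \<psi>)"] by auto
  moreover have "(v, mul (k 0) u0) \<in> closure G" unfolding v_def by (intro mul_invD[OF invc] k vu)
  ultimately show ?thesis using that k v_def by blast
qed

theorem closure_representation:
  assumes \<psi>: "isom_mult \<psi>" and \<psi>\<theta>: "mul \<psi> one \<in> range (mul \<theta>)" and \<psi>\<phi>: "mul \<psi> one \<in> range (mul \<phi>)"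
  obtains v u where "v \<in> Hinf" "u \<in> Hinf" "one \<in> closure (ideal (mul v one) \<psi>)"
    "mul \<theta> (mul u one) \<in> range (mul \<phi>)"
    "closure G = {(f, g). mul v g - mul u f \<in> range (mul \<phi>)}"
proof -
  obtain V U where VU: "(V, U) \<in> closure G" "fn V \<in> Hinf" "fn U \<in> Hinf" "one \<in> closure (ideal V \<psi>)"
    using cyclic_bounded_pair[OF \<psi>] by blast
  have invc: "mul_inv (closure G)" by (rule mul_inv_closure[OF inv])
  have subc: "subspace (closure G)" using invc by (simp add: mul_inv_def)
  have \<psi>H: "\<psi> \<in> Hinf" using \<psi> by simp
  have rng: "range (mul \<psi>) \<subseteq> range (mul w)" if w: "isom_mult w" "mul \<psi> one \<in> range (mul w)" for w
  proof -
    obtain q where q: "q \<in> Hinf" "\<And>z. norm z < 1 \<Longrightarrow> \<psi> z = w z * q z"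
      using range_mul_hinf_dvd[OF w \<psi>H] unfolding hinf_dvd_def by auto
    have "mul \<psi> x = mul w (mul q x)" for x by (rule fn_eqI) (use q w \<psi>H in simp)
    then show ?thesis by auto
  qed
  have \<psi>G: "(mul \<psi> f, mul \<psi> g) \<in> closure G" for f g
  proof -
    obtain h k where "mul \<psi> f = mul \<theta> h" "mul \<psi> g = mul \<phi> k"
      using rng[OF \<theta> \<psi>\<theta>] rng[OF \<phi> \<psi>\<phi>] by blast
    then show ?thesis using kernel[of h k] closure_subset by auto
  qed
  have "mul \<theta> U \<in> range (mul \<phi>)"
    using closure_single[OF mul_invD[OF invc \<theta>H VU(1)]] .
  moreover have "mul (fn V) g - mul (fn U) f \<in> range (mul \<phi>)" if "(f, g) \<in> closure G" for f g
    using det_mem[OF VU(1-3) that] by (simp add: det_def)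
  moreover have "(f, g) \<in> closure G" if r: "mul (fn V) g - mul (fn U) f \<in> range (mul \<phi>)" for f g
  proof -
    \<comment> \<open>The ideal of \<open>V\<close>, with polynomials in place of arbitrary
      coefficients of \<psi>: its elements are bounded, as cancellation requires, and remain dense
      in the ideal.\<close>
    define F where "F = {mul a V + mul \<psi> (hpoly p) |a p. a \<in> Hinf}"
    have FH: "fn w \<in> Hinf" and FG: "(mul (fn w) f, mul (fn w) g) \<in> closure G" if wF: "w \<in> F" for w
    proof -
      obtain a p where w: "w = mul a V + mul \<psi> (hpoly p)" "a \<in> Hinf" using wF unfolding F_def by blast
      have fw: "fn w z = a z * fn V z + \<psi> z * fn (hpoly p) z" for z using w \<psi>H by simp
      have fwH: "(\<lambda>z. a z * fn V z + \<psi> z * fn (hpoly p) z) \<in> Hinf"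
        using w \<psi>H VU fn_hpoly_Hinf by (intro Hinf_add Hinf_mult)
      show wH: "fn w \<in> Hinf" using Hinf_cong[OF fwH] fw by metis
      obtain k where k: "mul (fn V) g - mul (fn U) f = mul \<phi> k" using r by blast
      have "(mul (fn V) f, mul (fn U) f) \<in> closure G"
      proof -
        \<comment> \<open>The vector \<open>f\<close> may be unbounded and cannot act as a
          multiplier on the pair \<open>(V, U)\<close>. Polynomials can, and the closed relation
          admits their limit.\<close>
        obtain q where q: "(\<lambda>n. hpoly (q n)) \<longlonglongrightarrow> f" using hpoly_dense by blast
        show ?thesis
        proof (rule closed_sequentially[of "closure G"])
          show "(mul (fn V) (hpoly (q n)), mul (fn U) (hpoly (q n))) \<in> closure G" for n
            unfolding mul_hpoly_commute[OF VU(2)] mul_hpoly_commute[OF VU(3)]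
            by (intro mul_invD[OF invc] VU Hinf_poly)
          show "(\<lambda>n. (mul (fn V) (hpoly (q n)), mul (fn U) (hpoly (q n)))) \<longlonglongrightarrow> (mul (fn V) f, mul (fn U) f)"
            by (intro tendsto_Pair tendsto_mul VU q)
        qed simp
      qed
      moreover have "(0, mul \<phi> k) \<in> closure G" using kernel[of 0 k] closure_subset by auto
      ultimately have "(mul (fn V) f, mul (fn U) f) + (0, mul \<phi> k) \<in> closure G" by (rule subspace_add[OF subc])
      then have "(mul (fn V) f, mul (fn V) g) \<in> closure G" using k by (simp add: algebra_simps)
      then have "(mul a (mul (fn V) f), mul a (mul (fn V) g)) \<in> closure G" by (rule mul_invD[OF invc w(2)])
      from subspace_add[OF subc this \<psi>G[of "mul (poly p) f" "mul (poly p) g"]]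
      have "(mul a (mul (fn V) f), mul a (mul (fn V) g)) + (mul \<psi> (mul (poly p) f), mul \<psi> (mul (poly p) g)) \<in> closure G" .
      moreover have "mul (fn w) x = mul a (mul (fn V) x) + mul \<psi> (mul (poly p) x)" for x
        by (rule fn_eqI) (use w \<psi>H VU wH in \<open>simp add: fn_hpoly algebra_simps\<close>)
      ultimately show "(mul (fn w) f, mul (fn w) g) \<in> closure G" by simp
    qed
    have "ideal V \<psi> \<subseteq> closure F"
    proof
      fix x assume "x \<in> ideal V \<psi>"
      then obtain a b where x: "x = mul a V + mul \<psi> b" "a \<in> Hinf" unfolding ideal_def by blast
      obtain q where q: "(\<lambda>n. hpoly (q n)) \<longlonglongrightarrow> b" using hpoly_dense by blast
      have "(\<lambda>n. mul a V + mul \<psi> (hpoly (q n))) \<longlonglongrightarrow> x" unfolding x by (intro tendsto_intros \<psi>H q)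
      moreover have "mul a V + mul \<psi> (hpoly (q n)) \<in> F" for n using x unfolding F_def by blast
      ultimately show "x \<in> closure F" by (rule closureI_sequentially[rotated])
    qed
    then have "one \<in> closure F" using VU(4) closure_minimal[of "ideal V \<psi>" "closure F"] by auto
    from cancel_approximate_unit[OF closed_closure invc this FH FG] show ?thesis .
  qed
  ultimately have "closure G = {(f, g). mul (fn V) g - mul (fn U) f \<in> range (mul \<phi>)}"
    by blast
  then show ?thesis using that[of "fn V" "fn U"] VU \<open>mul \<theta> U \<in> range (mul \<phi>)\<close> by simp
qed

end

section \<open>Inner functions and differentiation of integrals\<close>

lemma AE_lborel_imp_negligible:
  assumes "AE t in lborel. P t" shows "negligible {t. \<not> P t}"
proof -
  have "AE t in lebesgue. P t" by (rule AE_completion[OF assms])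
  then obtain N where "negligible N" "{t. \<not> P t} \<subseteq> N" unfolding eventually_ae_filter_negligible by blast
  then show ?thesis by (rule negligible_subset)
qed

section \<open>Radii increasing to one and dilations\<close>

definition radius :: "nat \<Rightarrow> real" where "radius k = 1 - 1 / real (k + 2)"

lemma radius: "0 < radius k" "radius k < 1"
  by (auto simp: radius_def)

lemma radius_mono: "i \<le> j \<Longrightarrow> radius i \<le> radius j"
  by (simp add: radius_def frac_le)

lemma radius_tendsto: "radius \<longlonglongrightarrow> 1"
proof -
  have "(\<lambda>k. 1 - 1 / real (k + 2)) \<longlonglongrightarrow> 1 - 0"
    by (intro tendsto_diff tendsto_const LIMSEQ_ignore_initial_segment[OF lim_inverse_n'])
  then show ?thesis by (simp add: radius_def[abs_def])
qed

lemma radius_at_left: "filterlim radius (at_left 1) sequentially"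
  by (rule tendsto_imp_filterlim_at_left[OF radius_tendsto]) (simp add: radius)

definition dilate :: "real \<Rightarrow> h2 \<Rightarrow> h2" where
  "dilate r a = h2_of (\<lambda>n. of_real r ^ n * hcoeff a n)"

lemma hcoeff_dilate:
  assumes "0 \<le> r" "r \<le> 1" shows "hcoeff (dilate r a) n = of_real r ^ n * hcoeff a n"
proof -
  have "summable (\<lambda>n. (norm (of_real r ^ n * hcoeff a n))\<^sup>2)"
  proof (rule summable_comparison_test'[OF summable_hcoeff[of a], of 0])
    fix n
    have "norm (of_real r ^ n * hcoeff a n) \<le> norm (hcoeff a n)"
      using assms by (simp add: norm_mult norm_power mult_left_le_one_le power_le_one)
    then show "norm ((norm (of_real r ^ n * hcoeff a n))\<^sup>2) \<le> (norm (hcoeff a n))\<^sup>2" by (simp add: power_mono)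
  qed
  then show ?thesis by (simp add: dilate_def h2_of_inverse)
qed

lemma fn_dilate:
  assumes "0 \<le> r" "r \<le> 1" "norm z < 1" shows "fn (dilate r a) z = fn a (of_real r * z)"
proof -
  have "norm (of_real r * z) \<le> norm z" using assms by (simp add: norm_mult mult_left_le_one_le)
  then have "(\<lambda>n. hcoeff a n * (of_real r * z) ^ n) sums fn a (of_real r * z)" using assms by (intro fn_sums) simp
  moreover have "(\<lambda>n. hcoeff a n * (of_real r * z) ^ n) sums fn (dilate r a) z"
    using fn_sums[OF assms(3), of "dilate r a"] hcoeff_dilate[OF assms(1,2)] by (simp add: power_mult_distrib mult_ac)
  ultimately show ?thesis using sums_unique2 by blast
qed

lemma norm_dilate_le:
  assumes "0 \<le> r" "r \<le> 1" shows "norm (dilate r a) \<le> norm a"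
proof (rule power2_le_imp_le)
  show "(norm (dilate r a))\<^sup>2 \<le> (norm a)\<^sup>2"
    unfolding norm_h2_sq
  proof (intro suminf_le summable_hcoeff power_mono)
    show "norm (hcoeff (dilate r a) n) \<le> norm (hcoeff a n)" for n
      using assms by (simp add: hcoeff_dilate norm_mult norm_power mult_left_le_one_le power_le_one)
  qed simp
qed simp

lemma dilate_tendsto: "(\<lambda>k. dilate (radius k) a) \<longlonglongrightarrow> a"
proof (rule tendsto_of_pointwise)
  show "norm (dilate (radius k) a) \<le> norm a" for k using radius[of k] by (intro norm_dilate_le) auto
  fix z :: complex assume z: "norm z < 1"
  have "isCont (fn a) z"
    using z fn_holomorphic[of a] holomorphic_on_imp_continuous_on continuous_on_eq_continuous_at[of "ball 0 1" "fn a"] by auto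
  moreover have "(\<lambda>k. of_real (radius k) * z) \<longlonglongrightarrow> of_real 1 * z" by (intro tendsto_intros radius_tendsto)
  ultimately have "(\<lambda>k. fn a (of_real (radius k) * z)) \<longlonglongrightarrow> fn a z" using isCont_tendsto_compose by simp
  then show "(\<lambda>k. fn (dilate (radius k) a) z) \<longlonglongrightarrow> fn a z"
    using radius z by (simp add: fn_dilate less_imp_le)
qed

lemma circle_norm_fn:
  assumes "0 \<le> r" "r < 1"
  shows "integral {0..2*pi} (\<lambda>t. (norm (fn a (of_real r * cis t)))\<^sup>2) = 2 * pi * (norm (dilate r a))\<^sup>2"
proof -
  have "(norm (dilate r a))\<^sup>2 = (\<Sum>n. (norm (h2_coeff (fn a) n))\<^sup>2 * r ^ (2 * n))"
    unfolding norm_h2_sq using assms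
    by (simp add: hcoeff_dilate h2_coeff_fn norm_mult norm_power power_mult_distrib mult.commute flip: power_mult)
  also have "\<dots> = integral {0..2*pi} (\<lambda>t. (norm (fn a (of_real r * cis t)))\<^sup>2) / (2 * pi)"
    using circle_parseval(2)[OF fn_holomorphic assms, of a] by (simp add: sums_iff)
  finally show ?thesis by simp
qed

lemma circle_integrable_fn:
  "0 \<le> r \<Longrightarrow> r < 1 \<Longrightarrow> (\<lambda>t. (norm (fn a (of_real r * cis t)))\<^sup>2) integrable_on {0..2*pi}"
  by (rule circle_parseval(1)[OF fn_holomorphic])

lemma circle_norm_tendsto:
  "(\<lambda>k. integral {0..2*pi} (\<lambda>t. (norm (fn a (of_real (radius k) * cis t)))\<^sup>2)) \<longlonglongrightarrow> 2 * pi * (norm a)\<^sup>2"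
proof -
  have "(\<lambda>k. 2 * pi * (norm (dilate (radius k) a))\<^sup>2) \<longlonglongrightarrow> 2 * pi * (norm a)\<^sup>2"
    by (intro tendsto_intros dilate_tendsto)
  then show ?thesis using radius by (simp add: circle_norm_fn less_imp_le)
qed

text \<open>On polynomials the difference of the two mean squares tends to 0 by bounded convergence,
  because the radial limits of \<theta> are unimodular almost everywhere. Polynomials are bounded on
  the disc, which supplies the dominating constant; density does the rest.\<close>

lemma inner_fn_isom_mult:
  assumes "inner_fn \<theta>" shows "isom_mult \<theta>"
proof -
  have \<theta>: "\<theta> \<in> Hinf" using assms by (simp add: inner_fn_def)
  define P where "P t \<longleftrightarrow> (\<exists>\<zeta>. ((\<lambda>r::real. \<theta> (of_real r * cis t)) \<longlongrightarrow> \<zeta>) (at_left 1) \<and> norm \<zeta> = 1)" for t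
  have AEP: "AE t in lborel. t \<in> {0..2*pi} \<longrightarrow> P t" using assms by (simp add: inner_fn_def P_def)
  define S where "S = {t \<in> {0..2*pi}. P t}"
  have neg: "negligible ({0..2*pi} - S)"
    by (rule negligible_subset[OF AE_lborel_imp_negligible[OF AEP]]) (auto simp: S_def)
  have SS: "S \<subseteq> {0..2*pi}" by (auto simp: S_def)
  have poly: "norm (mul \<theta> (hpoly p)) = norm (hpoly p)" for p
  proof -
    define a where "a = hpoly p"
    define f where "f k t = (norm (fn (mul \<theta> a) (of_real (radius k) * cis t)))\<^sup>2 - (norm (fn a (of_real (radius k) * cis t)))\<^sup>2" for k t
    have rn: "norm (of_real (radius k) * cis t) < 1" for k t using radius[of k] by (simp add: norm_mult)
    have f_eq: "f k t = ((norm (\<theta> (of_real (radius k) * cis t)))\<^sup>2 - 1) * (norm (poly p (of_real (radius k) * cis t)))\<^sup>2" for k t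
      using \<theta> rn by (simp add: f_def a_def fn_hpoly norm_mult power_mult_distrib algebra_simps)
    obtain B where B: "B > 0" "\<And>z. norm z < 1 \<Longrightarrow> norm (\<theta> z) \<le> B" using Hinf_bound[OF \<theta>] by blast
    obtain C where C: "C > 0" "\<And>z. norm z < 1 \<Longrightarrow> norm (poly p z) \<le> C" using Hinf_bound[OF Hinf_poly] by blast
    have fint: "f k integrable_on {0..2*pi}" for k
      unfolding f_def using radius[of k] by (intro integrable_diff circle_integrable_fn) auto
    have "(\<lambda>k. integral S (f k)) \<longlonglongrightarrow> integral S (\<lambda>_. 0)"
    proof (rule dominated_convergence(2))
      show "f k integrable_on S" for k
        using fint[of k] neg SS by (subst integrable_spike_set_eq[of S "{0..2*pi}"]) (auto simp: Un_absorb1 Diff_eq_empty_iff[THEN iffD2])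
      show "(\<lambda>_. (B\<^sup>2 + 1) * C\<^sup>2) integrable_on S"
        using neg SS by (subst integrable_spike_set_eq[of S "{0..2*pi}"]) (auto simp: Un_absorb1 Diff_eq_empty_iff[THEN iffD2])
      show "norm (f k t) \<le> (B\<^sup>2 + 1) * C\<^sup>2" for k t
      proof -
        have "\<bar>(norm (\<theta> (of_real (radius k) * cis t)))\<^sup>2 - 1\<bar> \<le> B\<^sup>2 + 1"
          using power_mono[OF B(2)[OF rn[of k t]] norm_ge_zero, of 2] zero_le_power2[of "norm (\<theta> (of_real (radius k) * cis t))"]
          unfolding abs_le_iff by linarith
        moreover have "(norm (poly p (of_real (radius k) * cis t)))\<^sup>2 \<le> C\<^sup>2" using C(2)[OF rn[of k t]] by (simp add: power_mono)
        ultimately show ?thesis unfolding f_eq real_norm_def abs_mult by (intro mult_mono) auto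
      qed
      fix t assume "t \<in> S"
      then obtain \<zeta> where \<zeta>: "((\<lambda>r::real. \<theta> (of_real r * cis t)) \<longlongrightarrow> \<zeta>) (at_left 1)" "norm \<zeta> = 1"
        by (auto simp: S_def P_def)
      have "(\<lambda>k. \<theta> (of_real (radius k) * cis t)) \<longlonglongrightarrow> \<zeta>" using filterlim_compose[OF \<zeta>(1) radius_at_left] .
      have "(\<lambda>k. ((norm (\<theta> (of_real (radius k) * cis t)))\<^sup>2 - 1) * (norm (poly p (of_real (radius k) * cis t)))\<^sup>2)
         \<longlonglongrightarrow> ((norm \<zeta>)\<^sup>2 - 1) * (norm (poly p (of_real 1 * cis t)))\<^sup>2"
        by (intro tendsto_intros \<open>(\<lambda>k. \<theta> (of_real (radius k) * cis t)) \<longlonglongrightarrow> \<zeta>\<close> radius_tendsto)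
      then show "(\<lambda>k. f k t) \<longlonglongrightarrow> 0" unfolding f_eq using \<zeta>(2) by simp
    qed
    moreover have "integral S (f k) = integral {0..2*pi} (f k)" for k
      by (rule integral_subset_negligible[OF SS neg])
    ultimately have "(\<lambda>k. integral {0..2*pi} (f k)) \<longlonglongrightarrow> 0" by simp
    moreover have "integral {0..2*pi} (f k) = integral {0..2*pi} (\<lambda>t. (norm (fn (mul \<theta> a) (of_real (radius k) * cis t)))\<^sup>2)
        - integral {0..2*pi} (\<lambda>t. (norm (fn a (of_real (radius k) * cis t)))\<^sup>2)" for k
      unfolding f_def using radius[of k] by (intro integral_diff circle_integrable_fn) auto
    then have "(\<lambda>k. integral {0..2*pi} (f k)) \<longlonglongrightarrow> 2 * pi * (norm (mul \<theta> a))\<^sup>2 - 2 * pi * (norm a)\<^sup>2"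
      by (simp only:) (intro tendsto_diff circle_norm_tendsto)
    ultimately have "2 * pi * (norm (mul \<theta> a))\<^sup>2 - 2 * pi * (norm a)\<^sup>2 = 0" using LIMSEQ_unique by blast
    then have "(norm (mul \<theta> a))\<^sup>2 = (norm a)\<^sup>2" by (simp flip: right_diff_distrib)
    then show ?thesis unfolding a_def by (rule power2_eq_imp_eq) simp_all
  qed
  show ?thesis
    unfolding isom_mult_def
  proof (intro conjI allI \<theta>)
    fix x
    obtain q where q: "(\<lambda>n. hpoly (q n)) \<longlonglongrightarrow> x" using hpoly_dense by blast
    have "(\<lambda>n. norm (mul \<theta> (hpoly (q n)))) \<longlonglongrightarrow> norm (mul \<theta> x)" by (intro tendsto_intros \<theta> q)
    moreover have "(\<lambda>n. norm (mul \<theta> (hpoly (q n)))) \<longlonglongrightarrow> norm x" unfolding poly by (intro tendsto_intros q)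
    ultimately show "norm (mul \<theta> x) = norm x" by (rule LIMSEQ_unique)
  qed
qed

text \<open>Where \<open>g\<close> lies below \<open>p\<close> although arbitrarily short intervals
  have mean above \<open>q\<close>, Vitali's theorem selects disjoint such intervals. On their union
  \<open>g - q\<close> has nonnegative integral, yet off a small set it is below
  \<open>p - q\<close>; so the union is small.\<close>

lemma upper_derivate_negligible:
  fixes g :: "real \<Rightarrow> real"
  assumes g: "g \<in> borel_measurable borel" and bd: "\<And>x. \<bar>g x\<bar> \<le> B" and pq: "p < q"
  shows "negligible {t \<in> {a<..<b}. g t < p \<and>
           (\<forall>d>0. \<exists>x y. x < y \<and> x \<le> t \<and> t \<le> y \<and> y - x < d \<and> q * (y - x) < integral {x..y} g)}" (is "negligible ?S")
  unfolding negligible_outer_le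
proof (intro allI impI)
  fix e :: real assume e: "e > 0"
  have B0: "0 \<le> B" using bd[of 0] by linarith
  have gint: "g integrable_on T" if "T \<in> lmeasurable" for T
  proof (rule measurable_bounded_by_integrable_imp_integrable)
    show "g \<in> borel_measurable (lebesgue_on T)"
      using g by (intro measurable_restrict_space1 measurable_completion) simp
    show "(\<lambda>_. B) integrable_on T" using that integrable_on_const by blast
  qed (use bd that in auto)
  define A where "A = {t \<in> {a<..<b}. g t < p}"
  have Ameas: "A \<in> sets lebesgue"
  proof -
    have "A = {a<..<b} \<inter> (g -` {..<p} \<inter> space borel)" by (auto simp: A_def)
    then have "A \<in> sets borel" using measurable_sets[OF g, of "{..<p}"] by auto
    then show ?thesis by auto
  qed
  \<comment> \<open>The final comparison reads \<open>(q - p)\<close> times the covered measure at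
    most \<open>(B + \<bar>p\<bar> + 1) * \<delta>\<close>, which this choice makes equal to
    \<open>(q - p) * e\<close>.\<close>
  define \<delta> where "\<delta> = e * (q - p) / (B + \<bar>p\<bar> + 1)"
  have \<delta>: "\<delta> > 0" unfolding \<delta>_def using e pq B0 by (intro divide_pos_pos mult_pos_pos) auto
  obtain O' where O': "open O'" "A \<subseteq> O'" "O' - A \<in> lmeasurable" "emeasure lebesgue (O' - A) < ennreal \<delta>"
    using sets_lebesgue_outer_open[OF Ameas \<delta>] by blast
  define D where "D = O' - A"
  have D: "D \<in> lmeasurable" "measure lebesgue D \<le> \<delta>"
    using O' \<delta> unfolding D_def by (auto simp: emeasure_eq_measure2 ennreal_less_iff intro: less_imp_le)
  define U where "U = O' \<inter> {a<..<b}"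
  have U: "open U" "A \<subseteq> U" "U - A \<subseteq> D" using O' by (auto simp: U_def A_def D_def)
  define K where "K = {(x, y). x < y \<and> {x..y} \<subseteq> U \<and> q * (y - x) < integral {x..y} g}"
  define c where "c i = (fst i + snd i) / 2" for i :: "real \<times> real"
  define r where "r i = (snd i - fst i) / 2" for i :: "real \<times> real"
  have cb: "cball (c i) (r i) = {fst i..snd i}" for i
  proof -
    have "c i - r i = fst i" "c i + r i = snd i" unfolding c_def r_def by (simp_all add: field_simps)
    then show ?thesis by (simp add: cball_eq_atLeastAtMost)
  qed
  obtain C where C: "countable C" "C \<subseteq> K"
    "pairwise (\<lambda>i j. disjnt (cball (c i) (r i)) (cball (c j) (r j))) C"
    "negligible (?S - (\<Union>i\<in>C. cball (c i) (r i)))"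
  proof (rule Vitali_covering_theorem_cballs[of K r ?S c])
    show "0 < r i" if "i \<in> K" for i using that by (auto simp: K_def r_def)
    fix t d :: real assume t: "t \<in> ?S" and d: "0 < d"
    then have "t \<in> U" using U by (auto simp: A_def)
    then obtain \<epsilon> where \<epsilon>: "\<epsilon> > 0" "ball t \<epsilon> \<subseteq> U" using U open_contains_ball by blast
    have "min \<epsilon> d > 0" using \<epsilon> d by simp
    then obtain x y where xy: "x < y" "x \<le> t" "t \<le> y" "y - x < min \<epsilon> d" "q * (y - x) < integral {x..y} g"
      using t by blast
    have "{x..y} \<subseteq> ball t \<epsilon>" using xy by (auto simp: dist_real_def)
    then have "(x, y) \<in> K" using xy \<epsilon> by (auto simp: K_def)
    moreover have "t \<in> cball (c (x, y)) (r (x, y))" using xy by (simp add: cb)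
    moreover have "r (x, y) < d" using xy by (simp add: r_def)
    ultimately show "\<exists>i. i \<in> K \<and> t \<in> cball (c i) (r i) \<and> r i < d" by blast
  qed blast
  have fin: "measure lebesgue (\<Union>i\<in>E. cball (c i) (r i)) \<le> e" if E: "E \<subseteq> C" "finite E" for E
  proof -
    define V where "V = (\<Union>i\<in>E. cball (c i) (r i))"
    have V: "V \<in> lmeasurable" unfolding V_def using E by (intro fmeasurable.finite_UN) auto
    have "{fst i..snd i} \<subseteq> U" if "i \<in> K" for i using that unfolding K_def by (simp add: case_prod_beta)
    then have VU: "V \<subseteq> U" unfolding V_def cb using E(1) C(2) by blast
    define I where "I i = integral {fst i..snd i} g - q * (snd i - fst i)" for i
    have "((\<lambda>t. g t - q) has_integral sum I E) V"
      unfolding V_def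
    proof (rule has_integral_UN)
      show "finite E" by (rule E)
      fix i assume i: "i \<in> E"
      then have "fst i \<le> snd i" using E C unfolding K_def by force
      then have "((\<lambda>_. q) has_integral q * (snd i - fst i)) {fst i..snd i}"
        using has_integral_const_real[of q "fst i" "snd i"] by (simp add: mult.commute)
      then show "((\<lambda>t. g t - q) has_integral I i) (cball (c i) (r i))"
        unfolding cb I_def by (intro has_integral_diff integrable_integral gint) auto
    next
      show "pairwise (\<lambda>i i'. negligible (cball (c i) (r i) \<inter> cball (c i') (r i'))) E"
        using C(3) E(1) unfolding pairwise_def disjnt_def by (metis negligible_empty subsetD)
    qed
    then have 1: "integral V (\<lambda>t. g t - q) = sum I E" "(\<lambda>t. g t - q) integrable_on V" by (auto simp: has_integral_iff)
    have "0 \<le> sum I E"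
    proof (rule sum_nonneg)
      fix i assume "i \<in> E"
      then have "i \<in> K" using E C by blast
      then show "0 \<le> I i" by (auto simp: K_def I_def)
    qed
    \<comment> \<open>Points of \<open>V\<close> outside \<open>D\<close> satisfy
      \<open>g t < p\<close>; on the excess \<open>D\<close> the crude bound
      \<open>g t \<le> p + (B + \<bar>p\<bar>)\<close> is used.\<close>
    also have "\<dots> \<le> integral V (\<lambda>t. (p - q) + (B + \<bar>p\<bar>) * indicator D t)"
      unfolding 1(1)[symmetric]
    proof (rule integral_le)
      show "(\<lambda>t. (p - q) + (B + \<bar>p\<bar>) * indicator D t) integrable_on V"
      proof (intro integrable_add integrable_on_mult_right)
        show "(\<lambda>_. p - q) integrable_on V" using V integrable_on_const by blast
        show "(indicator D :: real \<Rightarrow> real) integrable_on V"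
          using D V by (metis fmeasurable.Int integrable_on_indicator)
      qed
      fix t assume "t \<in> V"
      then have "g t < p \<or> t \<in> D" using VU U by (auto simp: A_def)
      moreover have "g t \<le> p + (B + \<bar>p\<bar>)" using bd[of t] by linarith
      ultimately show "g t - q \<le> (p - q) + (B + \<bar>p\<bar>) * indicator D t"
        using B0 by (cases "t \<in> D") auto
    qed (rule 1)
    also have "\<dots> = (p - q) * measure lebesgue V + (B + \<bar>p\<bar>) * measure lebesgue (D \<inter> V)"
    proof -
      have "((\<lambda>_. 1) has_integral measure lebesgue V) V"
        using V lmeasure_integral[OF V] by (simp add: lmeasurable_iff_integrable_on has_integral_iff)
      from has_integral_mult_right[OF this, of "p - q"]
      have "((\<lambda>_. p - q) has_integral (p - q) * measure lebesgue V) V" by simp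
      moreover have "(indicator D has_integral measure lebesgue (D \<inter> V)) V"
        using D V by (simp add: has_integral_iff integrable_on_indicator integral_indicator fmeasurable.Int)
      then have "((\<lambda>t. (B + \<bar>p\<bar>) * indicator D t) has_integral (B + \<bar>p\<bar>) * measure lebesgue (D \<inter> V)) V"
        by (rule has_integral_mult_right)
      ultimately show ?thesis by (intro integral_unique has_integral_add)
    qed
    finally have "(q - p) * measure lebesgue V \<le> (B + \<bar>p\<bar>) * measure lebesgue (D \<inter> V)" by (simp add: algebra_simps)
    also have "\<dots> \<le> (B + \<bar>p\<bar> + 1) * \<delta>"
    proof (intro mult_mono)
      have "measure lebesgue (D \<inter> V) \<le> measure lebesgue D"
        using D V by (intro measure_mono_fmeasurable) auto
      then show "measure lebesgue (D \<inter> V) \<le> \<delta>" using D by linarith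
    qed (use B0 \<delta> in auto)
    also have "\<dots> = (q - p) * e"
    proof -
      have "B + \<bar>p\<bar> + 1 \<noteq> 0" using B0 by linarith
      then show ?thesis by (simp add: \<delta>_def)
    qed
    finally show ?thesis using pq by (simp add: V_def)
  qed
  define W where "W = (\<Union>i\<in>C. cball (c i) (r i))"
  have W: "W \<in> lmeasurable" "measure lebesgue W \<le> e"
    unfolding W_def
    by (rule fmeasurable_UN_bound[OF C(1) _ fin] measure_UN_bound[OF C(1) _ fin]; simp)+
  have nW: "negligible (?S - W)" using C(4) by (simp add: W_def)
  show "\<exists>T. ?S \<subseteq> T \<and> T \<in> lmeasurable \<and> measure lebesgue T \<le> e"
  proof (intro exI conjI)
    show "?S \<subseteq> W \<union> (?S - W)" by blast
    show "W \<union> (?S - W) \<in> lmeasurable"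
      by (rule fmeasurable.Un[OF W(1) negligible_imp_measurable[OF nW]])
    have "measure lebesgue (W \<union> (?S - W)) \<le> measure lebesgue W + measure lebesgue (?S - W)"
      by (rule measure_Un_le[OF fmeasurableD[OF W(1)] fmeasurableD[OF negligible_imp_measurable[OF nW]]])
    then show "measure lebesgue (W \<union> (?S - W)) \<le> e"
      using W(2) negligible_imp_measure0[OF nW] by linarith
  qed
qed

text \<open>A failure at \<open>t\<close> leaves room for two rationals between \<open>g t\<close>
  and \<open>g t + \<epsilon>\<close>, so countably many negligible sets cover all failures.
  Intervals need only contain \<open>t\<close>, which later allows \<open>t\<close> as an
  endpoint.\<close>

lemma upper_density_AE:
  fixes g :: "real \<Rightarrow> real"
  assumes g: "g \<in> borel_measurable borel" and bd: "\<And>x. \<bar>g x\<bar> \<le> B"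
  obtains N where "negligible N"
    "\<And>t \<epsilon>. t \<in> {a<..<b} - N \<Longrightarrow> 0 < \<epsilon> \<Longrightarrow> \<exists>d>0. \<forall>x y. x < y \<and> x \<le> t \<and> t \<le> y \<and> y - x < d \<longrightarrow>
        integral {x..y} g \<le> (g t + \<epsilon>) * (y - x)"
proof -
  define S where "S p q = {t \<in> {a<..<b}. g t < p \<and>
           (\<forall>d>0. \<exists>x y. x < y \<and> x \<le> t \<and> t \<le> y \<and> y - x < d \<and> q * (y - x) < integral {x..y} g)}" for p q
  have negS: "negligible (S p q)" if "p < q" for p q
    unfolding S_def by (rule upper_derivate_negligible[OF g bd that])
  define N where "N = \<Union> ((\<lambda>(p, q). S p q) ` {(p, q). p \<in> \<rat> \<and> q \<in> \<rat> \<and> p < q})"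
  have "negligible N"
    unfolding N_def
  proof (rule negligible_countable_Union)
    have "countable (\<rat> \<times> \<rat> :: (real \<times> real) set)" by (intro countable_SIGMA countable_rat)
    then have "countable {(p :: real, q). p \<in> \<rat> \<and> q \<in> \<rat> \<and> p < q}" by (rule countable_subset[rotated]) auto
    then show "countable ((\<lambda>(p, q). S p q) ` {(p, q). p \<in> \<rat> \<and> q \<in> \<rat> \<and> p < q})" by (rule countable_image)
  qed (use negS in auto)
  moreover have "\<exists>d>0. \<forall>x y. x < y \<and> x \<le> t \<and> t \<le> y \<and> y - x < d \<longrightarrow> integral {x..y} g \<le> (g t + \<epsilon>) * (y - x)"
    if t: "t \<in> {a<..<b} - N" and e: "0 < \<epsilon>" for t \<epsilon>
  proof -
    obtain p where p: "p \<in> \<rat>" "g t < p" "p < g t + \<epsilon>" using Rats_dense_in_real[of "g t" "g t + \<epsilon>"] e by auto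
    obtain q where q: "q \<in> \<rat>" "p < q" "q < g t + \<epsilon>" using Rats_dense_in_real[of p "g t + \<epsilon>"] p by auto
    have "t \<notin> S p q" using t p q unfolding N_def by auto
    then obtain d where d: "d > 0"
      "\<And>x y. x < y \<Longrightarrow> x \<le> t \<Longrightarrow> t \<le> y \<Longrightarrow> y - x < d \<Longrightarrow> integral {x..y} g \<le> q * (y - x)"
      using t p unfolding S_def by (force simp: not_less)
    have "integral {x..y} g \<le> (g t + \<epsilon>) * (y - x)" if "x < y" "x \<le> t" "t \<le> y" "y - x < d" for x y
      using d(2)[OF that] mult_right_mono[of q "g t + \<epsilon>" "y - x"] q that by linarith
    then show ?thesis using d(1) by blast
  qed
  ultimately show ?thesis using that by blast
qed

lemma density_AE:
  fixes g :: "real \<Rightarrow> real"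
  assumes g: "g \<in> borel_measurable borel" and bd: "\<And>x. \<bar>g x\<bar> \<le> B"
  obtains N where "negligible N"
    "\<And>t \<epsilon>. t \<in> {a<..<b} - N \<Longrightarrow> 0 < \<epsilon> \<Longrightarrow> \<exists>d>0. \<forall>x y. x < y \<and> x \<le> t \<and> t \<le> y \<and> y - x < d \<longrightarrow>
        \<bar>integral {x..y} g - g t * (y - x)\<bar> \<le> \<epsilon> * (y - x)"
proof -
  obtain N1 where N1: "negligible N1"
    "\<And>t \<epsilon>. t \<in> {a<..<b} - N1 \<Longrightarrow> 0 < \<epsilon> \<Longrightarrow> \<exists>d>0. \<forall>x y. x < y \<and> x \<le> t \<and> t \<le> y \<and> y - x < d \<longrightarrow>
        integral {x..y} g \<le> (g t + \<epsilon>) * (y - x)" using upper_density_AE[OF g bd] by blast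
  have g': "(\<lambda>x. - g x) \<in> borel_measurable borel" using g by simp
  obtain N2 where N2: "negligible N2"
    "\<And>t \<epsilon>. t \<in> {a<..<b} - N2 \<Longrightarrow> 0 < \<epsilon> \<Longrightarrow> \<exists>d>0. \<forall>x y. x < y \<and> x \<le> t \<and> t \<le> y \<and> y - x < d \<longrightarrow>
        integral {x..y} (\<lambda>x. - g x) \<le> (- g t + \<epsilon>) * (y - x)"
    using upper_density_AE[OF g', of B] bd by auto
  have "\<exists>d>0. \<forall>x y. x < y \<and> x \<le> t \<and> t \<le> y \<and> y - x < d \<longrightarrow>
        \<bar>integral {x..y} g - g t * (y - x)\<bar> \<le> \<epsilon> * (y - x)"
    if t: "t \<in> {a<..<b} - (N1 \<union> N2)" and e: "0 < \<epsilon>" for t \<epsilon>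
  proof -
    obtain d1 where d1: "d1 > 0" "\<forall>x y. x < y \<and> x \<le> t \<and> t \<le> y \<and> y - x < d1 \<longrightarrow>
        integral {x..y} g \<le> (g t + \<epsilon>) * (y - x)" using N1(2)[of t, OF _ e] t by auto
    obtain d2 where d2: "d2 > 0" "\<forall>x y. x < y \<and> x \<le> t \<and> t \<le> y \<and> y - x < d2 \<longrightarrow>
        integral {x..y} (\<lambda>x. - g x) \<le> (- g t + \<epsilon>) * (y - x)" using N2(2)[of t, OF _ e] t by auto
    have "\<bar>integral {x..y} g - g t * (y - x)\<bar> \<le> \<epsilon> * (y - x)"
      if "x < y \<and> x \<le> t \<and> t \<le> y \<and> y - x < min d1 d2" for x y
    proof -
      have "integral {x..y} g \<le> (g t + \<epsilon>) * (y - x)" "- integral {x..y} g \<le> (- g t + \<epsilon>) * (y - x)"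
        using d1(2) d2(2) that by (auto simp flip: integral_neg)
      then show ?thesis unfolding abs_le_iff distrib_right by simp
    qed
    then show ?thesis using d1 d2 by (intro exI[of _ "min d1 d2"]) auto
  qed
  then show ?thesis using that[of "N1 \<union> N2"] N1(1) N2(1) by auto
qed

section \<open>Radial limits\<close>

text \<open>The Poisson kernel is a squared Szego kernel. Splitting \<open>r\<close> into two
  factors \<open>sqrt r\<close>, one for the pole and one for the circle, keeps both inside the
  disc, where Parseval evaluates the integral.\<close>

lemma poisson_integral:
  assumes r: "0 < r" "r < 1"
  shows "((\<lambda>s. (1 - r\<^sup>2) / (norm (cis s - of_real r * cis t))\<^sup>2) has_integral 2 * pi) {0..2*pi}"
proof -
  define w where "w = of_real (sqrt r) * cis t"
  have nw: "norm w < 1" using r by (simp add: w_def norm_mult)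
  have pt: "norm (of_real (sqrt r) * cis s) < 1" for s using r by (simp add: norm_mult)
  have sr: "complex_of_real (sqrt r) * complex_of_real (sqrt r) = of_real r"
    using r by (simp flip: of_real_mult)
  have k: "fn (kernel 1 w) u = 1 / (1 - cnj w * u)" if "norm u < 1" for u
  proof -
    have "norm (cnj w * u) < 1" using nw that mult_strict_mono'[of "norm w" 1 "norm u" 1] by (simp add: norm_mult)
    then have "(\<lambda>n. (cnj w * u) ^ n) sums (1 / (1 - cnj w * u))" by (rule geometric_sums)
    moreover have "(\<lambda>n. (cnj w * u) ^ n) sums fn (kernel 1 w) u"
      using fn_sums[OF that, of "kernel 1 w"] by (simp add: hcoeff_kernel nw power_mult_distrib)
    ultimately show ?thesis using sums_unique2 by blast
  qed
  have e: "(norm (fn (kernel 1 w) (of_real (sqrt r) * cis s)))\<^sup>2 = 1 / (norm (cis s - of_real r * cis t))\<^sup>2" for s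
  proof -
    have "cnj w * (of_real (sqrt r) * cis s) = of_real r * cnj (cis t) * cis s"
      using sr by (simp add: w_def algebra_simps)
    then have "fn (kernel 1 w) (of_real (sqrt r) * cis s) = 1 / (1 - of_real r * cnj (cis t) * cis s)"
      by (simp add: k[OF pt])
    moreover have "norm (1 - of_real r * cnj (cis t) * cis s) = norm (cis s - of_real r * cis t)"
    proof -
      have "cis s * cnj (1 - of_real r * cnj (cis t) * cis s) = cis s - of_real r * cis t * (cis s * cnj (cis s))"
        by (simp add: algebra_simps)
      also have "cis s * cnj (cis s) = 1" by (simp add: cis_cnj cis_mult)
      finally have "norm (cis s * cnj (1 - of_real r * cnj (cis t) * cis s)) = norm (cis s - of_real r * cis t)"
        by simp
      then show ?thesis unfolding norm_mult complex_mod_cnj norm_cis by simp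
    qed
    ultimately show ?thesis by (simp add: norm_divide power_divide)
  qed
  have "dilate (sqrt r) (kernel 1 w) = kernel 1 (of_real r * cis t)"
  proof (rule h2_eqI)
    fix n
    have "complex_of_real (sqrt r) * cnj w = cnj (of_real r * cis t)" using sr by (simp add: w_def algebra_simps)
    then show "hcoeff (dilate (sqrt r) (kernel 1 w)) n = hcoeff (kernel 1 (of_real r * cis t)) n"
      using r nw by (simp add: hcoeff_dilate hcoeff_kernel norm_mult flip: power_mult_distrib)
  qed
  then have "integral {0..2*pi} (\<lambda>s. 1 / (norm (cis s - of_real r * cis t))\<^sup>2) = 2 * pi * (1 / (1 - r\<^sup>2))"
    using circle_norm_fn[of "sqrt r" "kernel 1 w"] r unfolding e
    by (simp add: norm_kernel norm_mult)
  moreover have "(\<lambda>s. 1 / (norm (cis s - of_real r * cis t))\<^sup>2) integrable_on {0..2*pi}"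
    using circle_integrable_fn[of "sqrt r" "kernel 1 w"] r unfolding e by simp
  ultimately have "((\<lambda>s. 1 / (norm (cis s - of_real r * cis t))\<^sup>2) has_integral 2 * pi * (1 / (1 - r\<^sup>2))) {0..2*pi}"
    by (simp add: has_integral_iff)
  from has_integral_mult_right[OF this, of "1 - r\<^sup>2"] show ?thesis
    using r power_less_one_iff[of r 2] by simp
qed

text \<open>Taking \<open>t\<close> in the open interval excludes the coincidence of the two
  endpoints.\<close>

lemma cis_inj_circle:
  assumes "t \<in> {0<..<2*pi}" "s \<in> {0..2*pi}" "cis s = cis t" shows "s = t"
proof -
  have "cis (s - t) = 1" using assms(3) by (simp add: cis_divide[symmetric])
  then have "exp (\<i> * of_real (s - t)) = 1" by (simp add: cis_conv_exp)
  then obtain n :: int where n: "s - t = of_int (2 * n) * pi" unfolding exp_eq_1 by auto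
  then have n': "real_of_int n * (2 * pi) = s - t" by simp
  have "real_of_int n * (2 * pi) < 1 * (2 * pi)" "(- 1) * (2 * pi) < real_of_int n * (2 * pi)"
    unfolding n' using assms(1,2) by auto
  then have "real_of_int n < 1" "- 1 < real_of_int n"
    using mult_less_cancel_right_pos[of "2 * pi"] pi_gt_zero by (simp_all only: zero_less_mult_iff zero_less_numeral simp_thms)
  then have "n = 0" by linarith
  then show ?thesis using n by simp
qed

text \<open>The Cauchy kernel at \<open>z\<close> is not integrable uniformly as \<open>z\<close> approaches the circle; subtracting its
  reflection, which annihilates analytic functions, makes it comparable to the Poisson kernel.\<close>

lemma reflected_kernel_bound:
  fixes \<zeta> \<zeta>0 :: complex
  assumes r: "0 < r" "r < 1" and n: "norm \<zeta> = 1" "norm \<zeta>0 = 1"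
  shows "norm (1 / (\<zeta> - of_real r * \<zeta>0)\<^sup>2 - 1 / (\<zeta> - \<zeta>0 / of_real r)\<^sup>2) \<le> 2 * (1 - r\<^sup>2) / norm (\<zeta> - of_real r * \<zeta>0) ^ 3"
proof -
  define A where "A = \<zeta> - of_real r * \<zeta>0"
  define B where "B = \<zeta> - \<zeta>0 / of_real r"
  have "1 - r \<le> norm A" unfolding A_def using norm_triangle_ineq2[of \<zeta> "of_real r * \<zeta>0"] n r by (simp add: norm_mult)
  then have A0: "norm A > 0" using r by linarith
  have u: "\<zeta> * cnj \<zeta> = 1" "\<zeta>0 * cnj \<zeta>0 = 1" using n by (simp_all flip: complex_norm_square)
  \<comment> \<open>Reflection in the circle: points of modulus 1 have proportional distances, with
    ratio \<open>r\<close>, to a point and to its mirror image.\<close>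
  have "norm (of_real r * \<zeta> - \<zeta>0) = norm A"
  proof -
    have "cnj (of_real r * \<zeta> - \<zeta>0) * (\<zeta> * \<zeta>0) = of_real r * \<zeta>0 * (\<zeta> * cnj \<zeta>) - \<zeta> * (\<zeta>0 * cnj \<zeta>0)"
      by (simp add: algebra_simps)
    then have "cnj (of_real r * \<zeta> - \<zeta>0) * (\<zeta> * \<zeta>0) = - A" by (simp add: u A_def)
    then have "norm (cnj (of_real r * \<zeta> - \<zeta>0) * (\<zeta> * \<zeta>0)) = norm A" by simp
    then show ?thesis by (simp only: norm_mult complex_mod_cnj n mult_1_right)
  qed
  moreover have "of_real r * B = of_real r * \<zeta> - \<zeta>0" using r by (simp add: B_def algebra_simps)
  then have "norm (of_real r * \<zeta> - \<zeta>0) = r * norm B" using r by (metis abs_of_pos norm_mult norm_of_real)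
  ultimately have nB: "norm B = norm A / r" using r by (simp add: field_simps)
  then have B0: "B \<noteq> 0" using A0 r by auto
  have "1 / A\<^sup>2 - 1 / B\<^sup>2 = (B - A) * (A + B) / (A\<^sup>2 * B\<^sup>2)"
    using A0 B0 by (simp add: field_simps power2_eq_square)
  then have "norm (1 / A\<^sup>2 - 1 / B\<^sup>2) = norm (B - A) * norm (A + B) / ((norm A)\<^sup>2 * (norm B)\<^sup>2)"
    by (simp add: norm_mult norm_divide norm_power)
  also have "norm (B - A) = (1 - r\<^sup>2) / r"
  proof -
    have "B - A = - (\<zeta>0 * of_real ((1 - r\<^sup>2) / r))"
      using r by (simp add: A_def B_def field_simps power2_eq_square)
    then have "norm (B - A) = norm (\<zeta>0 * of_real ((1 - r\<^sup>2) / r))" by (simp only: norm_minus_cancel)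
    also have "\<dots> = \<bar>(1 - r\<^sup>2) / r\<bar>" by (simp only: norm_mult n norm_of_real mult_1_left)
    also have "\<dots> = (1 - r\<^sup>2) / r" using r power_less_one_iff[of r 2] by simp
    finally show ?thesis .
  qed
  also have "(1 - r\<^sup>2) / r * norm (A + B) / ((norm A)\<^sup>2 * (norm B)\<^sup>2)
      \<le> (1 - r\<^sup>2) / r * (norm A * 2 / r) / ((norm A)\<^sup>2 * (norm B)\<^sup>2)"
  proof (intro divide_right_mono mult_left_mono)
    have "norm (A + B) \<le> norm A + norm A / r" using norm_triangle_ineq[of A B] nB by simp
    also have "\<dots> \<le> norm A / r + norm A / r" using r A0 by (intro add_right_mono) (simp add: pos_le_divide_eq)
    finally show "norm (A + B) \<le> norm A * 2 / r" by (simp add: mult.commute)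
    show "0 \<le> (1 - r\<^sup>2) / r" using r power_less_one_iff[of r 2] by simp
  qed simp
  also have "\<dots> = 2 * (1 - r\<^sup>2) / norm A ^ 3"
    unfolding nB using r A0 by (simp add: field_simps power2_eq_square power3_eq_cube)
  finally show ?thesis by (simp add: A_def B_def)
qed

text \<open>After subtracting the linear part of \<open>F\<close> at the boundary point, Cauchy's
  formula with the reflected kernel represents \<open>f z - c\<close>. The remainder is small
  compared with the chord near \<open>t\<close>, and one factor chord turns the cubic kernel bound
  into a Poisson kernel.\<close>

lemma boundary_derivative_radial_limit:
  assumes contF: "continuous_on (cball 0 1) F"
    and derF: "\<And>z. norm z < 1 \<Longrightarrow> (F has_field_derivative f z) (at z)"
    and t: "t \<in> {0<..<2*pi}"
    and bder: "\<And>\<epsilon>. 0 < \<epsilon> \<Longrightarrow> \<exists>d>0. \<forall>s\<in>{0..2*pi}. \<bar>s - t\<bar> < d \<longrightarrow>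
        norm (F (cis s) - F (cis t) - c * (cis s - cis t)) \<le> \<epsilon> * norm (cis s - cis t)"
  shows "((\<lambda>r::real. f (of_real r * cis t)) \<longlongrightarrow> c) (at_left 1)"
proof -
  define \<zeta>0 where "\<zeta>0 = cis t"
  have n0: "norm \<zeta>0 = 1" by (simp add: \<zeta>0_def)
  define G where "G u = F u - F \<zeta>0 - c * (u - \<zeta>0)" for u
  have contG: "continuous_on (cball 0 1) G" unfolding G_def by (intro continuous_intros contF)
  have derG: "(G has_field_derivative f z - c) (at z)" if "norm z < 1" for z
    unfolding G_def using that by (auto intro!: derivative_eq_intros derF)
  have holG: "G holomorphic_on ball 0 1"
    unfolding holomorphic_on_open[OF open_ball] using derG by (metis mem_ball_0)
  obtain M where M: "\<And>u. norm u \<le> 1 \<Longrightarrow> norm (G u) \<le> M"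
    using compact_imp_bounded[OF compact_continuous_image[OF contG]] unfolding bounded_iff
    by (metis compact_cball imageI mem_cball_0)
  have M0: "0 \<le> M" using M[of 0] norm_ge_zero[of "G 0"] by (simp del: norm_ge_zero)
  \<comment> \<open>The third power is chosen to cancel the cube in the kernel bound. Away from
    \<open>t\<close> the chord is bounded below, so a large constant absorbs the maximum
    \<open>M\<close>.\<close>
  have cubic: "\<exists>C\<ge>0. \<forall>s\<in>{0..2*pi}. norm (G (cis s)) \<le> \<epsilon> * norm (cis s - \<zeta>0) + C * norm (cis s - \<zeta>0) ^ 3"
    if e: "0 < \<epsilon>" for \<epsilon>
  proof -
    obtain d where d: "d > 0" "\<And>s. s \<in> {0..2*pi} \<Longrightarrow> \<bar>s - t\<bar> < d \<Longrightarrow> norm (G (cis s)) \<le> \<epsilon> * norm (cis s - \<zeta>0)"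
      using bder[OF e] unfolding G_def \<zeta>0_def by blast
    define T where "T = {0..2*pi} - ball t d"
    have "compact T" unfolding T_def by (intro compact_diff) auto
    have pos: "0 < norm (cis s - \<zeta>0)" if "s \<in> T" for s
      using that cis_inj_circle[OF t, of s] d(1) unfolding T_def \<zeta>0_def by auto
    obtain m where m: "m > 0" "\<And>s. s \<in> T \<Longrightarrow> m \<le> norm (cis s - \<zeta>0)"
    proof (cases "T = {}")
      case False
      have "continuous_on T (\<lambda>s. norm (cis s - \<zeta>0))" by (intro continuous_intros)
      then obtain s0 where "s0 \<in> T" "\<forall>s\<in>T. norm (cis s0 - \<zeta>0) \<le> norm (cis s - \<zeta>0)"
        using continuous_attains_inf[OF \<open>compact T\<close> False] by blast
      then show ?thesis using pos that by blast
    qed (use that[of 1] in auto)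
    have "norm (G (cis s)) \<le> \<epsilon> * norm (cis s - \<zeta>0) + M / m ^ 3 * norm (cis s - \<zeta>0) ^ 3"
      if s: "s \<in> {0..2*pi}" for s
    proof (cases "\<bar>s - t\<bar> < d")
      case True
      have "0 \<le> M / m ^ 3 * norm (cis s - \<zeta>0) ^ 3" using M0 m(1) by simp
      then show ?thesis using d(2)[OF s True] by linarith
    next
      case False
      then have "s \<in> T" using s by (simp add: T_def dist_real_def abs_minus_commute)
      then have "m ^ 3 \<le> norm (cis s - \<zeta>0) ^ 3" using m by (intro power_mono) auto
      then have "M / m ^ 3 * m ^ 3 \<le> M / m ^ 3 * norm (cis s - \<zeta>0) ^ 3" using M0 m(1) by (intro mult_left_mono) auto
      then have "M \<le> M / m ^ 3 * norm (cis s - \<zeta>0) ^ 3" using m(1) by simp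
      moreover have "norm (G (cis s)) \<le> M" by (rule M) simp
      moreover have "0 \<le> \<epsilon> * norm (cis s - \<zeta>0)" using e by simp
      ultimately show ?thesis by linarith
    qed
    then show ?thesis using M0 m(1) by (intro exI[of _ "M / m ^ 3"]) auto
  qed
  have main: "norm (f (of_real r * \<zeta>0) - c) \<le> 4 * \<epsilon> + 16 * C * (1 - r\<^sup>2)"
    if r: "0 < r" "r < 1" and C: "0 \<le> C"
      "\<And>s. s \<in> {0..2*pi} \<Longrightarrow> norm (G (cis s)) \<le> \<epsilon> * norm (cis s - \<zeta>0) + C * norm (cis s - \<zeta>0) ^ 3"
      and e: "0 < \<epsilon>" for r C \<epsilon>
  proof -
    define z where "z = of_real r * \<zeta>0"
    define zs where "zs = \<zeta>0 / of_real r"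
    have nz: "norm z < 1" using r n0 by (simp add: z_def norm_mult)
    have nzs: "1 < norm zs" using r n0 by (simp add: zs_def norm_divide)
    have r2: "0 \<le> 1 - r\<^sup>2" using r power_less_one_iff[of r 2] by simp
    have I1: "((\<lambda>u. G u / (u - z)\<^sup>2) has_contour_integral 2 * of_real pi * \<i> * (f z - c)) (circlepath 0 1)"
    proof -
      note D = Cauchy_derivative_integral_circlepath[OF contG holG, of z]
      have "z \<in> ball 0 1" using nz by simp
      from DERIV_unique[OF derG[OF nz] D(2)[OF this]]
      have "2 * of_real pi * \<i> * (f z - c) = contour_integral (circlepath 0 1) (\<lambda>u. G u / (u - z)\<^sup>2)" by simp
      then show ?thesis using D(1)[OF \<open>z \<in> ball 0 1\<close>] by (simp add: has_contour_integral_integral)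
    qed
    \<comment> \<open>The reflected pole lies outside the closed disc. The extra factor
      \<open>u\<close> in \<open>H\<close> lets Cauchy's formula at the centre return the value
      0.\<close>
    have I2: "((\<lambda>u. G u / (u - zs)\<^sup>2) has_contour_integral 0) (circlepath 0 1)"
    proof -
      define H where "H u = u * G u / (u - zs)\<^sup>2" for u
      have ne: "u - zs \<noteq> 0" if "norm u \<le> 1" for u using that nzs by auto
      have "continuous_on (cball 0 1) H" unfolding H_def using ne by (intro continuous_intros contG) auto
      moreover have "H holomorphic_on ball 0 1" unfolding H_def using ne by (intro holomorphic_intros holG) auto
      ultimately have "((\<lambda>u. H u / (u - 0)) has_contour_integral 2 * of_real pi * \<i> * H 0) (circlepath 0 1)"
        by (rule Cauchy_integral_circlepath) simp
      then have "((\<lambda>u. H u / (u - 0)) has_contour_integral 0) (circlepath 0 1)" by (simp add: H_def)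
      then show ?thesis by (rule has_contour_integral_eq) (auto simp: H_def)
    qed
    define K where "K u = 1 / (u - z)\<^sup>2 - 1 / (u - zs)\<^sup>2" for u
    have "((\<lambda>u. G u / (u - z)\<^sup>2 - G u / (u - zs)\<^sup>2) has_contour_integral 2 * of_real pi * \<i> * (f z - c) - 0) (circlepath 0 1)"
      by (rule has_contour_integral_diff[OF I1 I2])
    then have "((\<lambda>u. G u * K u) has_contour_integral 2 * of_real pi * \<i> * (f z - c)) (circlepath 0 1)"
      by (simp add: K_def algebra_simps)
    then have I: "((\<lambda>s. G (cis s) * K (cis s) * \<i> * cis s) has_integral 2 * of_real pi * \<i> * (f z - c)) {0..2*pi}"
      unfolding circlepath_def by (subst (asm) has_contour_integral_part_circlepath_iff) simp_all
    define P where "P s = (1 - r\<^sup>2) / (norm (cis s - z))\<^sup>2" for s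
    have "((\<lambda>s. 4 * \<epsilon> * P s) has_integral 4 * \<epsilon> * (2 * pi)) {0..2*pi}"
      unfolding P_def z_def \<zeta>0_def by (intro has_integral_mult_right poisson_integral r)
    moreover have "((\<lambda>s::real. 16 * C * (1 - r\<^sup>2)) has_integral 16 * C * (1 - r\<^sup>2) * (2 * pi)) {0..2*pi}"
      using has_integral_const_real[of "16 * C * (1 - r\<^sup>2)" 0 "2*pi"] by (simp add: mult.commute)
    ultimately have J: "((\<lambda>s. 4 * \<epsilon> * P s + 16 * C * (1 - r\<^sup>2)) has_integral 4 * \<epsilon> * (2 * pi) + 16 * C * (1 - r\<^sup>2) * (2 * pi)) {0..2*pi}"
      by (rule has_integral_add)
    have bound: "norm (G (cis s) * K (cis s) * \<i> * cis s) \<le> 4 * \<epsilon> * P s + 16 * C * (1 - r\<^sup>2)"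
      if s: "s \<in> {0..2*pi}" for s
    proof -
      define A where "A = norm (cis s - z)"
      have r1: "1 - r \<le> A" unfolding A_def z_def
        using norm_triangle_ineq2[of "cis s" "of_real r * \<zeta>0"] n0 r by (simp add: norm_mult)
      then have A0: "0 < A" using r by linarith
      \<comment> \<open>The radial distance \<open>1 - r\<close> is at most \<open>A\<close>, so the
        chord is at most \<open>2 * A\<close>; this produces the constants 4 and 16.\<close>
      have "norm (z - \<zeta>0) = 1 - r"
      proof -
        have "z - \<zeta>0 = - (of_real (1 - r) * \<zeta>0)" by (simp add: z_def algebra_simps)
        then have "norm (z - \<zeta>0) = \<bar>1 - r\<bar> * norm \<zeta>0" by (simp only: norm_minus_cancel norm_mult norm_of_real)
        then show ?thesis using r n0 by simp
      qed
      then have "norm (cis s - \<zeta>0) \<le> 2 * A"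
        using norm_triangle_ineq[of "cis s - z" "z - \<zeta>0"] r1 unfolding A_def by simp
      then have "\<epsilon> * norm (cis s - \<zeta>0) + C * norm (cis s - \<zeta>0) ^ 3 \<le> \<epsilon> * (2 * A) + C * (2 * A) ^ 3"
        using e C(1) by (intro add_mono mult_left_mono power_mono) auto
      then have g: "norm (G (cis s)) \<le> \<epsilon> * (2 * A) + C * (2 * A) ^ 3" using C(2)[OF s] by linarith
      have k: "norm (K (cis s)) \<le> 2 * (1 - r\<^sup>2) / A ^ 3"
        unfolding K_def A_def z_def zs_def by (rule reflected_kernel_bound[OF r _ n0]) simp
      have "norm (G (cis s) * K (cis s) * \<i> * cis s) = norm (G (cis s)) * norm (K (cis s))"
        by (simp add: norm_mult)
      also have "\<dots> \<le> (\<epsilon> * (2 * A) + C * (2 * A) ^ 3) * (2 * (1 - r\<^sup>2) / A ^ 3)"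
        using g k order_trans[OF norm_ge_zero g] by (intro mult_mono) auto
      also have "\<dots> = 4 * \<epsilon> * P s + 16 * C * (1 - r\<^sup>2)"
        using A0 unfolding P_def A_def[symmetric] by (simp add: field_simps power2_eq_square power3_eq_cube)
      finally show ?thesis .
    qed
    have "norm (2 * of_real pi * \<i> * (f z - c)) \<le> 4 * \<epsilon> * (2 * pi) + 16 * C * (1 - r\<^sup>2) * (2 * pi)"
      unfolding integral_unique[OF I, symmetric] integral_unique[OF J, symmetric]
      by (rule Henstock_Kurzweil_Integration.integral_norm_bound_integral) (use I J bound in blast)+
    moreover have "norm (2 * of_real pi * \<i> * (f z - c)) = norm (f z - c) * (2 * pi)"
      unfolding norm_mult by simp
    ultimately have "norm (f z - c) * (2 * pi) \<le> (4 * \<epsilon> + 16 * C * (1 - r\<^sup>2)) * (2 * pi)"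
      by (simp add: algebra_simps)
    then show ?thesis unfolding z_def by (subst (asm) mult_le_cancel_right_pos) auto
  qed
  show ?thesis
  proof (rule tendstoI)
    fix e :: real assume e: "e > 0"
    \<comment> \<open>With \<open>e / 8\<close> the first error is \<open>e / 2\<close>; the second
      vanishes as \<open>r\<close> tends to 1, whatever the size of \<open>C\<close>.\<close>
    obtain C where C: "0 \<le> C"
      "\<And>s. s \<in> {0..2*pi} \<Longrightarrow> norm (G (cis s)) \<le> e / 8 * norm (cis s - \<zeta>0) + C * norm (cis s - \<zeta>0) ^ 3"
      using cubic[of "e / 8"] e by auto
    have "((\<lambda>r::real. 4 * (e / 8) + 16 * C * (1 - r\<^sup>2)) \<longlongrightarrow> 4 * (e / 8) + 16 * C * (1 - 1\<^sup>2)) (at_left 1)"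
      by (intro tendsto_intros)
    then have "eventually (\<lambda>r::real. 4 * (e / 8) + 16 * C * (1 - r\<^sup>2) < e) (at_left 1)"
      by (rule order_tendstoD(2)) (use e in simp)
    moreover have "eventually (\<lambda>r. r \<in> {0<..<1}) (at_left (1::real))" by (rule eventually_at_left_real) simp
    ultimately show "eventually (\<lambda>r::real. dist (f (of_real r * cis t)) c < e) (at_left 1)"
    proof eventually_elim
      case (elim r)
      then show ?case using main[of r C "e / 8"] C e by (auto simp: dist_norm \<zeta>0_def)
    qed
  qed
qed

text \<open>Dilations converge in H^2, so their restrictions to the circle are Cauchy in mean, and a
  subsequence of radii converges almost everywhere. This gives a measurable candidate for the
  boundary values before full radial limits are known.\<close>

lemma boundary_function:
  assumes f: "f \<in> Hinf"
  obtains g N k where "negligible N" "g \<in> borel_measurable borel" "strict_mono k"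
    "\<And>t. t \<in> {0..2*pi} - N \<Longrightarrow> (\<lambda>i. f (of_real (radius (k i)) * cis t)) \<longlonglongrightarrow> g t"
    "\<And>t B. 0 \<le> B \<Longrightarrow> (\<And>z. norm z < 1 \<Longrightarrow> norm (f z) \<le> B) \<Longrightarrow> norm (g t) \<le> B"
proof -
  define a where "a = mul f one"
  define s where "s n t = fn a (of_real (radius n) * cis t)" for n t
  have rn: "norm (of_real (radius n) * cis t) < 1" for n t using radius[of n] by (simp add: norm_mult)
  have sf: "s n t = f (of_real (radius n) * cis t)" for n t using f rn by (simp add: s_def a_def)
  have cont_s: "continuous_on S (s n)" for S n
    unfolding s_def
    by (rule continuous_on_compose2[OF holomorphic_on_imp_continuous_on[OF fn_holomorphic]])
       (use rn in \<open>auto intro!: continuous_intros\<close>)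
  have int_s: "integrable (lebesgue_on {0..2*pi}) (s n)" for n
    by (rule continuous_imp_integrable_real) (rule cont_s)
  \<comment> \<open>Dilating by the quotient of the two radii moves both functions to a single
    circle, where Parseval applies to their difference.\<close>
  have sq: "integral {0..2*pi} (\<lambda>t. (norm (s i t - s j t))\<^sup>2) = 2 * pi * (norm (dilate (radius i) a - dilate (radius j) a))\<^sup>2"
    if ij: "i \<le> j" for i j
  proof -
    define \<tau> where "\<tau> = radius i / radius j"
    have \<tau>: "0 \<le> \<tau>" "\<tau> \<le> 1" using radius[of i] radius[of j] radius_mono[OF ij] by (auto simp: \<tau>_def)
    have \<tau>r: "radius i = \<tau> * radius j" using radius[of j] by (simp add: \<tau>_def)
    have "s i t = fn (dilate \<tau> a) (of_real (radius j) * cis t)" for t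
      using \<tau> rn by (simp add: fn_dilate s_def \<tau>r mult.assoc)
    then have "integral {0..2*pi} (\<lambda>t. (norm (s i t - s j t))\<^sup>2)
      = integral {0..2*pi} (\<lambda>t. (norm (fn (dilate \<tau> a - a) (of_real (radius j) * cis t)))\<^sup>2)"
      by (simp add: s_def)
    also have "\<dots> = 2 * pi * (norm (dilate (radius j) (dilate \<tau> a - a)))\<^sup>2"
      using radius[of j] by (intro circle_norm_fn) auto
    also have "dilate (radius j) (dilate \<tau> a - a) = dilate (radius i) a - dilate (radius j) a"
      using radius[of j] radius[of i] \<tau>
      by (intro h2_eqI) (simp add: hcoeff_dilate \<tau>r power_mult_distrib algebra_simps)
    finally show ?thesis .
  qed
  have small: "\<exists>N. \<forall>i\<ge>N. \<forall>j\<ge>N. LINT t|lebesgue_on {0..2*pi}. norm (s i t - s j t) < e" if e: "e > 0" for e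
  proof -
    \<comment> \<open>The two resulting terms are each at most \<open>2 * pi * \<eta>\<close>, a
      quarter of \<open>e\<close>.\<close>
    define \<eta> where "\<eta> = e / (8 * pi)"
    have \<eta>: "\<eta> > 0" using e by (simp add: \<eta>_def)
    have "Cauchy (\<lambda>n. dilate (radius n) a)" using dilate_tendsto LIMSEQ_imp_Cauchy by blast
    from metric_CauchyD[OF this \<eta>]
    obtain N where N: "norm (dilate (radius i) a - dilate (radius j) a) < \<eta>" if "i \<ge> N" "j \<ge> N" for i j
      unfolding dist_norm by blast
    have lt: "LINT t|lebesgue_on {0..2*pi}. norm (s i t - s j t) < e" if ij: "N \<le> i" "i \<le> j" for i j
    proof -
      have c: "continuous_on {0..2*pi} (\<lambda>t. norm (s i t - s j t))" by (intro continuous_intros cont_s)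
      have "LINT t|lebesgue_on {0..2*pi}. norm (s i t - s j t) = integral {0..2*pi} (\<lambda>t. norm (s i t - s j t))"
        by (rule lebesgue_integral_eq_integral[OF continuous_imp_integrable_real[OF c]]) simp
      also have "\<dots> \<le> integral {0..2*pi} (\<lambda>t. \<eta> + (norm (s i t - s j t))\<^sup>2 / \<eta>)"
      proof (rule integral_le)
        show "(\<lambda>t. norm (s i t - s j t)) integrable_on {0..2*pi}" by (rule integrable_continuous_real[OF c])
        show "(\<lambda>t. \<eta> + (norm (s i t - s j t))\<^sup>2 / \<eta>) integrable_on {0..2*pi}"
          using \<eta> by (intro integrable_continuous_real continuous_intros cont_s) auto
        \<comment> \<open>This elementary inequality replaces Cauchy-Schwarz in passing from square
          means to means.\<close>
        have "x \<le> \<eta> + x\<^sup>2 / \<eta>" if "0 \<le> x" for x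
        proof (cases "x \<le> \<eta>")
          case True
          have "0 \<le> x\<^sup>2 / \<eta>" using \<eta> by simp
          then show ?thesis using True by linarith
        next
          case False
          then have "x * \<eta> \<le> x * x" using \<eta> by (intro mult_left_mono) auto
          then have "x \<le> x\<^sup>2 / \<eta>" using \<eta> by (simp add: pos_le_divide_eq power2_eq_square)
          then show ?thesis using \<eta> by linarith
        qed
        then show "norm (s i t - s j t) \<le> \<eta> + (norm (s i t - s j t))\<^sup>2 / \<eta>" for t by simp
      qed
      also have "\<dots> = integral {0..2*pi} (\<lambda>_. \<eta>) + integral {0..2*pi} (\<lambda>t. (norm (s i t - s j t))\<^sup>2 / \<eta>)"
        using \<eta> by (intro integral_add integrable_continuous_real continuous_intros cont_s) auto
      also have "integral {0..2*pi} (\<lambda>t. (norm (s i t - s j t))\<^sup>2 / \<eta>) = 2 * pi * (norm (dilate (radius i) a - dilate (radius j) a))\<^sup>2 / \<eta>"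
        using sq[OF ij(2)] by simp
      also have "\<dots> \<le> 2 * pi * \<eta>\<^sup>2 / \<eta>"
        using \<eta> N[of i j] ij by (intro divide_right_mono mult_left_mono power_mono) auto
      also have "integral {0..2*pi} (\<lambda>_. \<eta>) + 2 * pi * \<eta>\<^sup>2 / \<eta> < e"
      proof -
        have "2 * pi * \<eta>\<^sup>2 / \<eta> = 2 * pi * \<eta>" using \<eta> by (simp add: power2_eq_square)
        moreover have "integral {0..2*pi} (\<lambda>_. \<eta>) = 2 * pi * \<eta>" by simp
        moreover have "2 * pi * \<eta> = e / 4" by (simp add: \<eta>_def)
        ultimately show ?thesis using e by linarith
      qed
      finally show ?thesis by simp
    qed
    have "LINT t|lebesgue_on {0..2*pi}. norm (s i t - s j t) < e" if "N \<le> i" "N \<le> j" for i j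
      using lt[of i j] lt[of j i] that by (cases "i \<le> j") (simp_all add: norm_minus_commute)
    then show ?thesis by blast
  qed
  obtain k where k: "strict_mono k" "AE t in lebesgue_on {0..2*pi}. Cauchy (\<lambda>i. s (k i) t)"
    using cauchy_L1_AE_cauchy_subseq[OF int_s small] by blast
  have "AE t in lebesgue. t \<in> {0..2*pi} \<longrightarrow> Cauchy (\<lambda>i. s (k i) t)"
    using k(2) by (subst (asm) AE_restrict_space_iff) auto
  then obtain N where N: "negligible N" "{t. \<not> (t \<in> {0..2*pi} \<longrightarrow> Cauchy (\<lambda>i. s (k i) t))} \<subseteq> N"
    unfolding eventually_ae_filter_negligible by blast
  have ms[measurable]: "s n \<in> borel_measurable borel" for n by (rule borel_measurable_continuous_onI[OF cont_s])
  define g where "g t = (if Cauchy (\<lambda>i. s (k i) t) then lim (\<lambda>i. s (k i) t) else 0)" for t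
  have conv: "(\<lambda>i. s (k i) t) \<longlonglongrightarrow> g t" if "Cauchy (\<lambda>i. s (k i) t)" for t
    using that by (simp add: g_def Cauchy_convergent_iff convergent_LIMSEQ_iff)
  have mg: "g \<in> borel_measurable borel"
    unfolding g_def by measurable
  have "norm (g t) \<le> B" if B: "0 \<le> B" "\<And>z. norm z < 1 \<Longrightarrow> norm (f z) \<le> B" for t B
  proof (cases "Cauchy (\<lambda>i. s (k i) t)")
    case True
    have "norm (s (k i) t) \<le> B" for i unfolding sf by (rule B(2)[OF rn])
    then show ?thesis using tendsto_norm[OF conv[OF True]] by (intro LIMSEQ_le_const2) auto
  qed (simp add: g_def B)
  moreover have "(\<lambda>i. f (of_real (radius (k i)) * cis t)) \<longlonglongrightarrow> g t" if "t \<in> {0..2*pi} - N" for t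
    using conv[of t] N(2) that unfolding sf by auto
  ultimately show ?thesis using that[OF N(1) mg k(1)] by blast
qed

text \<open>A primitive of \<open>f\<close> is Lipschitz and extends continuously to the closed
  disc. Along the circle it is the integral of \<open>h\<close>, so Lebesgue differentiation gives
  it a boundary derivative at almost every point, and this derivative is the radial limit of
  \<open>f\<close>.\<close>

theorem fatou:
  assumes f: "f \<in> Hinf"
  shows "AE t in lborel. t \<in> {0..2*pi} \<longrightarrow> (\<exists>c. ((\<lambda>r::real. f (of_real r * cis t)) \<longlongrightarrow> c) (at_left 1))"
proof -
  obtain B where B: "B > 0" "\<And>z. norm z < 1 \<Longrightarrow> norm (f z) \<le> B" using Hinf_bound[OF f] by blast
  obtain g N0 k where g: "negligible N0" "g \<in> borel_measurable borel" "strict_mono k"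
    "\<And>t. t \<in> {0..2*pi} - N0 \<Longrightarrow> (\<lambda>i. f (of_real (radius (k i)) * cis t)) \<longlonglongrightarrow> g t"
    and gB: "\<And>t. norm (g t) \<le> B"
    using boundary_function[OF f] B by (metis less_imp_le)
  have holf: "f holomorphic_on ball 0 1" using f by (rule Hinf_holomorphic)
  obtain F0 where "\<And>x. x \<in> ball 0 1 \<Longrightarrow> (F0 has_field_derivative f x) (at x within ball 0 1)"
    using holomorphic_convex_primitive'[OF convex_ball open_ball holf] by blast
  note F0 = this
  have lip: "norm (F0 x - F0 y) \<le> B * norm (x - y)" if "x \<in> ball 0 1" "y \<in> ball 0 1" for x y :: complex
    by (rule field_differentiable_bound[OF convex_ball F0]) (use that B in auto)
  have uc: "uniformly_continuous_on (ball 0 1) F0"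
    unfolding uniformly_continuous_on_def
  proof (intro allI impI)
    fix e :: real assume e: "e > 0"
    show "\<exists>d>0. \<forall>x\<in>ball 0 1. \<forall>x'\<in>ball 0 1. dist x' x < d \<longrightarrow> dist (F0 x') (F0 x) < e"
    proof (intro exI[of _ "e / B"] conjI ballI impI)
      fix x y :: complex assume xy: "x \<in> ball 0 1" "y \<in> ball 0 1" "dist y x < e / B"
      have "dist (F0 y) (F0 x) \<le> B * dist y x" using lip[OF xy(2,1)] by (simp add: dist_norm)
      also have "\<dots> < e" using xy(3) B(1) by (simp add: pos_less_divide_eq mult.commute)
      finally show "dist (F0 y) (F0 x) < e" .
    qed (use e B in auto)
  qed
  obtain F where F: "uniformly_continuous_on (closure (ball 0 1)) F" "\<And>x. x \<in> ball 0 1 \<Longrightarrow> F0 x = F x"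
    by (rule uniformly_continuous_on_extension_on_closure[OF uc]) (rule that)
  have contF: "continuous_on (cball 0 1) F"
    using uniformly_continuous_imp_continuous[OF F(1)] by simp
  have derF: "(F has_field_derivative f z) (at z)" if "norm z < 1" for z
  proof -
    have z: "z \<in> ball 0 1" using that by simp
    have "(F0 has_field_derivative f z) (at z)" using F0[OF z] unfolding at_within_open[OF z open_ball] .
    then show ?thesis by (rule has_field_derivative_transform_within_open[OF _ open_ball z F(2)])
  qed
  \<comment> \<open>The candidate derivative of \<open>F (cis t)\<close> with respect to the
    angle.\<close>
  define h where "h t = g t * (\<i> * cis t)" for t
  have mh: "h \<in> borel_measurable borel"
    unfolding h_def
    by (intro borel_measurable_times g(2) borel_measurable_continuous_onI[of "\<lambda>t. \<i> * cis t"] continuous_intros)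
  have hB: "norm (h t) \<le> B" for t using gB[of t] by (simp add: h_def norm_mult)
  have hint: "(h has_integral (F (cis y) - F (cis x))) {x..y}" if xy: "0 \<le> x" "x \<le> y" "y \<le> 2*pi" for x y
  proof -
    define S where "S = {x..y} - N0"
    have SS: "S \<subseteq> {x..y}" by (auto simp: S_def)
    have neg: "negligible ({x..y} - S)" "negligible (S - {x..y} \<union> ({x..y} - S))"
      by (rule negligible_subset[OF g(1)]; auto simp: S_def)+
    define q where "q i t = f (of_real (radius (k i)) * cis t) * (\<i> * of_real (radius (k i)) * cis t)" for i t
    have rn: "norm (of_real (radius n) * cis t) < 1" for n t using radius[of n] by (simp add: norm_mult)
    have qint: "(q i has_integral (F (of_real (radius (k i)) * cis y) - F (of_real (radius (k i)) * cis x))) {x..y}" for i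
    proof (rule fundamental_theorem_of_calculus[OF xy(2)])
      fix t
      define \<rho> where "\<rho> = radius (k i)"
      have "((\<lambda>t. of_real \<rho> * cis t) has_vector_derivative (\<i> * of_real \<rho> * cis t)) (at t within {x..y})"
        unfolding has_vector_derivative_def
        by (auto intro!: derivative_eq_intros simp: scaleR_conv_of_real algebra_simps)
      from field_vector_diff_chain_within[OF this has_field_derivative_at_within[OF derF[OF rn[of "k i" t, folded \<rho>_def]]]]
      show "((\<lambda>t. F (of_real (radius (k i)) * cis t)) has_vector_derivative q i t) (at t within {x..y})"
        by (simp add: o_def q_def \<rho>_def mult.commute)
    qed
    have qS: "q i integrable_on S" "integral S (q i) = F (of_real (radius (k i)) * cis y) - F (of_real (radius (k i)) * cis x)" for i
    proof -
      show "q i integrable_on S" using qint[of i] integrable_spike_set_eq[OF neg(2), of "q i"] by blast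
      show "integral S (q i) = F (of_real (radius (k i)) * cis y) - F (of_real (radius (k i)) * cis x)"
        using integral_subset_negligible[OF SS neg(1), of "q i"] qint[of i] by (simp add: integral_unique)
    qed
    have rk: "(\<lambda>i. radius (k i)) \<longlonglongrightarrow> 1" using LIMSEQ_subseq_LIMSEQ[OF radius_tendsto g(3)] by (simp add: o_def)
    have dc: "h integrable_on S" "(\<lambda>i. integral S (q i)) \<longlonglongrightarrow> integral S h"
    proof (rule_tac [!] dominated_convergence[of q S "\<lambda>_. B" h])
      show 1: "q i integrable_on S" for i by (rule qS)
      then show "q i integrable_on S" for i .
      show 2: "(\<lambda>_. B) integrable_on S" using integrable_spike_set_eq[OF neg(2), of "\<lambda>_. B"] by auto
      then show "(\<lambda>_. B) integrable_on S" .
      show 3: "norm (q i t) \<le> B" for i t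
      proof -
        have "norm (q i t) = norm (f (of_real (radius (k i)) * cis t)) * radius (k i)"
          using radius[of "k i"] by (simp add: q_def norm_mult)
        also have "\<dots> \<le> B * 1" using B radius[of "k i"] rn by (intro mult_mono) (auto simp: less_imp_le)
        finally show ?thesis by simp
      qed
      then show "norm (q i t) \<le> B" for i t .
      show 4: "(\<lambda>i. q i t) \<longlonglongrightarrow> h t" if "t \<in> S" for t
      proof -
        have "(\<lambda>i. q i t) \<longlonglongrightarrow> g t * (\<i> * of_real 1 * cis t)"
          unfolding q_def using that xy by (intro tendsto_intros g(4) rk) (auto simp: S_def)
        then show ?thesis by (simp add: h_def)
      qed
      then show "(\<lambda>i. q i t) \<longlonglongrightarrow> h t" if "t \<in> S" for t using that by blast
    qed
    have Flim: "(\<lambda>i. F (of_real (radius (k i)) * cis w)) \<longlonglongrightarrow> F (cis w)" for w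
    proof (rule continuous_on_tendsto_compose[OF contF])
      have "(\<lambda>i. of_real (radius (k i)) * cis w) \<longlonglongrightarrow> of_real 1 * cis w" by (intro tendsto_intros rk)
      then show "(\<lambda>i. of_real (radius (k i)) * cis w) \<longlonglongrightarrow> cis w" by simp
      show "eventually (\<lambda>i. of_real (radius (k i)) * cis w \<in> cball 0 1) sequentially"
        using less_imp_le[OF rn] by (intro always_eventually) auto
    qed simp
    have "integral S h = F (cis y) - F (cis x)"
      using dc(2) unfolding qS(2) by (rule LIMSEQ_unique) (intro tendsto_diff Flim)
    moreover have "h integrable_on {x..y}" using dc(1) integrable_spike_set_eq[OF neg(2), of h] by blast
    ultimately show ?thesis using integral_subset_negligible[OF SS neg(1), of h] by (simp add: has_integral_iff)
  qed
  obtain N1 where N1: "negligible N1"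
    "\<And>t \<epsilon>. t \<in> {0<..<2*pi} - N1 \<Longrightarrow> 0 < \<epsilon> \<Longrightarrow> \<exists>d>0. \<forall>x y. x < y \<and> x \<le> t \<and> t \<le> y \<and> y - x < d \<longrightarrow>
        \<bar>integral {x..y} (\<lambda>t. Re (h t)) - Re (h t) * (y - x)\<bar> \<le> \<epsilon> * (y - x)"
  proof (rule density_AE[of "\<lambda>t. Re (h t)" B 0 "2*pi"])
    show "\<bar>Re (h x)\<bar> \<le> B" for x using abs_Re_le_cmod[of "h x"] hB[of x] by linarith
  qed (use mh in auto)
  obtain N2 where N2: "negligible N2"
    "\<And>t \<epsilon>. t \<in> {0<..<2*pi} - N2 \<Longrightarrow> 0 < \<epsilon> \<Longrightarrow> \<exists>d>0. \<forall>x y. x < y \<and> x \<le> t \<and> t \<le> y \<and> y - x < d \<longrightarrow>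
        \<bar>integral {x..y} (\<lambda>t. Im (h t)) - Im (h t) * (y - x)\<bar> \<le> \<epsilon> * (y - x)"
  proof (rule density_AE[of "\<lambda>t. Im (h t)" B 0 "2*pi"])
    show "\<bar>Im (h x)\<bar> \<le> B" for x using abs_Im_le_cmod[of "h x"] hB[of x] by linarith
  qed (use mh in auto)
  have lim: "((\<lambda>r::real. f (of_real r * cis t)) \<longlongrightarrow> g t) (at_left 1)"
    if t: "t \<in> {0<..<2*pi} - (N1 \<union> N2)" for t
  proof (rule boundary_derivative_radial_limit[OF contF derF])
    show "t \<in> {0<..<2*pi}" using t by blast
    fix \<epsilon> :: real assume e: "0 < \<epsilon>"
    \<comment> \<open>The bound 1/2 makes the arc at most twice the chord; the other bound absorbs
      the resulting constant \<open>2 * (2 + B)\<close>.\<close>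
    define \<eta> where "\<eta> = min (1/2) (\<epsilon> / (2 * (2 + B)))"
    have \<eta>: "0 < \<eta>" "\<eta> \<le> 1/2" "\<eta> * (2 * (2 + B)) \<le> \<epsilon>"
    proof -
      show "0 < \<eta>" using e B(1) by (simp add: \<eta>_def)
      show "\<eta> \<le> 1/2" unfolding \<eta>_def by (rule min.cobounded1)
      have "\<eta> \<le> \<epsilon> / (2 * (2 + B))" unfolding \<eta>_def by (rule min.cobounded2)
      then show "\<eta> * (2 * (2 + B)) \<le> \<epsilon>" using B(1) by (simp add: pos_le_divide_eq)
    qed
    obtain d1 where d1: "d1 > 0" "\<forall>x y. x < y \<and> x \<le> t \<and> t \<le> y \<and> y - x < d1 \<longrightarrow>
        \<bar>integral {x..y} (\<lambda>t. Re (h t)) - Re (h t) * (y - x)\<bar> \<le> \<eta> * (y - x)"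
      using N1(2)[OF _ \<eta>(1), of t] t by auto
    obtain d2 where d2: "d2 > 0" "\<forall>x y. x < y \<and> x \<le> t \<and> t \<le> y \<and> y - x < d2 \<longrightarrow>
        \<bar>integral {x..y} (\<lambda>t. Im (h t)) - Im (h t) * (y - x)\<bar> \<le> \<eta> * (y - x)"
      using N2(2)[OF _ \<eta>(1), of t] t by auto
    have "(cis has_derivative (\<lambda>x. x *\<^sub>R (\<i> * cis t))) (at t)"
      by (auto intro!: derivative_eq_intros simp: scaleR_conv_of_real algebra_simps)
    then obtain d3 where d3: "d3 > 0" "\<And>s. \<bar>s - t\<bar> < d3 \<Longrightarrow> norm (cis s - cis t - (s - t) *\<^sub>R (\<i> * cis t)) \<le> \<eta> * \<bar>s - t\<bar>"
      unfolding has_derivative_at_alt using \<eta>(1) by (auto simp: real_norm_def)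
    have step: "norm (F (cis y) - F (cis x) - (y - x) *\<^sub>R h t) \<le> 2 * \<eta> * (y - x)"
      if xy: "x < y" "x \<le> t" "t \<le> y" "y - x < min d1 d2" "0 \<le> x" "y \<le> 2*pi" for x y
    proof -
      have hi: "(h has_integral (F (cis y) - F (cis x))) {x..y}" using xy by (intro hint) auto
      have "Re (F (cis y) - F (cis x)) = integral {x..y} (\<lambda>t. Re (h t))"
        using has_integral_linear[OF hi bounded_linear_Re] by (simp add: o_def integral_unique)
      moreover have "Im (F (cis y) - F (cis x)) = integral {x..y} (\<lambda>t. Im (h t))"
        using has_integral_linear[OF hi bounded_linear_Im] by (simp add: o_def integral_unique)
      moreover have "\<bar>integral {x..y} (\<lambda>t. Re (h t)) - Re (h t) * (y - x)\<bar> \<le> \<eta> * (y - x)"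
        "\<bar>integral {x..y} (\<lambda>t. Im (h t)) - Im (h t) * (y - x)\<bar> \<le> \<eta> * (y - x)"
        using d1(2) d2(2) xy by auto
      ultimately have "\<bar>Re (F (cis y) - F (cis x) - (y - x) *\<^sub>R h t)\<bar> \<le> \<eta> * (y - x)"
        "\<bar>Im (F (cis y) - F (cis x) - (y - x) *\<^sub>R h t)\<bar> \<le> \<eta> * (y - x)"
        by (simp_all add: mult.commute)
      then show ?thesis using cmod_le[of "F (cis y) - F (cis x) - (y - x) *\<^sub>R h t"] by linarith
    qed
    show "\<exists>d>0. \<forall>s\<in>{0..2*pi}. \<bar>s - t\<bar> < d \<longrightarrow>
        norm (F (cis s) - F (cis t) - g t * (cis s - cis t)) \<le> \<epsilon> * norm (cis s - cis t)"
    proof (intro exI[of _ "min (min d1 d2) d3"] conjI ballI impI)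
      fix s assume s: "s \<in> {0..2*pi}" "\<bar>s - t\<bar> < min (min d1 d2) d3"
      have 1: "norm (F (cis s) - F (cis t) - (s - t) *\<^sub>R h t) \<le> 2 * \<eta> * \<bar>s - t\<bar>"
      proof (cases s t rule: linorder_cases)
        case less
        have "norm (F (cis t) - F (cis s) - (t - s) *\<^sub>R h t) \<le> 2 * \<eta> * (t - s)"
          using less s t by (intro step) auto
        moreover have "F (cis t) - F (cis s) - (t - s) *\<^sub>R h t = - (F (cis s) - F (cis t) - (s - t) *\<^sub>R h t)"
          by (simp add: algebra_simps)
        ultimately show ?thesis using less by (simp only: norm_minus_cancel) simp
      next
        case greater
        then show ?thesis using step[of t s] s t by simp
      qed simp
      have 2: "norm (cis s - cis t - (s - t) *\<^sub>R (\<i> * cis t)) \<le> \<eta> * \<bar>s - t\<bar>" using d3(2) s by simp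
      have "\<bar>s - t\<bar> = norm ((s - t) *\<^sub>R (\<i> * cis t))" by (simp add: norm_mult)
      also have "\<dots> \<le> norm (cis s - cis t) + norm (cis s - cis t - (s - t) *\<^sub>R (\<i> * cis t))"
        by (metis norm_minus_commute norm_triangle_sub)
      also have "\<dots> \<le> norm (cis s - cis t) + 1/2 * \<bar>s - t\<bar>"
        using 2 mult_right_mono[OF \<eta>(2) abs_ge_zero[of "s - t"]] by linarith
      finally have 3: "\<bar>s - t\<bar> \<le> 2 * norm (cis s - cis t)" by simp
      have "F (cis s) - F (cis t) - g t * (cis s - cis t)
         = (F (cis s) - F (cis t) - (s - t) *\<^sub>R h t) - g t * (cis s - cis t - (s - t) *\<^sub>R (\<i> * cis t))"
        by (simp add: h_def scaleR_conv_of_real algebra_simps)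
      then have "norm (F (cis s) - F (cis t) - g t * (cis s - cis t))
         \<le> norm (F (cis s) - F (cis t) - (s - t) *\<^sub>R h t) + norm (g t * (cis s - cis t - (s - t) *\<^sub>R (\<i> * cis t)))"
        using norm_triangle_ineq4 by metis
      also have "norm (g t * (cis s - cis t - (s - t) *\<^sub>R (\<i> * cis t))) \<le> B * (\<eta> * \<bar>s - t\<bar>)"
        unfolding norm_mult using gB[of t] 2 B(1) by (intro mult_mono) auto
      finally have "norm (F (cis s) - F (cis t) - g t * (cis s - cis t)) \<le> \<eta> * (2 + B) * \<bar>s - t\<bar>"
        using 1 by (simp add: algebra_simps)
      also have "\<dots> \<le> \<eta> * (2 + B) * (2 * norm (cis s - cis t))"
        using 3 \<eta>(1) B(1) by (intro mult_left_mono) auto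
      also have "\<dots> = \<eta> * (2 * (2 + B)) * norm (cis s - cis t)" by simp
      also have "\<dots> \<le> \<epsilon> * norm (cis s - cis t)" by (intro mult_right_mono \<eta>(3)) simp
      finally show "norm (F (cis s) - F (cis t) - g t * (cis s - cis t)) \<le> \<epsilon> * norm (cis s - cis t)" .
    qed (use d1 d2 d3 in auto)
  qed
  \<comment> \<open>The differentiation lemma covers the open interval only, so both endpoints join
    the exceptional set.\<close>
  have "negligible (insert 0 (insert (2*pi) (N1 \<union> N2)))" using N1(1) N2(1) by simp
  moreover have "{t. \<not> (t \<in> {0..2*pi} \<longrightarrow> (\<exists>c. ((\<lambda>r::real. f (of_real r * cis t)) \<longlongrightarrow> c) (at_left 1)))}
      \<subseteq> insert 0 (insert (2*pi) (N1 \<union> N2))"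
  proof (rule subsetI, rule ccontr)
    fix t assume t: "t \<in> {t. \<not> (t \<in> {0..2*pi} \<longrightarrow> (\<exists>c. ((\<lambda>r::real. f (of_real r * cis t)) \<longlongrightarrow> c) (at_left 1)))}"
      and n: "t \<notin> insert 0 (insert (2*pi) (N1 \<union> N2))"
    then have "t \<in> {0<..<2*pi} - (N1 \<union> N2)" by auto
    from lim[OF this] t show False by blast
  qed
  ultimately have "AE t in lebesgue. t \<in> {0..2*pi} \<longrightarrow> (\<exists>c. ((\<lambda>r::real. f (of_real r * cis t)) \<longlongrightarrow> c) (at_left 1))"
    unfolding eventually_ae_filter_negligible by blast
  then show ?thesis by (simp only: AE_completion_iff)
qed

section \<open>Model spaces\<close>

lemma hinf_dvd_imp_range:
  assumes "hinf_dvd w u" "w \<in> Hinf" "u \<in> Hinf" shows "mul u x \<in> range (mul w)"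
proof -
  obtain q where q: "q \<in> Hinf" "\<And>z. norm z < 1 \<Longrightarrow> u z = w z * q z" using assms(1) unfolding hinf_dvd_def by auto
  have "mul u x = mul w (mul q x)" by (rule fn_eqI) (use q assms in simp)
  then show ?thesis by blast
qed

text \<open>Fatou's theorem supplies the radial limits of \<psi>, of modulus at most 1. They are at
  least 1 in modulus because the cofactor \<open>h\<close> is contractive while \<theta> and \<phi>
  have unimodular limits.\<close>

lemma inner_fn_divisor:
  assumes \<psi>: "isom_mult \<psi>" and h: "isom_mult h" and "inner_fn \<theta>" "inner_fn \<phi>"
    and e: "\<And>z. norm z < 1 \<Longrightarrow> \<theta> z * \<phi> z = \<psi> z * h z"
  shows "inner_fn \<psi>"
  unfolding inner_fn_def
proof
  show "\<psi> \<in> Hinf" using \<psi> by simp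
  have "AE t in lborel. t \<in> {0..2*pi} \<longrightarrow> (\<exists>c. ((\<lambda>r::real. \<psi> (of_real r * cis t)) \<longlongrightarrow> c) (at_left 1))"
    by (rule fatou) (use \<psi> in simp)
  moreover have "AE t in lborel. t \<in> {0..2*pi} \<longrightarrow>
      (\<exists>\<zeta>. ((\<lambda>r::real. \<theta> (of_real r * cis t)) \<longlongrightarrow> \<zeta>) (at_left 1) \<and> norm \<zeta> = 1)"
    "AE t in lborel. t \<in> {0..2*pi} \<longrightarrow>
      (\<exists>\<zeta>. ((\<lambda>r::real. \<phi> (of_real r * cis t)) \<longlongrightarrow> \<zeta>) (at_left 1) \<and> norm \<zeta> = 1)"
    using assms by (auto simp: inner_fn_def)
  ultimately show "AE t in lborel. t \<in> {0..2*pi} \<longrightarrow>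
      (\<exists>\<zeta>. ((\<lambda>r::real. \<psi> (of_real r * cis t)) \<longlongrightarrow> \<zeta>) (at_left 1) \<and> norm \<zeta> = 1)"
  proof eventually_elim
    case (elim t)
    show ?case
    proof
      assume t: "t \<in> {0..2*pi}"
      obtain c where c: "((\<lambda>r::real. \<psi> (of_real r * cis t)) \<longlongrightarrow> c) (at_left 1)" using elim t by blast
      obtain x where x: "((\<lambda>r::real. \<theta> (of_real r * cis t)) \<longlongrightarrow> x) (at_left 1)" "norm x = 1" using elim t by blast
      obtain y where y: "((\<lambda>r::real. \<phi> (of_real r * cis t)) \<longlongrightarrow> y) (at_left 1)" "norm y = 1" using elim t by blast
      have ev: "eventually (\<lambda>r::real. norm (of_real r * cis t) < 1) (at_left 1)"
        using eventually_at_left_real[of 0 "1::real"] by (auto elim!: eventually_mono simp: norm_mult)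
      have "norm c \<le> 1"
      proof (rule tendsto_upperbound[OF tendsto_norm[OF c]])
        show "eventually (\<lambda>r::real. norm (\<psi> (of_real r * cis t)) \<le> 1) (at_left 1)"
          using ev by eventually_elim (rule isom_mult_le_1[OF \<psi>])
      qed simp
      moreover have "norm x * norm y \<le> norm c"
      proof (rule tendsto_le[OF _ tendsto_norm[OF c] tendsto_mult[OF tendsto_norm[OF x(1)] tendsto_norm[OF y(1)]]])
        show "eventually (\<lambda>r::real. norm (\<theta> (of_real r * cis t)) * norm (\<phi> (of_real r * cis t)) \<le> norm (\<psi> (of_real r * cis t))) (at_left 1)"
          using ev
        proof eventually_elim
          case (elim r)
          have "norm (\<theta> (of_real r * cis t)) * norm (\<phi> (of_real r * cis t)) = norm (\<psi> (of_real r * cis t)) * norm (h (of_real r * cis t))"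
            using e[OF elim] by (simp flip: norm_mult)
          also have "\<dots> \<le> norm (\<psi> (of_real r * cis t)) * 1"
            by (intro mult_left_mono isom_mult_le_1[OF h elim]) simp
          finally show ?case by simp
        qed
      qed simp
      ultimately show "\<exists>\<zeta>. ((\<lambda>r::real. \<psi> (of_real r * cis t)) \<longlongrightarrow> \<zeta>) (at_left 1) \<and> norm \<zeta> = 1"
        using c x y by (intro exI[of _ c]) auto
    qed
  qed
qed

lemma lcim_exists:
  assumes "inner_fn \<theta>" "inner_fn \<phi>"
  obtains \<psi> where "isom_mult \<psi>" "is_lcim \<psi> \<theta> \<phi>" "mul \<psi> one \<in> range (mul \<theta>)" "mul \<psi> one \<in> range (mul \<phi>)"
proof -
  have \<theta>: "isom_mult \<theta>" and \<phi>: "isom_mult \<phi>" using assms by (auto intro: inner_fn_isom_mult)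
  have H: "\<theta> \<in> Hinf" "\<phi> \<in> Hinf" using \<theta> \<phi> by auto
  define M where "M = range (mul \<theta>) \<inter> range (mul \<phi>)"
  have clM: "closed M" unfolding M_def by (intro closed_Int closed_range_mul \<theta> \<phi>)
  have subM: "hinf_sub M"
    using hinf_sub_range[OF H(1)] hinf_sub_range[OF H(2)] unfolding M_def hinf_sub_def by (auto intro: subspace_inter)
  \<comment> \<open>The product of \<theta> and \<phi> makes the intersection nonzero, as Beurling's
    theorem requires, and later serves as the multiple from which \<psi> inherits unimodular
    limits.\<close>
  have mem: "mul (\<lambda>z. \<theta> z * \<phi> z) one \<in> M"
    using H mul_mul[OF H, of one] mul_mul[OF H(2,1), of one] unfolding M_def
    by (metis (no_types, lifting) IntI mul_commute rangeI)
  have iso: "isom_mult (\<lambda>z. \<theta> z * \<phi> z)" by (rule isom_mult_mult[OF \<theta> \<phi>])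
  have "mul (\<lambda>z. \<theta> z * \<phi> z) one \<noteq> 0"
  proof
    assume "mul (\<lambda>z. \<theta> z * \<phi> z) one = 0"
    then have "one = 0" using iso by (metis isom_mult_def norm_eq_zero)
    then show False using fn_one[of 0] by simp
  qed
  then obtain \<psi> where \<psi>: "isom_mult \<psi>" "M = range (mul \<psi>)" using beurling[OF clM subM mem] by blast
  have "hinf_dvd \<psi> (\<lambda>z. \<theta> z * \<phi> z)" using mem \<psi> H by (intro range_mul_hinf_dvd) auto
  then obtain h where h: "h \<in> Hinf" "\<And>z. norm z < 1 \<Longrightarrow> \<theta> z * \<phi> z = \<psi> z * h z" unfolding hinf_dvd_def by auto
  have isoh: "isom_mult h" by (rule isom_mult_cofactor[OF \<psi>(1) iso h])
  have in\<psi>: "inner_fn \<psi>" by (rule inner_fn_divisor[OF \<psi>(1) isoh assms h(2)])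
  have rng: "mul \<psi> one \<in> range (mul \<theta>)" "mul \<psi> one \<in> range (mul \<phi>)" using \<psi>(2) unfolding M_def by auto
  have "is_lcim \<psi> \<theta> \<phi>"
    unfolding is_lcim_def
  proof (intro conjI allI impI in\<psi>)
    show "hinf_dvd \<theta> \<psi>" "hinf_dvd \<phi> \<psi>" using rng \<theta> \<phi> \<psi> by (auto intro: range_mul_hinf_dvd)
    fix w assume w: "inner_fn w \<and> hinf_dvd \<theta> w \<and> hinf_dvd \<phi> w"
    then have wH: "w \<in> Hinf" by (simp add: inner_fn_def)
    have "mul w one \<in> M" using w wH H unfolding M_def by (auto intro: hinf_dvd_imp_range)
    then show "hinf_dvd \<psi> w" using \<psi> wH by (intro range_mul_hinf_dvd) auto
  qed
  then show ?thesis using that \<psi>(1) rng by blast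
qed

text \<open>A common inner divisor has a closed range containing the whole ideal, hence also
  \<open>one\<close>.\<close>

lemma is_gcid_one:
  assumes "v \<in> Hinf" "isom_mult \<psi>" "one \<in> closure (ideal (mul v one) \<psi>)"
  shows "is_gcid (\<lambda>_. 1) v \<psi>"
  unfolding is_gcid_def
proof (intro conjI allI impI)
  have "((\<lambda>r::real. 1 :: complex) \<longlongrightarrow> 1) (at_left 1)" by simp
  then show "inner_fn (\<lambda>_. 1)" unfolding inner_fn_def by (auto intro!: exI[of _ 1])
  show "hinf_dvd (\<lambda>_. 1) v" "hinf_dvd (\<lambda>_. 1) \<psi>"
    using assms unfolding hinf_dvd_def by (auto intro: bexI[of _ v] bexI[of _ \<psi>])
  fix w assume w: "inner_fn w \<and> hinf_dvd w v \<and> hinf_dvd w \<psi>"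
  then have iso: "isom_mult w" by (auto intro: inner_fn_isom_mult)
  then have wH: "w \<in> Hinf" by simp
  have "ideal (mul v one) \<psi> \<subseteq> range (mul w)"
    using w assms wH by (intro ideal_subset hinf_sub_range) (auto intro: hinf_dvd_imp_range)
  then have "one \<in> range (mul w)"
    using assms(3) closure_minimal[OF _ closed_range_mul[OF iso]] by blast
  then show "hinf_dvd w (\<lambda>_. 1)" by (intro range_mul_hinf_dvd iso) simp_all
qed

section \<open>Orthogonal complements, projections and compressions\<close>

definition perp :: "(complex \<Rightarrow> complex) \<Rightarrow> h2 set" where
  "perp w = {a. \<forall>b. inner a (mul w b) = 0}"

text \<open>The orthogonal projection, characterized as the representative in \<open>perp w\<close>
  of a class modulo the range of \<open>w\<close>. Statements about compressions thereby become
  congruences.\<close>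

definition model_proj :: "(complex \<Rightarrow> complex) \<Rightarrow> h2 \<Rightarrow> h2" where
  "model_proj w a = (THE p. p \<in> perp w \<and> a - p \<in> range (mul w))"

lemma subspace_perp: "subspace (perp w)"
  unfolding subspace_def perp_def by (auto simp: inner_simps)

lemma closed_perp: "closed (perp w)"
proof -
  have "perp w = (\<Inter>b. {a. inner a (mul w b) = 0})" by (auto simp: perp_def)
  moreover have "closed {a. inner a (mul w b) = 0}" for b
    by (intro closed_Collect_eq continuous_intros)
  ultimately show ?thesis by auto
qed

lemma perp_range: "a \<in> perp w \<Longrightarrow> a \<in> range (mul w) \<Longrightarrow> a = 0"
  unfolding perp_def by (metis (mono_tags, lifting) imageE inner_eq_zero_iff mem_Collect_eq)

lemma model_proj_unique:
  assumes "w \<in> Hinf" "p \<in> perp w" "a - p \<in> range (mul w)" shows "model_proj w a = p"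
  unfolding model_proj_def
proof (rule the_equality)
  fix q assume q: "q \<in> perp w \<and> a - q \<in> range (mul w)"
  have "q - p \<in> perp w" using q assms by (intro subspace_diff subspace_perp) auto
  moreover have "(a - p) - (a - q) \<in> range (mul w)"
    by (rule subspace_diff[OF subspace_range_mul[OF assms(1)]]) (use q assms in blast)+
  then have "q - p \<in> range (mul w)" by simp
  ultimately have "q - p = 0" by (rule perp_range)
  then show "q = p" by simp
qed (use assms in blast)

lemma model_proj:
  assumes "isom_mult w" shows "model_proj w a \<in> perp w" "a - model_proj w a \<in> range (mul w)"
proof -
  have wH: "w \<in> Hinf" using assms by simp
  obtain q where q: "q \<in> range (mul w)" "\<And>k. k \<in> range (mul w) \<Longrightarrow> inner (a - q) k = 0"
    using orthogonal_projection_exists[OF closed_range_mul[OF assms] subspace_range_mul[OF wH]] by blast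
  have "a - q \<in> perp w" using q(2) by (simp add: perp_def)
  moreover from this have "model_proj w a = a - q" by (rule model_proj_unique[OF wH]) (use q in simp)
  ultimately show "model_proj w a \<in> perp w" "a - model_proj w a \<in> range (mul w)" using q by simp_all
qed

lemma model_proj_perp: "w \<in> Hinf \<Longrightarrow> a \<in> perp w \<Longrightarrow> model_proj w a = a"
  by (rule model_proj_unique) (auto intro!: range_eqI[of _ _ 0])

lemma model_proj_eq_iff:
  assumes "isom_mult w" shows "model_proj w a = model_proj w b \<longleftrightarrow> a - b \<in> range (mul w)"
proof
  have wH: "w \<in> Hinf" using assms by simp
  assume "model_proj w a = model_proj w b"
  then have "(a - model_proj w a) - (b - model_proj w b) = a - b" by simp
  then show "a - b \<in> range (mul w)"
    using model_proj(2)[OF assms] subspace_diff[OF subspace_range_mul[OF wH]] by metis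
next
  have wH: "w \<in> Hinf" using assms by simp
  assume "a - b \<in> range (mul w)"
  then have "(a - b) + (b - model_proj w b) \<in> range (mul w)"
    by (intro subspace_add subspace_range_mul wH model_proj assms)
  then show "model_proj w a = model_proj w b" by (intro model_proj_unique wH model_proj assms) simp
qed

lemma bounded_linear_model_proj:
  assumes "isom_mult w" shows "bounded_linear (model_proj w)"
proof (rule bounded_linear_intro[where K = 1])
  have wH: "w \<in> Hinf" using assms by simp
  show "model_proj w (a + b) = model_proj w a + model_proj w b" for a b
  proof (rule model_proj_unique[OF wH])
    have "(a - model_proj w a) + (b - model_proj w b) \<in> range (mul w)"
      by (intro subspace_add subspace_range_mul wH model_proj assms)
    then show "a + b - (model_proj w a + model_proj w b) \<in> range (mul w)" by (simp add: algebra_simps)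
  qed (intro subspace_add subspace_perp model_proj assms)
  show "model_proj w (r *\<^sub>R a) = r *\<^sub>R model_proj w a" for r a
  proof (rule model_proj_unique[OF wH])
    have "r *\<^sub>R (a - model_proj w a) \<in> range (mul w)"
      by (intro subspace_scale subspace_range_mul wH model_proj assms)
    then show "r *\<^sub>R a - r *\<^sub>R model_proj w a \<in> range (mul w)" by (simp add: algebra_simps)
  qed (intro subspace_scale subspace_perp model_proj assms)
  show "norm (model_proj w a) \<le> norm a * 1" for a
  proof -
    obtain b where b: "a - model_proj w a = mul w b" using model_proj(2)[OF assms] by blast
    have "inner (model_proj w a) (a - model_proj w a) = 0"
      unfolding b using model_proj(1)[OF assms, of a] by (simp add: perp_def)
    then have "(norm (model_proj w a))\<^sup>2 = inner (model_proj w a) a"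
      by (simp add: power2_norm_eq_inner inner_simps)
    also have "\<dots> \<le> norm (model_proj w a) * norm a" by (rule norm_cauchy_schwarz)
    finally have "norm (model_proj w a) * norm (model_proj w a) \<le> norm (model_proj w a) * norm a"
      by (simp add: power2_eq_square)
    then show ?thesis by (cases "model_proj w a = 0") auto
  qed
qed

text \<open>The range of \<open>w\<close> is invariant under multipliers, so multiplication descends
  to the quotient.\<close>

lemma model_proj_mul:
  assumes "isom_mult w" "u \<in> Hinf" "a - b \<in> range (mul w)"
  shows "model_proj w (mul u a) = model_proj w (mul u b)"
proof -
  have "mul u (a - b) \<in> range (mul w)"
    using hinf_sub_range[of w] assms unfolding hinf_sub_def by auto
  then show ?thesis using assms by (simp add: model_proj_eq_iff mul_diff)
qed

lemma Im_h2_inner_fn: "Im (h2_inner (fn a) (fn b)) = inner a (mul (\<lambda>_. \<i>) b)"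
proof -
  have "h2_inner (fn a) (fn (mul (\<lambda>_. \<i>) b)) = - \<i> * h2_inner (fn a) (fn b)"
    unfolding h2_inner_fn hcoeff_mul_const suminf_mult[OF summable_hcoeff_cnj, symmetric]
    by (intro suminf_cong) simp
  then have "Re (h2_inner (fn a) (fn (mul (\<lambda>_. \<i>) b))) = Im (h2_inner (fn a) (fn b))" by simp
  then show ?thesis by (simp only: Re_h2_inner_fn)
qed

text \<open>Replacing \<open>k\<close> by its multiple by \<i> exposes the imaginary part, so real
  orthogonality to all of \<open>K\<close> is complex orthogonality.\<close>

lemma h2_inner_eq_0_iff:
  assumes "\<And>k. k \<in> K \<Longrightarrow> mul (\<lambda>_. \<i>) k \<in> K"
  shows "(\<forall>k\<in>K. h2_inner (fn a) (fn k) = 0) \<longleftrightarrow> (\<forall>k\<in>K. inner a k = 0)"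
  using assms by (auto simp: complex_eq_iff Re_h2_inner_fn Im_h2_inner_fn)

lemma model_space_eq:
  assumes "w \<in> Hinf" shows "model_space w = fn ` perp w"
proof -
  have "(\<forall>g\<in>H2. h2_inner (fn a) (\<lambda>z. w z * g z) = 0) \<longleftrightarrow> (\<forall>k\<in>range (mul w). h2_inner (fn a) (fn k) = 0)" for a
    unfolding H2_eq_range_fn using assms by (simp add: fn_mul_eq)
  also have "\<dots> a \<longleftrightarrow> (\<forall>k\<in>range (mul w). inner a k = 0)" for a
    by (rule h2_inner_eq_0_iff) (use assms hinf_sub_range in \<open>auto simp: hinf_sub_def\<close>)
  finally have "(\<forall>g\<in>H2. h2_inner (fn a) (\<lambda>z. w z * g z) = 0) \<longleftrightarrow> a \<in> perp w" for a
    by (simp add: perp_def)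
  then show ?thesis unfolding model_space_def H2_eq_range_fn by blast
qed

lemma perp_mul_const:
  assumes "w \<in> Hinf" "a \<in> perp w" shows "mul (\<lambda>_. c) a \<in> perp w"
  using assms by (simp add: perp_def inner_mul_const mul_commute[of "\<lambda>_. cnj c" w])

lemma proj_model_space:
  assumes w: "isom_mult w" shows "proj (model_space w) (fn a) = fn (model_proj w a)"
proof -
  have wH: "w \<in> Hinf" using w by simp
  have iff: "(\<forall>k\<in>model_space w. h2_inner (\<lambda>z. fn a z - fn b z) k = 0) \<longleftrightarrow> (\<forall>k\<in>perp w. inner (a - b) k = 0)" for b
  proof -
    have "(\<lambda>z. fn a z - fn b z) = fn (a - b)" by auto
    then show ?thesis unfolding model_space_eq[OF wH]
      using h2_inner_eq_0_iff[of "perp w" "a - b"] perp_mul_const[OF wH] by simp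
  qed
  show ?thesis
    unfolding proj_def
  proof (rule the_equality)
    have "\<forall>k\<in>perp w. inner (a - model_proj w a) k = 0"
      using model_proj(2)[OF w, of a] by (auto simp: perp_def inner_commute)
    then show "fn (model_proj w a) \<in> model_space w \<and> (\<forall>k\<in>model_space w. h2_inner (\<lambda>z. fn a z - fn (model_proj w a) z) k = 0)"
      unfolding iff using model_proj(1)[OF w] model_space_eq[OF wH] by auto
  next
    fix p assume p: "p \<in> model_space w \<and> (\<forall>k\<in>model_space w. h2_inner (\<lambda>z. fn a z - p z) k = 0)"
    then obtain b where b: "p = fn b" "b \<in> perp w" unfolding model_space_eq[OF wH] by blast
    have o: "\<forall>k\<in>perp w. inner (a - b) k = 0" using p unfolding b iff by blast
    have "\<forall>k\<in>perp w. inner (a - model_proj w a) k = 0"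
      using model_proj(2)[OF w, of a] by (auto simp: perp_def inner_commute)
    moreover have d: "model_proj w a - b \<in> perp w" by (intro subspace_diff subspace_perp model_proj w b)
    ultimately have "inner ((a - b) - (a - model_proj w a)) (model_proj w a - b) = 0"
      using o unfolding inner_diff_left by simp
    then have "model_proj w a - b = 0" by simp
    then show "p = fn (model_proj w a)" by (simp add: b)
  qed
qed

lemma compr_fn:
  assumes "isom_mult w" "u \<in> Hinf" shows "compr w u (fn a) = fn (model_proj w (mul u a))"
  unfolding compr_def using proj_model_space[OF assms(1), of "mul u a"] assms(2) by (simp add: fn_mul_eq)

section \<open>The lifted graph of an intertwining map\<close>

locale intertwiner =
  fixes \<theta> \<phi> :: "complex \<Rightarrow> complex" and D :: "(complex \<Rightarrow> complex) set"
    and X :: "(complex \<Rightarrow> complex) \<Rightarrow> (complex \<Rightarrow> complex)"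
  assumes iso\<theta>: "isom_mult \<theta>" and iso\<phi>: "isom_mult \<phi>"
    and dl: "dense_linear (model_space \<theta>) (model_space \<phi>) D X"
    and tw: "\<forall>u\<in>Hinf. intertwines D X (compr \<phi> u) (compr \<theta> u)"
begin

lemma \<theta>H: "\<theta> \<in> Hinf" and \<phi>H: "\<phi> \<in> Hinf"
  using iso\<theta> iso\<phi> by auto

definition Y :: "h2 \<Rightarrow> h2" where "Y a = of_fn (X (fn a))"

text \<open>The preimage of the graph of \<open>X\<close> under the two projections; it is a union
  of cosets of \<theta> H^2 times \<phi> H^2.\<close>

definition G :: "(h2 \<times> h2) set" where
  "G = {(f, g). fn (model_proj \<theta> f) \<in> D \<and> model_proj \<phi> g = Y (model_proj \<theta> f)}"

lemma D_sub: "D \<subseteq> fn ` perp \<theta>"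
  and X_mem: "\<And>f. f \<in> D \<Longrightarrow> X f \<in> fn ` perp \<phi>"
  and D_plus: "\<And>f g. f \<in> D \<Longrightarrow> g \<in> D \<Longrightarrow> (\<lambda>z. f z + g z) \<in> D"
  and D_cmult: "\<And>f c. f \<in> D \<Longrightarrow> (\<lambda>z. c * f z) \<in> D"
  and X_plus: "\<And>f g. f \<in> D \<Longrightarrow> g \<in> D \<Longrightarrow> X (\<lambda>z. f z + g z) = (\<lambda>z. X f z + X g z)"
  and X_cmult: "\<And>f c. f \<in> D \<Longrightarrow> X (\<lambda>z. c * f z) = (\<lambda>z. c * X f z)"
  and D_0: "(\<lambda>_. 0) \<in> D"
  and D_dense: "\<And>f e. f \<in> fn ` perp \<theta> \<Longrightarrow> 0 < e \<Longrightarrow> \<exists>d\<in>D. h2_norm (\<lambda>z. f z - d z) < e"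
proof -
  note * = dl[unfolded dense_linear_def model_space_eq[OF \<theta>H] model_space_eq[OF \<phi>H]]
  from * show "D \<subseteq> fn ` perp \<theta>" by (elim conjE)
  from * have "\<forall>f\<in>D. X f \<in> fn ` perp \<phi>" by (elim conjE)
  then show "\<And>f. f \<in> D \<Longrightarrow> X f \<in> fn ` perp \<phi>" by (rule bspec)
  from * have "\<forall>f\<in>D. \<forall>g\<in>D. (\<lambda>z. f z + g z) \<in> D" by (elim conjE)
  then show "\<And>f g. f \<in> D \<Longrightarrow> g \<in> D \<Longrightarrow> (\<lambda>z. f z + g z) \<in> D" by blast
  from * have "\<forall>c. \<forall>f\<in>D. (\<lambda>z. c * f z) \<in> D" by (elim conjE)
  then show "\<And>f c. f \<in> D \<Longrightarrow> (\<lambda>z. c * f z) \<in> D" by blast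
  from * have "\<forall>f\<in>D. \<forall>g\<in>D. X (\<lambda>z. f z + g z) = (\<lambda>z. X f z + X g z)" by (elim conjE)
  then show "\<And>f g. f \<in> D \<Longrightarrow> g \<in> D \<Longrightarrow> X (\<lambda>z. f z + g z) = (\<lambda>z. X f z + X g z)" by blast
  from * have "\<forall>c. \<forall>f\<in>D. X (\<lambda>z. c * f z) = (\<lambda>z. c * X f z)" by (elim conjE)
  then show "\<And>f c. f \<in> D \<Longrightarrow> X (\<lambda>z. c * f z) = (\<lambda>z. c * X f z)" by blast
  from * show "(\<lambda>_. 0) \<in> D" by (elim conjE)
  from * have "\<forall>f\<in>fn ` perp \<theta>. \<forall>e>0. \<exists>d\<in>D. h2_norm (\<lambda>z. f z - d z) < e" by (elim conjE)
  then show "\<And>f e. f \<in> fn ` perp \<theta> \<Longrightarrow> 0 < e \<Longrightarrow> \<exists>d\<in>D. h2_norm (\<lambda>z. f z - d z) < e" by blast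
qed

lemma D_perp: "fn a \<in> D \<Longrightarrow> a \<in> perp \<theta>"
proof -
  assume "fn a \<in> D"
  then obtain b where "b \<in> perp \<theta>" "fn a = fn b" using D_sub by blast
  then show "a \<in> perp \<theta>" by (simp add: fn_inject)
qed

lemma D_range: "d \<in> D \<Longrightarrow> \<exists>a. d = fn a"
  using D_sub by blast

lemma fn_Y: "fn a \<in> D \<Longrightarrow> fn (Y a) = X (fn a)" and Y_perp: "fn a \<in> D \<Longrightarrow> Y a \<in> perp \<phi>"
proof -
  assume "fn a \<in> D"
  then obtain b where "b \<in> perp \<phi>" "X (fn a) = fn b" using X_mem by blast
  then show "fn (Y a) = X (fn a)" "Y a \<in> perp \<phi>" by (simp_all add: Y_def)
qed

lemma D_add: "fn a \<in> D \<Longrightarrow> fn b \<in> D \<Longrightarrow> fn (a + b) \<in> D"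
proof -
  assume ab: "fn a \<in> D" "fn b \<in> D"
  have "fn (a + b) = (\<lambda>z. fn a z + fn b z)" by auto
  then show "fn (a + b) \<in> D" using D_plus[OF ab] by simp
qed

lemma Y_add: "fn a \<in> D \<Longrightarrow> fn b \<in> D \<Longrightarrow> Y (a + b) = Y a + Y b"
proof -
  assume ab: "fn a \<in> D" "fn b \<in> D"
  have "fn (a + b) = (\<lambda>z. fn a z + fn b z)" by auto
  then have "fn (Y (a + b)) = (\<lambda>z. X (fn a) z + X (fn b) z)"
    using fn_Y[OF D_add[OF ab]] X_plus[OF ab] by simp
  also have "\<dots> = fn (Y a + Y b)" by (auto simp: fn_Y ab)
  finally show "Y (a + b) = Y a + Y b" by (simp add: fn_inject)
qed

lemma D_scale: "fn a \<in> D \<Longrightarrow> fn (r *\<^sub>R a) \<in> D"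
proof -
  assume a: "fn a \<in> D"
  have "fn (r *\<^sub>R a) = (\<lambda>z. of_real r * fn a z)" by auto
  then show "fn (r *\<^sub>R a) \<in> D" using D_cmult[OF a] by simp
qed

lemma Y_scale: "fn a \<in> D \<Longrightarrow> Y (r *\<^sub>R a) = r *\<^sub>R Y a"
proof -
  assume a: "fn a \<in> D"
  have "fn (r *\<^sub>R a) = (\<lambda>z. of_real r * fn a z)" by auto
  then have "fn (Y (r *\<^sub>R a)) = (\<lambda>z. of_real r * X (fn a) z)"
    using fn_Y[OF D_scale[OF a]] X_cmult[OF a] by simp
  also have "\<dots> = fn (r *\<^sub>R Y a)" by (auto simp: fn_Y a)
  finally show "Y (r *\<^sub>R a) = r *\<^sub>R Y a" by (simp add: fn_inject)
qed

lemma D_zero: "fn 0 \<in> D"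
proof -
  have "fn 0 = (\<lambda>_. 0)" by auto
  then show ?thesis using D_0 by simp
qed

lemma Y_zero: "Y 0 = 0"
  using Y_scale[OF D_zero, of 0] by simp

lemma model_proj_range [simp]:
  "model_proj \<theta> (mul \<theta> h) = 0" "model_proj \<phi> (mul \<phi> h) = 0"
  by (auto intro!: model_proj_unique \<theta>H \<phi>H simp: perp_def)

text \<open>The intertwining relations for all compressions say that the lifted graph is invariant
  under multiplication. Single-valuedness over \<theta> H^2 reflects that \<open>X\<close> maps 0 to
  0.\<close>

sublocale module_graph \<theta> \<phi> G
proof
  show "isom_mult \<theta>" "isom_mult \<phi>" by (fact iso\<theta> iso\<phi>)+
  interpret P\<theta>: bounded_linear "model_proj \<theta>" by (rule bounded_linear_model_proj[OF iso\<theta>])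
  interpret P\<phi>: bounded_linear "model_proj \<phi>" by (rule bounded_linear_model_proj[OF iso\<phi>])
  show "mul_inv G"
    unfolding mul_inv_def
  proof (intro conjI ballI allI impI)
    show "subspace G"
      unfolding subspace_def G_def
      by (auto simp: zero_prod_def P\<theta>.zero P\<phi>.zero P\<theta>.add P\<phi>.add P\<theta>.scaleR P\<phi>.scaleR D_zero Y_zero Y_add Y_scale
          intro: D_add D_scale)
    fix u f g assume u: "u \<in> Hinf" and fg: "(f, g) \<in> G"
    define a where "a = model_proj \<theta> f"
    have aD: "fn a \<in> D" and gY: "model_proj \<phi> g = Y a" using fg by (auto simp: G_def a_def)
    have 1: "model_proj \<theta> (mul u f) = model_proj \<theta> (mul u a)"
      unfolding a_def by (intro model_proj_mul iso\<theta> u model_proj)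
    have 2: "model_proj \<phi> (mul u g) = model_proj \<phi> (mul u (Y a))"
      unfolding gY[symmetric] by (intro model_proj_mul iso\<phi> u model_proj)
    have t: "compr \<theta> u (fn a) \<in> D" "compr \<phi> u (X (fn a)) = X (compr \<theta> u (fn a))"
      using tw u aD unfolding intertwines_def by auto
    have c: "compr \<theta> u (fn a) = fn (model_proj \<theta> (mul u a))" by (rule compr_fn[OF iso\<theta> u])
    have "fn (model_proj \<phi> (mul u (Y a))) = X (fn (model_proj \<theta> (mul u a)))"
      using t(2) compr_fn[OF iso\<phi> u, of "Y a"] fn_Y[OF aD] c by simp
    then have "model_proj \<phi> (mul u (Y a)) = Y (model_proj \<theta> (mul u a))" unfolding Y_def by (metis of_fn_fn)
    then show "(mul u f, mul u g) \<in> G" using t(1) c 1 2 by (simp add: G_def)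
  qed
  show "(mul \<theta> h, mul \<phi> k) \<in> G" for h k by (simp add: G_def D_zero Y_zero)
  show "g \<in> range (mul \<phi>)" if "(mul \<theta> h, g) \<in> G" for h g
    using that model_proj(2)[OF iso\<phi>, of g] by (simp add: G_def Y_zero)
  show "closure (fst ` G) = UNIV"
  proof -
    have "f \<in> closure (fst ` G)" for f
      unfolding closure_approachable
    proof (intro allI impI)
      fix e :: real assume e: "e > 0"
      define p where "p = model_proj \<theta> f"
      have "fn p \<in> fn ` perp \<theta>" unfolding p_def using model_proj(1)[OF iso\<theta>] by blast
      then obtain d where d: "d \<in> D" "h2_norm (\<lambda>z. fn p z - d z) < e"
        using D_dense e by blast
      obtain a where a: "d = fn a" using D_range d(1) by blast
      have aD: "fn a \<in> D" using a d by simp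
      have "(\<lambda>z. fn p z - d z) = fn (p - a)" by (auto simp: a)
      then have n: "norm (p - a) < e" using d(2) by (simp add: h2_norm_fn)
      \<comment> \<open>Only the component in the model space needs approximation; the component of
        \<open>f\<close> in \<theta> H^2 is kept unchanged.\<close>
      have "model_proj \<theta> (a + (f - p)) = a"
        by (intro model_proj_unique \<theta>H D_perp aD) (simp add: p_def model_proj[OF iso\<theta>])
      then have "(a + (f - p), Y a) \<in> G"
        using aD model_proj_perp[OF \<phi>H Y_perp[OF aD]] by (simp add: G_def)
      then have "a + (f - p) \<in> fst ` G" by force
      moreover have "dist (a + (f - p)) f < e" using n by (simp add: dist_norm norm_minus_commute)
      ultimately show "\<exists>y\<in>fst ` G. dist y f < e" by blast
    qed
    then show ?thesis by blast
  qed
qed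

text \<open>Lifting loses nothing under closure: projecting a convergent sequence of
  \<open>G\<close> gives one in the graph of \<open>X\<close>, with the same limit as soon as that
  limit lies in the model spaces.\<close>

lemma graph_closure_iff:
  "(fn f, fn g) \<in> graph_closure (graph_of D X) \<longleftrightarrow> f \<in> perp \<theta> \<and> g \<in> perp \<phi> \<and> (f, g) \<in> closure G"
proof
  assume "(fn f, fn g) \<in> graph_closure (graph_of D X)"
  then obtain s where s: "\<And>n. s n \<in> graph_of D X" "(\<lambda>n. h2_norm (\<lambda>z. fst (s n) z - fn f z)) \<longlonglongrightarrow> 0"
    "(\<lambda>n. h2_norm (\<lambda>z. snd (s n) z - fn g z)) \<longlonglongrightarrow> 0"
    unfolding graph_closure_def by blast
  have "\<exists>a. fn a \<in> D \<and> s n = (fn a, fn (Y a))" for n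
    using s(1)[of n] D_range unfolding graph_of_def by (auto simp: fn_Y) (metis fn_Y)
  then obtain a where a: "\<And>n. fn (a n) \<in> D" "\<And>n. s n = (fn (a n), fn (Y (a n)))" by metis
  have e: "(\<lambda>z. fn x z - fn y z) = fn (x - y)" for x y by auto
  have l: "a \<longlonglongrightarrow> f" "(\<lambda>n. Y (a n)) \<longlonglongrightarrow> g"
    using s(2,3) by (simp_all add: a(2) e h2_norm_fn tendsto_norm_zero_iff LIM_zero_iff)
  have "f \<in> perp \<theta>" using closed_sequentially[OF closed_perp _ l(1)] D_perp a by blast
  moreover have "g \<in> perp \<phi>" using closed_sequentially[OF closed_perp _ l(2)] Y_perp a by blast
  moreover have "(f, g) \<in> closure G"
  proof (rule closureI_sequentially)
    show "(a n, Y (a n)) \<in> G" for n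
      using a(1)[of n] model_proj_perp[OF \<theta>H D_perp[OF a(1)[of n]]] model_proj_perp[OF \<phi>H Y_perp[OF a(1)[of n]]]
      by (simp add: G_def)
    show "(\<lambda>n. (a n, Y (a n))) \<longlonglongrightarrow> (f, g)" by (intro tendsto_Pair l)
  qed
  ultimately show "f \<in> perp \<theta> \<and> g \<in> perp \<phi> \<and> (f, g) \<in> closure G" by blast
next
  assume fg: "f \<in> perp \<theta> \<and> g \<in> perp \<phi> \<and> (f, g) \<in> closure G"
  then obtain x where x: "\<And>n. x n \<in> G" "x \<longlonglongrightarrow> (f, g)" unfolding closure_sequential by blast
  define a where "a n = model_proj \<theta> (fst (x n))" for n
  have aD: "fn (a n) \<in> D" and Ya: "model_proj \<phi> (snd (x n)) = Y (a n)" for n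
    using x(1)[of n] by (auto simp: G_def a_def split: prod.splits)
  have "a \<longlonglongrightarrow> model_proj \<theta> f"
    unfolding a_def by (rule bounded_linear.tendsto[OF bounded_linear_model_proj[OF iso\<theta>]]) (use tendsto_fst[OF x(2)] in simp)
  then have l1: "a \<longlonglongrightarrow> f" using fg by (simp add: model_proj_perp \<theta>H)
  have "(\<lambda>n. Y (a n)) \<longlonglongrightarrow> model_proj \<phi> g"
    unfolding Ya[symmetric] by (rule bounded_linear.tendsto[OF bounded_linear_model_proj[OF iso\<phi>]]) (use tendsto_snd[OF x(2)] in simp)
  then have l2: "(\<lambda>n. Y (a n)) \<longlonglongrightarrow> g" using fg by (simp add: model_proj_perp \<phi>H)
  have e: "(\<lambda>z. fn x z - fn y z) = fn (x - y)" for x y by auto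
  have "\<forall>n. (fn (a n), fn (Y (a n))) \<in> graph_of D X"
    using aD by (auto simp: graph_of_def fn_Y)
  moreover have "(\<lambda>n. h2_norm (\<lambda>z. fst (fn (a n), fn (Y (a n))) z - fn f z)) \<longlonglongrightarrow> 0"
    "(\<lambda>n. h2_norm (\<lambda>z. snd (fn (a n), fn (Y (a n))) z - fn g z)) \<longlonglongrightarrow> 0"
    using tendsto_norm_zero[OF LIM_zero[OF l1]] tendsto_norm_zero[OF LIM_zero[OF l2]]
    by (simp_all add: e h2_norm_fn)
  ultimately show "(fn f, fn g) \<in> graph_closure (graph_of D X)"
    unfolding graph_closure_def using fn_in_H2
    by (auto intro!: exI[of _ "\<lambda>n. (fn (a n), fn (Y (a n)))"])
qed

lemma graph_closure_fn:
  "(f, g) \<in> graph_closure (graph_of D X) \<Longrightarrow> \<exists>a b. f = fn a \<and> g = fn b"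
  unfolding graph_closure_def H2_eq_range_fn by auto

lemma closable: "closable D X"
  unfolding closable_def
proof (intro allI impI, elim conjE)
  fix f g1 g2 assume g: "(f, g1) \<in> graph_closure (graph_of D X)" "(f, g2) \<in> graph_closure (graph_of D X)"
  then obtain a b c where abc: "f = fn a" "g1 = fn b" "g2 = fn c"
    using graph_closure_fn by (metis fn_inject)
  have *: "b \<in> perp \<phi>" "c \<in> perp \<phi>" "(a, b) \<in> closure G" "(a, c) \<in> closure G"
    using g unfolding abc graph_closure_iff by auto
  have "(a, b) - (a, c) \<in> closure G" by (rule subspace_diff[OF subspace_closure[OF subspace_G] *(3,4)])
  then have "(mul \<theta> 0, b - c) \<in> closure G" using \<theta>H by simp
  then have "b - c \<in> range (mul \<phi>)" by (rule closure_single)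
  moreover have "b - c \<in> perp \<phi>" by (intro subspace_diff subspace_perp *)
  ultimately have "b - c = 0" by (intro perp_range)
  then show "g1 = g2" by (simp add: abc)
qed

text \<open>If \<open>v\<close> times \<open>a - b\<close> lies in \<phi> H^2, then the pair with
  first entry 0 and second entry \<open>a - b\<close> is in the closure of \<open>G\<close>; so
  injectivity is again single-valuedness.\<close>

lemma closure_formula:
  assumes v: "v \<in> Hinf" and u: "u \<in> Hinf" and rep: "closure G = {(f, g). mul v g - mul u f \<in> range (mul \<phi>)}"
  shows "inj_on (compr \<phi> v) (model_space \<phi>)"
    and "graph_closure (graph_of D X) =
         {(f, g). f \<in> model_space \<theta> \<and> g \<in> model_space \<phi> \<and>
                  compr \<phi> v g = compr \<phi> u (proj (model_space \<phi>) f)}"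
proof -
  show "inj_on (compr \<phi> v) (model_space \<phi>)"
  proof (rule inj_onI)
    fix x y assume "x \<in> model_space \<phi>" "y \<in> model_space \<phi>" and e: "compr \<phi> v x = compr \<phi> v y"
    then obtain a b where ab: "x = fn a" "y = fn b" "a \<in> perp \<phi>" "b \<in> perp \<phi>"
      unfolding model_space_eq[OF \<phi>H] by blast
    have "mul v a - mul v b \<in> range (mul \<phi>)"
      using e by (simp add: ab compr_fn iso\<phi> v fn_inject model_proj_eq_iff)
    then have "(mul \<theta> 0, a - b) \<in> closure G" unfolding rep using u v \<theta>H by (simp add: mul_diff)
    then have "a - b \<in> range (mul \<phi>)" by (rule closure_single)
    moreover have "a - b \<in> perp \<phi>" by (intro subspace_diff subspace_perp ab)
    ultimately have "a - b = 0" by (intro perp_range)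
    then show "x = y" by (simp add: ab)
  qed
  have eq: "compr \<phi> v (fn b) = compr \<phi> u (proj (model_space \<phi>) (fn a)) \<longleftrightarrow> (a, b) \<in> closure G" for a b
  proof -
    \<comment> \<open>Projecting \<open>a\<close> first changes it by an element of \<phi> H^2 only,
      so the compression of \<open>u\<close> does not notice it.\<close>
    have e: "model_proj \<phi> (mul u (model_proj \<phi> a)) = model_proj \<phi> (mul u a)"
      by (rule model_proj_mul[OF iso\<phi> u, symmetric]) (rule model_proj(2)[OF iso\<phi>])
    show ?thesis
      unfolding proj_model_space[OF iso\<phi>] compr_fn[OF iso\<phi> v] compr_fn[OF iso\<phi> u] fn_inject rep
        e model_proj_eq_iff[OF iso\<phi>] by simp
  qed
  show "graph_closure (graph_of D X) =
         {(f, g). f \<in> model_space \<theta> \<and> g \<in> model_space \<phi> \<and>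
                  compr \<phi> v g = compr \<phi> u (proj (model_space \<phi>) f)}" (is "?L = ?R")
  proof (rule set_eqI, clarify)
    fix f g
    show "(f, g) \<in> ?L \<longleftrightarrow> (f, g) \<in> ?R"
    proof
      assume fg: "(f, g) \<in> ?L"
      then obtain a b where ab: "f = fn a" "g = fn b" using graph_closure_fn by blast
      then have *: "a \<in> perp \<theta>" "b \<in> perp \<phi>" "(a, b) \<in> closure G"
        using fg by (simp_all add: graph_closure_iff)
      then have "fn a \<in> model_space \<theta>" "fn b \<in> model_space \<phi>"
        by (simp_all add: model_space_eq \<theta>H \<phi>H)
      then show "(f, g) \<in> ?R" using *(3) by (simp add: ab eq)
    next
      assume fg: "(f, g) \<in> ?R"
      then obtain a b where ab: "f = fn a" "g = fn b" "a \<in> perp \<theta>" "b \<in> perp \<phi>"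
        using model_space_eq[OF \<theta>H] model_space_eq[OF \<phi>H] by blast
      then have "(a, b) \<in> closure G" using fg by (simp add: eq)
      then show "(f, g) \<in> ?L" using ab by (simp add: graph_closure_iff)
    qed
  qed
qed

end

text \<open>The inverse of the compression of \<open>v\<close> is expressed by injectivity together
  with an equation between \<open>f\<close> and \<open>g\<close>. The equality of graphs thus also
  fixes the domain of the closure: those \<open>f\<close> for which the right side lies in the range
  of \<open>compr \<phi> v\<close> on the model space.\<close>

theorem theorem4p10:
  fixes \<theta> \<phi> :: "complex \<Rightarrow> complex"
    and D :: "(complex \<Rightarrow> complex) set"
    and X :: "(complex \<Rightarrow> complex) \<Rightarrow> (complex \<Rightarrow> complex)"
  assumes "inner_fn \<theta>" and "nonconstant_on_disc \<theta>"
    and "inner_fn \<phi>" and "nonconstant_on_disc \<phi>"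
    and "dense_linear (model_space \<theta>) (model_space \<phi>) D X"
    and "\<forall>u\<in>Hinf. intertwines D X (compr \<phi> u) (compr \<theta> u)"
  shows "closable D X \<and>
    (\<exists>u\<in>Hinf. \<exists>v\<in>Hinf.
       hinf_dvd \<phi> (\<lambda>z. u z * \<theta> z) \<and>
       (\<exists>\<psi>. is_lcim \<psi> \<theta> \<phi> \<and> is_gcid (\<lambda>_. 1) v \<psi>) \<and>
       inj_on (compr \<phi> v) (model_space \<phi>) \<and>
       graph_closure (graph_of D X) =
         {(f, g). f \<in> model_space \<theta> \<and> g \<in> model_space \<phi> \<and>
                  compr \<phi> v g = compr \<phi> u (proj (model_space \<phi>) f)})"
proof -
  interpret intertwiner \<theta> \<phi> D X
    by unfold_locales (use assms in \<open>auto intro: inner_fn_isom_mult\<close>)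
  obtain \<psi> where \<psi>: "isom_mult \<psi>" "is_lcim \<psi> \<theta> \<phi>" "mul \<psi> one \<in> range (mul \<theta>)" "mul \<psi> one \<in> range (mul \<phi>)"
    using lcim_exists[OF assms(1,3)] by blast
  obtain v u where vu: "v \<in> Hinf" "u \<in> Hinf" "one \<in> closure (ideal (mul v one) \<psi>)"
    "mul \<theta> (mul u one) \<in> range (mul \<phi>)"
    "closure G = {(f, g). mul v g - mul u f \<in> range (mul \<phi>)}"
    using closure_representation[OF \<psi>(1,3,4)] by blast
  have "hinf_dvd \<phi> (\<lambda>z. u z * \<theta> z)"
  proof (rule range_mul_hinf_dvd[OF iso\<phi>])
    have "mul \<theta> (mul u one) = mul (\<lambda>z. u z * \<theta> z) one"
      using mul_mul[OF \<theta>H vu(2)] by (simp add: mult.commute)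
    then show "mul (\<lambda>z. u z * \<theta> z) one \<in> range (mul \<phi>)" using vu(4) by simp
  qed (use \<theta>H vu in simp)
  moreover have "is_gcid (\<lambda>_. 1) v \<psi>" by (rule is_gcid_one[OF vu(1) \<psi>(1) vu(3)])
  ultimately show ?thesis
    using closable closure_formula[OF vu(1,2,5)] \<psi>(2) vu(1,2) by blast
qed

end
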